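(* (i) For any $d\ge 4$, $\mu^s(2,d)=\mu(2,d)=5$. (ii) For any $d\ge 4$, $\rho^s(2,d)=\rho(2,d)=d+1$. (iii) For any $d\ge 4$ and any integer $r$ with $5\le r\le d+1$, there exists $I\in\mathcal{T}^s(2,d)$ with $\mu(I)=r$.
   Context: $k$ is an algebraically closed field of characteristic zero and $R=k[x_0,\dots,x_n]$. Togliatti systems. Let $I\subset R$ be a homogeneous artinian ideal generated by $r$ forms $F_1,\dots,F_r$ of degree $d$, with $r\le\binom{n+d-1}{n-1}$. $I$ is a Togliatti system (of forms of degree $d$) if it satisfies the following (known to be equivalent) conditions: (1) $I$ fails the weak Lefschetz property in degree $d-1$, i.e. for a general linear form $L$ the multiplication map $\times L:(R/I)_{d-1}\to(R/I)_d$ does not have maximal rank (is neither injective nor surjective); (2) $F_1,\dots,F_r$ become $k$-linearly dependent on a general hyperplane of $\mathbb{P}^n$; (3) the variety $X$ associated to $I$ satisfies at least one Laplace equation of order $d-1$, i.e. its $(d-1)$-st osculating space at a general point has dimension less than $\binom{n+d-1}{d-1}-1$. It is monomial if $I$ is generated by monomials. For a monomial $I$, $X$ is the closure of the image of the rational map $\mathbb{P}^n\dashrightarrow\mathbb{P}^{\binom{n+d}{d}-r-1}$ given by all monomials of degree $d$ not in $I$ (here $r$ is the minimal number of generators). A monomial Togliatti system is smooth if $X$ is a smooth variety. It is minimal if, $I$ being generated by monomials $m_1,\dots,m_r$ of degree $d$, no proper subset of $\{m_1,\dots,m_r\}$ generates a monomial Togliatti system. $\mu(I)$ is the minimal number of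 generators of $I$. $\mathcal{T}(n,d)$ is the set of all minimal monomial Togliatti systems $I\subset k[x_0,\dots,x_n]$ of forms of degree $d$, and $\mathcal{T}^s(n,d)\subset\mathcal{T}(n,d)$ the subset of the smooth ones. $\mu(n,d)$ and $\rho(n,d)$ are respectively the minimum and the maximum of $\{\mu(I)\mid I\in\mathcal{T}(n,d)\}$; $\mu^s(n,d)$ and $\rho^s(n,d)$ are respectively the minimum and the maximum of $\{\mu(I)\mid I\in\mathcal{T}^s(n,d)\}$. *)

theory Defs
  imports
    "HOL-Library.Poly_Mapping"
    "HOL-Library.Function_Algebras"
    "HOL-Library.Extended_Nat"
    "HOL-Computational_Algebra.Polynomial"
    "HOL-Algebra.QuotRing"
begin

section \<open>Polynomial rings over a set of variables\<close>

text \<open>A monomial is its finitely supported exponent function; a polynomial is a finitely supported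
  function from monomials to coefficients, multiplied by convolution.  Variables range over a set
  \<open>V\<close>, so that both \<open>k[x_0,\<dots>,x_n]\<close> (\<open>V = {..n}\<close>) and the coordinate ring of the target projective
  space, whose variables are indexed by monomials, are instances.\<close>

type_synonym 'v expo = "'v \<Rightarrow>\<^sub>0 nat"
type_synonym ('v, 'k) mpol = "('v \<Rightarrow>\<^sub>0 nat) \<Rightarrow>\<^sub>0 'k"

definition mpoly_ring :: "'v set \<Rightarrow> ('v, 'k::field) mpol ring" where
  "mpoly_ring V = \<lparr>carrier = {p. \<forall>m \<in> Poly_Mapping.keys p. Poly_Mapping.keys m \<subseteq> V},
     monoid.mult = (*), one = 1, ring.zero = 0, add = (+)\<rparr>"

lemma cring_mpoly_ring: "cring (mpoly_ring V :: ('v, 'k::field) mpol ring)"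
proof -
  define C where "C = {p :: ('v, 'k) mpol. \<forall>m \<in> Poly_Mapping.keys p. Poly_Mapping.keys m \<subseteq> V}"
  have R: "mpoly_ring V = \<lparr>carrier = C, monoid.mult = (*), one = 1, ring.zero = 0, add = (+)\<rparr>"
    by (simp add: mpoly_ring_def C_def)
  have add: "p + q \<in> C" if "p \<in> C" "q \<in> C" for p q
    using that Poly_Mapping.keys_add[of p q] unfolding C_def by blast
  have mult: "p * q \<in> C" if p: "p \<in> C" and q: "q \<in> C" for p q
    unfolding C_def
  proof (intro CollectI ballI)
    fix m assume "m \<in> Poly_Mapping.keys (p * q)"
    then obtain a b where "m = a + b" "a \<in> Poly_Mapping.keys p" "b \<in> Poly_Mapping.keys q"
      using Poly_Mapping.keys_mult[of p q] by blast
    then show "Poly_Mapping.keys m \<subseteq> V"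
      using p q Poly_Mapping.keys_add[of a b] unfolding C_def by blast
  qed
  have const: "0 \<in> C" "1 \<in> C"
    by (simp_all add: C_def)
  have uminus: "- p \<in> C" if "p \<in> C" for p
    using that by (simp add: C_def)
  have add_inv: "\<exists>y \<in> C. p + y = 0" if "p \<in> C" for p
    using uminus[OF that] by (intro bexI[of _ "- p"]) simp_all
  show ?thesis
    unfolding R
  proof (rule cringI)
    show "abelian_group \<lparr>carrier = C, monoid.mult = (*), one = 1, ring.zero = 0, add = (+)\<rparr>"
      by (rule abelian_groupI) (simp_all add: add const add_inv ac_simps)
    show "Group.comm_monoid \<lparr>carrier = C, monoid.mult = (*), one = 1, ring.zero = 0, add = (+)\<rparr>"
      by (rule comm_monoidI) (simp_all add: mult const ac_simps)
  qed (simp add: distrib_right)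
qed

definition tdeg :: "'v expo \<Rightarrow> nat" where
  "tdeg m = (\<Sum>i \<in> Poly_Mapping.keys m. Poly_Mapping.lookup m i)"

definition expos :: "'v set \<Rightarrow> nat \<Rightarrow> 'v expo set" where
  "expos V d = {m. Poly_Mapping.keys m \<subseteq> V \<and> tdeg m = d}"

definition forms :: "'v set \<Rightarrow> nat \<Rightarrow> ('v, 'k::field) mpol set" where
  "forms V d = {p. Poly_Mapping.keys p \<subseteq> expos V d}"

definition mono_val :: "'v expo \<Rightarrow> ('v \<Rightarrow> 'k::field) \<Rightarrow> 'k" where
  "mono_val m a = (\<Prod>i \<in> Poly_Mapping.keys m. a i ^ Poly_Mapping.lookup m i)"

definition eval_mpol :: "('v, 'k::field) mpol \<Rightarrow> ('v \<Rightarrow> 'k) \<Rightarrow> 'k" where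
  "eval_mpol p a = (\<Sum>m \<in> Poly_Mapping.keys p. Poly_Mapping.lookup p m * mono_val m a)"

text \<open>The formal derivative with respect to the variable \<open>j\<close>; subtraction of exponents is truncated,
  but the terms in which this matters have coefficient \<open>0\<close>.\<close>

definition pdiff :: "'v \<Rightarrow> ('v, 'k::field) mpol \<Rightarrow> ('v, 'k) mpol" where
  "pdiff j p = (\<Sum>m \<in> Poly_Mapping.keys p.
     Poly_Mapping.single (m - Poly_Mapping.single j 1)
       (of_nat (Poly_Mapping.lookup m j) * Poly_Mapping.lookup p m))"


section \<open>Projective varieties\<close>

text \<open>\<open>\<P>(k^V)\<close> is described by homogeneous coordinates: a subset of it is represented by the set of all
  the nonzero vectors representing its points.  Vectors of \<open>k^V\<close> are functions vanishing outside \<open>V\<close>.\<close>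

definition vecs :: "'v set \<Rightarrow> ('v \<Rightarrow> 'k::field) set" where
  "vecs V = {p. \<forall>i. i \<notin> V \<longrightarrow> p i = 0}"

definition proj_closed :: "'v set \<Rightarrow> ('v \<Rightarrow> 'k::field) set \<Rightarrow> bool" where
  "proj_closed V Z \<longleftrightarrow>
     (\<exists>T \<subseteq> (\<Union>e. forms V e). Z = {p \<in> vecs V - {0}. \<forall>F \<in> T. eval_mpol F p = 0})"

definition proj_irreducible :: "'v set \<Rightarrow> ('v \<Rightarrow> 'k::field) set \<Rightarrow> bool" where
  "proj_irreducible V Z \<longleftrightarrow> proj_closed V Z \<and> Z \<noteq> {} \<and>
     (\<forall>A B. proj_closed V A \<and> proj_closed V B \<and> Z = A \<union> B \<longrightarrow> Z = A \<or> Z = B)"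

definition proj_dim :: "'v set \<Rightarrow> ('v \<Rightarrow> 'k::field) set \<Rightarrow> enat" where
  "proj_dim V X = Sup {enat m | m. \<exists>Z :: nat \<Rightarrow> ('v \<Rightarrow> 'k) set.
     (\<forall>i \<le> m. proj_irreducible V (Z i) \<and> Z i \<subseteq> X) \<and> (\<forall>i < m. Z i \<subset> Z (Suc i))}"

text \<open>The tangent space at \<open>p\<close> to the affine cone over \<open>X\<close>, that is, the kernel of the Jacobian matrix
  of the homogeneous ideal of \<open>X\<close>.  Its projectivization is the embedded tangent space of \<open>X\<close>
  at \<open>p\<close>.\<close>

definition cone_tangent :: "'v set \<Rightarrow> ('v \<Rightarrow> 'k::field) set \<Rightarrow> ('v \<Rightarrow> 'k) \<Rightarrow> ('v \<Rightarrow> 'k) set" where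
  "cone_tangent V X p = {v \<in> vecs V. \<forall>F \<in> (\<Union>e. forms V e).
     (\<forall>q \<in> X. eval_mpol F q = 0) \<longrightarrow> (\<Sum>j \<in> V. eval_mpol (pdiff j F) p * v j) = 0}"

definition fun_scale :: "'k::field \<Rightarrow> ('v \<Rightarrow> 'k) \<Rightarrow> 'v \<Rightarrow> 'k" where
  "fun_scale c v = (\<lambda>i. c * v i)"

lemma vector_space_fun_scale: "vector_space (fun_scale :: 'k::field \<Rightarrow> ('v \<Rightarrow> 'k) \<Rightarrow> 'v \<Rightarrow> 'k)"
  by unfold_locales (auto simp: fun_scale_def fun_eq_iff algebra_simps)

text \<open>Jacobian criterion for a variety (irreducible, so that its dimension is the same at all of its
  points).  The summand \<open>1\<close> comes from passing to the affine cone.\<close>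

definition smooth_variety :: "'v set \<Rightarrow> ('v \<Rightarrow> 'k::field) set \<Rightarrow> bool" where
  "smooth_variety V X \<longleftrightarrow> proj_irreducible V X \<and>
     (\<forall>p \<in> X. enat (vector_space.dim fun_scale (cone_tangent V X p)) = proj_dim V X + 1)"

text \<open>The closure of the image of the rational map to \<open>\<P>(k^M)\<close> given by a finite set \<open>M\<close> of monomials of
  the same degree, defined where these monomials do not all vanish.\<close>

definition monomial_variety :: "'v expo set \<Rightarrow> ('v expo \<Rightarrow> 'k::field) set" where
  "monomial_variety M =
     proj_closed M hull ({\<lambda>m. if m \<in> M then mono_val m a else 0 | a. True} - {0})"


section \<open>Togliatti systems\<close>

definition artinian_ring :: "('a, 'b) ring_scheme \<Rightarrow> bool" where
  "artinian_ring A \<longleftrightarrow> ring A \<and> (\<forall>J :: nat \<Rightarrow> 'a set.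
     (\<forall>i. ideal (J i) A \<and> J (Suc i) \<subseteq> J i) \<longrightarrow> (\<exists>m. \<forall>i \<ge> m. J i = J m))"

abbreviation PR :: "nat \<Rightarrow> (nat, 'k::field) mpol ring" where
  "PR n \<equiv> mpoly_ring {..n}"

definition lin_form :: "nat \<Rightarrow> (nat \<Rightarrow> 'k::field) \<Rightarrow> (nat, 'k) mpol" where
  "lin_form n a = (\<Sum>i \<le> n. Poly_Mapping.single (Poly_Mapping.single i 1) (a i))"

text \<open>A property holds for a general linear form if it holds on a nonempty Zariski open set of
  coefficient vectors; equivalently, on the complement of a hypersurface \<open>G = 0\<close>.\<close>

definition general_lin_form :: "nat \<Rightarrow> ((nat, 'k::field) mpol \<Rightarrow> bool) \<Rightarrow> bool" where
  "general_lin_form n P \<longleftrightarrow>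
     (\<exists>G \<in> carrier (PR n). G \<noteq> 0 \<and> (\<forall>a. eval_mpol G a \<noteq> 0 \<longrightarrow> P (lin_form n a)))"

definition quot_piece :: "nat \<Rightarrow> (nat, 'k::field) mpol set \<Rightarrow> nat \<Rightarrow> (nat, 'k) mpol set set" where
  "quot_piece n I j = (\<lambda>F. I +>\<^bsub>PR n\<^esub> F) ` forms {..n} j"

definition mult_map :: "nat \<Rightarrow> (nat, 'k::field) mpol set \<Rightarrow> (nat, 'k) mpol
    \<Rightarrow> (nat, 'k) mpol set \<Rightarrow> (nat, 'k) mpol set" where
  "mult_map n I L c = (I +>\<^bsub>PR n\<^esub> L) \<otimes>\<^bsub>PR n Quot I\<^esub> c"

definition fails_WLP :: "nat \<Rightarrow> (nat, 'k::field) mpol set \<Rightarrow> nat \<Rightarrow> bool" where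
  "fails_WLP n I j \<longleftrightarrow> general_lin_form n (\<lambda>L.
     \<not> inj_on (mult_map n I L) (quot_piece n I j) \<and>
     mult_map n I L ` quot_piece n I j \<noteq> quot_piece n I (Suc j))"

text \<open>Of the three equivalent conditions defining Togliatti systems, the failure of the weak Lefschetz
  property is taken as the definition.  Because of the subtractions on \<^typ>\<open>nat\<close>, this is meant
  for \<open>n \<ge> 1\<close> and \<open>d \<ge> 1\<close>.\<close>

definition togliatti :: "nat \<Rightarrow> nat \<Rightarrow> (nat, 'k::field) mpol set \<Rightarrow> bool" where
  "togliatti n d I \<longleftrightarrow>
     (\<exists>S \<subseteq> forms {..n} d. finite S \<and> card S \<le> (n + d - 1) choose (n - 1) \<and> I = Idl\<^bsub>PR n\<^esub> S) \<and>
     artinian_ring (PR n Quot I) \<and>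
     fails_WLP n I (d - 1)"

definition monomials :: "nat \<Rightarrow> nat \<Rightarrow> (nat, 'k::field) mpol set" where
  "monomials n d = (\<lambda>m. Poly_Mapping.single m 1) ` expos {..n} d"

text \<open>The set \<open>\<T>(n,d)\<close>.\<close>

definition Tog :: "nat \<Rightarrow> nat \<Rightarrow> (nat, 'k::field) mpol set set" where
  "Tog n d = {I. togliatti n d I \<and>
     (\<exists>S \<subseteq> monomials n d. I = Idl\<^bsub>PR n\<^esub> S \<and> (\<forall>S'. S' \<subset> S \<longrightarrow> \<not> togliatti n d (Idl\<^bsub>PR n\<^esub> S')))}"

definition assoc_expos :: "nat \<Rightarrow> nat \<Rightarrow> (nat, 'k::field) mpol set \<Rightarrow> nat expo set" where
  "assoc_expos n d I = {m \<in> expos {..n} d. Poly_Mapping.single m 1 \<notin> I}"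

definition assoc_variety :: "nat \<Rightarrow> nat \<Rightarrow> (nat, 'k::field) mpol set \<Rightarrow> (nat expo \<Rightarrow> 'k) set" where
  "assoc_variety n d I = monomial_variety (assoc_expos n d I)"

text \<open>The set \<open>\<T>\<^sup>s(n,d)\<close>.\<close>

definition Tog_smooth :: "nat \<Rightarrow> nat \<Rightarrow> (nat, 'k::field) mpol set set" where
  "Tog_smooth n d = {I \<in> Tog n d. smooth_variety (assoc_expos n d I) (assoc_variety n d I)}"

definition num_gens :: "nat \<Rightarrow> (nat, 'k::field) mpol set \<Rightarrow> nat" where
  "num_gens n I =
     (LEAST r. \<exists>S \<subseteq> carrier (PR n). finite S \<and> card S = r \<and> I = Idl\<^bsub>PR n\<^esub> S)"

definition mu_min :: "'k::field itself \<Rightarrow> nat \<Rightarrow> nat \<Rightarrow> nat" where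
  "mu_min _ n d = Min (num_gens n ` (Tog n d :: (nat, 'k) mpol set set))"

definition rho_max :: "'k::field itself \<Rightarrow> nat \<Rightarrow> nat \<Rightarrow> nat" where
  "rho_max _ n d = Max (num_gens n ` (Tog n d :: (nat, 'k) mpol set set))"

definition mu_min_smooth :: "'k::field itself \<Rightarrow> nat \<Rightarrow> nat \<Rightarrow> nat" where
  "mu_min_smooth _ n d = Min (num_gens n ` (Tog_smooth n d :: (nat, 'k) mpol set set))"

definition rho_max_smooth :: "'k::field itself \<Rightarrow> nat \<Rightarrow> nat \<Rightarrow> nat" where
  "rho_max_smooth _ n d = Max (num_gens n ` (Tog_smooth n d :: (nat, 'k) mpol set set))"

end

theory Submission
  imports Defs
begin

text \<open>By the torus action, a monomial ideal containing \<open>x\<^sup>d\<close>, \<open>y\<^sup>d\<close>, \<open>z\<^sup>d\<close> and generated by at most \<open>d + 1\<close> monomials of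
  degree \<open>d\<close> is a Togliatti system only if these monomials are linearly dependent on the line \<open>x + y + z = 0\<close>. Comparing
  coefficients shows that \<open>x\<^sup>d\<close>, \<open>y\<^sup>d\<close>, \<open>z\<^sup>d\<close> and one more monomial are independent there when \<open>d \<ge> 4\<close>, so that at
  least five generators are needed; the upper bound \<open>d + 1\<close> is part of the definition.

  Examples come from the syzygy \<open>z\<^sup>e = (- x - y)\<^sup>e\<close>, multiplied by a monomial \<open>m\<close>. The choice \<open>e = 1\<close>, \<open>m = z\<^bsup>d-1\<^esup>\<close> gives five
  generators. For \<open>6 \<le> r \<le> d + 1\<close> take \<open>e = r - 5\<close> and \<open>m = x\<^bsup>d-e-2\<^esup> y z\<close>; as \<open>m\<close> is divisible by \<open>x\<^sup>2 y z\<close>, no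
  combination of \<open>x\<^sup>d\<close>, \<open>y\<^sup>d\<close>, \<open>z\<^sup>d\<close> can occur in a relation, which gives minimality. The remaining monomials contain all
  boundary points of a truncated triangle and enough points next to its vertices, so the toric surface is covered by
  charts isomorphic to the affine plane.\<close>

section \<open>Evaluation and derivatives of polynomials\<close>

text \<open>Dimension is the length of a chain of irreducible closed sets, and smoothness refers to
  the Jacobian of all forms vanishing on the variety, so both are computed directly. Counting
  monomials bounds chains. Binomial equations bound a tangent space from above, explicit curves from
  below. Closed conditions are tested along polynomial curves, where infinitely many zeros
  annihilate a univariate polynomial; this also reaches points outside the torus.

  The two families of examples cannot be merged. For \<open>e = r - 5 = 0\<close> the syzygy is
  trivial, so \<open>r = 5\<close> needs another one; with m = z^(d-1) its term z^d is already a
  corner, which leaves 3 + 2 monomials. For r >= 6 there are 3 corners, e + 1 terms of the binomial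
  expansion and the term with z^e, hence e + 5 = r, and r <= d + 1 is exactly what leaves x^2 in m.
  On the line with x = 1 this factor keeps the syzygy below degree d - 1, where a multiple of (x +
  y)^d would still be visible.\<close>

abbreviation "lookup \<equiv> Poly_Mapping.lookup"
abbreviation "keys \<equiv> Poly_Mapping.keys"
abbreviation "single \<equiv> Poly_Mapping.single"

interpretation fs: vector_space "fun_scale :: 'k::field \<Rightarrow> ('v \<Rightarrow> 'k) \<Rightarrow> 'v \<Rightarrow> 'k"
  by (rule vector_space_fun_scale)

lemma poly_mapping_sum_singles:
  fixes p :: "'a \<Rightarrow>\<^sub>0 'b::comm_monoid_add"
  shows "p = (\<Sum>m\<in>keys p. single m (lookup p m))"
  by (rule poly_mapping_eqI)
     (simp add: lookup_sum lookup_single when_def sum.delta in_keys_iff cong: if_cong)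

lemma tdeg_superset:
  assumes "finite A" "keys m \<subseteq> A"
  shows "tdeg m = (\<Sum>i\<in>A. lookup m i)"
  unfolding tdeg_def using assms by (intro sum.mono_neutral_left) (auto simp: in_keys_iff)

lemma tdeg_add [simp]: "tdeg (m + m') = tdeg m + tdeg m'"
proof -
  have "keys (m + m') \<subseteq> keys m \<union> keys m'"
    by (rule Poly_Mapping.keys_add)
  then show ?thesis
    by (simp add: tdeg_superset[of "keys m \<union> keys m'"] lookup_add sum.distrib)
qed

lemma tdeg_single [simp]: "tdeg (single i n) = n"
  by (simp add: tdeg_def)

lemma tdeg_zero [simp]: "tdeg 0 = 0"
  by (simp add: tdeg_def)

lemma tdeg_eq_0_iff [simp]: "tdeg m = 0 \<longleftrightarrow> m = 0"
  by (auto simp: tdeg_def in_keys_iff intro!: poly_mapping_eqI)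

lemma keys_add_nat: "keys (m + m') = keys m \<union> keys (m' :: 'v \<Rightarrow>\<^sub>0 nat)"
  by (auto simp: in_keys_iff lookup_add)

lemma expos_add: "m \<in> expos V d \<Longrightarrow> m' \<in> expos V e \<Longrightarrow> m + m' \<in> expos V (d + e)"
  by (simp add: expos_def keys_add_nat)

lemma finite_expos: assumes "finite V" shows "finite (expos V d)"
proof (rule inj_on_finite[of "\<lambda>m i. lookup m i"])
  show "inj_on lookup (expos V d)"
    by (intro inj_onI poly_mapping_eqI) simp
  show "lookup ` expos V d \<subseteq> {f. \<forall>i. (i \<in> V \<longrightarrow> f i \<in> {..d}) \<and> (i \<notin> V \<longrightarrow> f i = 0)}"
  proof clarsimp
    fix m i assume m: "m \<in> expos V d"
    have "lookup m i \<le> d" if "i \<in> V"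
    proof -
      have "lookup m i \<le> (\<Sum>i\<in>V. lookup m i)"
        using that assms by (intro member_le_sum) auto
      also have "\<dots> = d"
        using m assms tdeg_superset[of V m] by (simp add: expos_def)
      finally show ?thesis .
    qed
    then show "(i \<in> V \<longrightarrow> lookup m i \<le> d) \<and> (i \<notin> V \<longrightarrow> lookup m i = 0)"
      using m by (auto simp: expos_def in_keys_iff)
  qed
  show "finite {f. \<forall>i. (i \<in> V \<longrightarrow> f i \<in> {..d}) \<and> (i \<notin> V \<longrightarrow> f i = (0::nat))}"
    using assms by (intro finite_set_of_finite_funs) auto
qed

lemma mono_val_superset:
  assumes "finite A" "keys m \<subseteq> A"
  shows "mono_val m a = (\<Prod>i\<in>A. a i ^ lookup m i)"
  unfolding mono_val_def using assms by (intro prod.mono_neutral_left) (auto simp: in_keys_iff)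

lemma mono_val_zero [simp]: "mono_val 0 a = 1"
  by (simp add: mono_val_def)

lemma mono_val_single [simp]: "mono_val (single i n) a = a i ^ n"
  by (cases "n = 0") (simp_all add: mono_val_def)

lemma mono_val_add: "mono_val (m + m') a = mono_val m a * mono_val m' a"
  by (simp add: mono_val_superset[of "keys m \<union> keys m'"] keys_add_nat lookup_add power_add
      prod.distrib)

lemma mono_val_scale: "mono_val m (\<lambda>i. c * a i) = c ^ tdeg m * mono_val m a"
  by (simp add: mono_val_def tdeg_def power_mult_distrib prod.distrib power_sum)

lemma eval_mpol_superset:
  assumes "finite A" "keys p \<subseteq> A"
  shows "eval_mpol p a = (\<Sum>m\<in>A. lookup p m * mono_val m a)"
  unfolding eval_mpol_def using assms by (intro sum.mono_neutral_left) (auto simp: in_keys_iff)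

lemma eval_mpol_add [simp]: "eval_mpol (p + q) a = eval_mpol p a + eval_mpol q a"
  using Poly_Mapping.keys_add[of p q]
  by (simp add: eval_mpol_superset[of "keys p \<union> keys q"] lookup_add distrib_right sum.distrib)

lemma eval_mpol_zero [simp]: "eval_mpol 0 a = 0"
  by (simp add: eval_mpol_def)

lemma eval_mpol_uminus [simp]: "eval_mpol (- p) a = - eval_mpol p a"
  by (simp add: eval_mpol_def sum_negf)

lemma eval_mpol_diff [simp]: "eval_mpol (p - q) a = eval_mpol p a - eval_mpol q a"
  using eval_mpol_add[of p "- q" a] by simp

lemma eval_mpol_sum: "eval_mpol (sum f A) a = (\<Sum>x\<in>A. eval_mpol (f x) a)"
  by (induction A rule: infinite_finite_induct) simp_all

lemma eval_mpol_single [simp]: "eval_mpol (single m c) a = c * mono_val m a"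
  by (cases "c = 0") (simp_all add: eval_mpol_def)

lemma mult_eq_sum_singles:
  fixes p q :: "('v, 'k::field) mpol"
  shows "p * q = (\<Sum>m\<in>keys p. \<Sum>m'\<in>keys q. single (m + m') (lookup p m * lookup q m'))"
proof -
  have "p * q = (\<Sum>m\<in>keys p. single m (lookup p m)) * (\<Sum>m\<in>keys q. single m (lookup q m))"
    using poly_mapping_sum_singles[of p] poly_mapping_sum_singles[of q] by simp
  then show ?thesis
    by (simp add: sum_product mult_single)
qed

lemma eval_mpol_mult [simp]: "eval_mpol (p * q) a = eval_mpol p a * eval_mpol q a"
proof -
  have "eval_mpol (p * q) a = (\<Sum>m\<in>keys p. \<Sum>m'\<in>keys q.
      (lookup p m * mono_val m a) * (lookup q m' * mono_val m' a))"
    unfolding mult_eq_sum_singles[of p q] by (simp add: eval_mpol_sum mono_val_add mult_ac)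
  then show ?thesis
    by (simp add: eval_mpol_def sum_product)
qed

lemma eval_mpol_one [simp]: "eval_mpol 1 a = 1"
  using eval_mpol_single[of 0 1 a] by simp

lemma eval_mpol_power [simp]: "eval_mpol (p ^ n) a = eval_mpol p a ^ n"
  by (induction n) simp_all

lemma lookup_mult_sum:
  fixes p q :: "('v, 'k::field) mpol"
  shows "lookup (p * q) k =
    (\<Sum>m\<in>keys p. \<Sum>m'\<in>keys q. if m + m' = k then lookup p m * lookup q m' else 0)"
  unfolding mult_eq_sum_singles[of p q] by (simp add: lookup_sum lookup_single when_def)

lemma lookup_single_mult_add:
  fixes p :: "('v, 'k::field) mpol"
  shows "lookup (single m c * p) (m + k) = c * lookup p k"
proof -
  have "lookup (single m c * p) (m + k) =
      (\<Sum>m'\<in>keys p. if m' = k then c * lookup p m' else 0)"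
    by (cases "c = 0") (simp_all add: lookup_mult_sum)
  also have "\<dots> = c * lookup p k"
    by (simp add: in_keys_iff)
  finally show ?thesis .
qed

lemma forms_add: "p \<in> forms V d \<Longrightarrow> q \<in> forms V d \<Longrightarrow> p + q \<in> forms V d"
  using Poly_Mapping.keys_add[of p q] by (auto simp: forms_def)

lemma forms_zero [simp]: "0 \<in> forms V d"
  by (simp add: forms_def)

lemma forms_uminus: "p \<in> forms V d \<Longrightarrow> - p \<in> forms V d"
  by (simp add: forms_def)

lemma forms_diff: "p \<in> forms V d \<Longrightarrow> q \<in> forms V d \<Longrightarrow> p - q \<in> forms V d"
  using forms_add[of p V d "- q"] by (simp add: forms_uminus)

lemma forms_sum: "(\<And>x. x \<in> A \<Longrightarrow> f x \<in> forms V d) \<Longrightarrow> sum f A \<in> forms V d"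
  by (induction A rule: infinite_finite_induct) (auto intro: forms_add)

lemma forms_single [simp]: "m \<in> expos V d \<Longrightarrow> single m c \<in> forms V d"
  by (simp add: forms_def)

lemma forms_mult: "p \<in> forms V d \<Longrightarrow> q \<in> forms V e \<Longrightarrow> p * q \<in> forms V (d + e)"
  using Poly_Mapping.keys_mult[of p q] by (fastforce simp: forms_def intro: expos_add)

lemma forms_one: "1 \<in> forms V 0"
  by (simp add: forms_def expos_def)

lemma forms_power: "p \<in> forms V d \<Longrightarrow> p ^ n \<in> forms V (n * d)"
  by (induction n) (auto intro: forms_mult forms_one)

lemma forms_prod: 
  "(\<And>x. x \<in> A \<Longrightarrow> f x \<in> forms V (g x)) \<Longrightarrow> prod f A \<in> forms V (sum g A)"
  by (induction A rule: infinite_finite_induct) (auto intro: forms_mult forms_one)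

lemma forms_smult: "p \<in> forms V d \<Longrightarrow> single 0 c * p \<in> forms V d"
  using forms_mult[of "single 0 c" V 0 p d] by (simp add: expos_def)

lemma eval_forms_scale:
  assumes "p \<in> forms V d"
  shows "eval_mpol p (\<lambda>i. c * a i) = c ^ d * eval_mpol p a"
proof -
  have "tdeg m = d" if "m \<in> keys p" for m
    using assms that by (auto simp: forms_def expos_def)
  then show ?thesis
    by (simp add: eval_mpol_def mono_val_scale sum_distrib_left mult_ac)
qed

lemma eval_forms_0:
  assumes "p \<in> forms V d" "d > 0"
  shows "eval_mpol p (\<lambda>i. 0) = 0"
  using eval_forms_scale[OF assms(1), of 0 "\<lambda>i. 0"] assms(2) by (auto simp: zero_power)

text \<open>The pullback of \<open>p\<close> along the polynomial curve \<open>g\<close>. It is an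
  honest univariate polynomial, so it can be differentiated and is determined by its values.\<close>

definition subst_poly :: "('v, 'k::field) mpol \<Rightarrow> ('v \<Rightarrow> 'k poly) \<Rightarrow> 'k poly" where
  "subst_poly p g = (\<Sum>m\<in>keys p. smult (lookup p m) (\<Prod>i\<in>keys m. g i ^ lookup m i))"

lemma poly_subst_poly: "poly (subst_poly p g) t = eval_mpol p (\<lambda>i. poly (g i) t)"
  by (simp add: subst_poly_def eval_mpol_def poly_sum mono_val_def poly_prod)

text \<open>Only \<open>j\<close> in the support of \<open>m\<close> occurs, so the subtraction
  \<open>m - single j 1\<close> is never truncated.\<close>

lemma pderiv_monomial:
  fixes g :: "'v \<Rightarrow> 'k::field poly"
  shows "pderiv (\<Prod>i\<in>keys m. g i ^ lookup m i) =
    (\<Sum>j\<in>keys m. of_nat (lookup m j) * pderiv (g j) *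
       (\<Prod>i\<in>keys m. g i ^ lookup (m - single j 1) i))"
proof -
  have "pderiv (\<Prod>i\<in>keys m. g i ^ lookup m i) =
      (\<Sum>j\<in>keys m. (\<Prod>i\<in>keys m - {j}. g i ^ lookup m i) * pderiv (g j ^ lookup m j))"
    by (rule pderiv_prod)
  also have "\<dots> = (\<Sum>j\<in>keys m. of_nat (lookup m j) * pderiv (g j) *
       (\<Prod>i\<in>keys m. g i ^ lookup (m - single j 1) i))"
  proof (rule sum.cong[OF refl])
    fix j assume j: "j \<in> keys m"
    then obtain n where n: "lookup m j = Suc n"
      by (metis in_keys_iff not0_implies_Suc)
    have "(\<Prod>i\<in>keys m. g i ^ lookup (m - single j 1) i) =
        g j ^ n * (\<Prod>i\<in>keys m - {j}. g i ^ lookup (m - single j 1) i)"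
      using j n by (simp add: prod.remove[of _ j] lookup_minus)
    also have "(\<Prod>i\<in>keys m - {j}. g i ^ lookup (m - single j 1) i) =
        (\<Prod>i\<in>keys m - {j}. g i ^ lookup m i)"
      by (intro prod.cong refl) (auto simp: lookup_minus lookup_single when_def)
    finally show "(\<Prod>i\<in>keys m - {j}. g i ^ lookup m i) * pderiv (g j ^ lookup m j) =
        of_nat (lookup m j) * pderiv (g j) * (\<Prod>i\<in>keys m. g i ^ lookup (m - single j 1) i)"
      by (simp add: n pderiv_power_Suc of_nat_poly mult_ac del: power_Suc)
  qed
  finally show ?thesis .
qed

lemma eval_pdiff:
  "eval_mpol (pdiff j p) a =
    (\<Sum>m\<in>keys p. of_nat (lookup m j) * lookup p m * mono_val (m - single j 1) a)"
  by (simp add: pdiff_def eval_mpol_sum)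

text \<open>The chain rule along the curve \<open>g\<close>. Both halves of the tangent space
  computation reach \<open>pdiff\<close> through it.\<close>

lemma poly_pderiv_subst_poly:
  fixes g :: "'v \<Rightarrow> 'k::field poly"
  assumes "finite V" and p: "\<And>m. m \<in> keys p \<Longrightarrow> keys m \<subseteq> V"
  shows "poly (pderiv (subst_poly p g)) t =
    (\<Sum>j\<in>V. eval_mpol (pdiff j p) (\<lambda>i. poly (g i) t) * poly (pderiv (g j)) t)"
proof -
  define M where "M m j = mono_val (m - single j 1) (\<lambda>i. poly (g i) t)" for m j
  have M: "M m j = poly (\<Prod>i\<in>keys m. g i ^ lookup (m - single j 1) i) t" for m j
  proof -
    have "keys (m - single j 1) \<subseteq> keys m"
      by (auto simp: in_keys_iff lookup_minus)
    then show ?thesis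
      unfolding M_def by (simp add: mono_val_superset[of "keys m"] poly_prod)
  qed
  have "poly (pderiv (subst_poly p g)) t =
      (\<Sum>m\<in>keys p. \<Sum>j\<in>keys m. lookup p m * (of_nat (lookup m j) * poly (pderiv (g j)) t * M m j))"
    by (simp add: subst_poly_def higher_pderiv_sum[of 1, simplified] poly_sum pderiv_smult pderiv_monomial M
        sum_distrib_left of_nat_poly mult_ac)
  also have "\<dots> = (\<Sum>m\<in>keys p. \<Sum>j\<in>V. 
      lookup p m * (of_nat (lookup m j) * poly (pderiv (g j)) t * M m j))"
    using p \<open>finite V\<close> by (intro sum.cong refl sum.mono_neutral_left) (auto simp: in_keys_iff)
  also have "\<dots> = (\<Sum>j\<in>V. \<Sum>m\<in>keys p.
      lookup p m * (of_nat (lookup m j) * poly (pderiv (g j)) t * M m j))"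
    by (rule sum.swap)
  also have "\<dots> = (\<Sum>j\<in>V. eval_mpol (pdiff j p) (\<lambda>i. poly (g i) t) * poly (pderiv (g j)) t)"
    by (simp add: eval_pdiff M_def sum_distrib_right sum_distrib_left mult_ac)
  finally show ?thesis .
qed

text \<open>A field of characteristic zero is infinite. The exceptional set is empty for plain
  identities and \<open>{0}\<close> when a torus coordinate is allowed to degenerate.\<close>

lemma poly_eq_0_if_cofinite:
  fixes p :: "'k::{field_char_0} poly"
  assumes "finite A" "\<And>t. t \<notin> A \<Longrightarrow> poly p t = 0"
  shows "p = 0"
proof (rule ccontr)
  assume "p \<noteq> 0"
  then have "finite {t. poly p t = 0}"
    by (rule poly_roots_finite)
  moreover have "UNIV = A \<union> {t. poly p t = 0}"
    using assms(2) by auto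
  ultimately show False
    using assms(1) infinite_UNIV_char_0[where 'a='k] by (metis finite_UnI)
qed

lemma obtain_nonroot:
  fixes p :: "'k::{field_char_0} poly"
  assumes "p \<noteq> 0"
  obtains t where "poly p t \<noteq> 0"
  using assms poly_eq_0_if_cofinite[of "{}" p] by auto

lemma sum_apply: "(\<Sum>x\<in>A. f x) y = (\<Sum>x\<in>A. (f x y :: 'b::comm_monoid_add))"
  by (induction A rule: infinite_finite_induct) simp_all

text \<open>More vectors than a spanning set has are dependent. The statement is about a family,
  since \<open>g\<close> may repeat a vector; a repetition gives the relation with coefficients 1
  and -1.\<close>

lemma exists_relation:
  fixes g :: "'i \<Rightarrow> ('v \<Rightarrow> 'k::field)"
  assumes "finite A" "finite B" and sp: "\<And>x. x \<in> A \<Longrightarrow> g x \<in> fs.span B" and "card B < card A"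
  shows "\<exists>c. (\<exists>x\<in>A. c x \<noteq> 0) \<and> (\<forall>y. (\<Sum>x\<in>A. c x * g x y) = 0)"
proof (cases "inj_on g A")
  case True
  then have "card (g ` A) > card B"
    using assms by (simp add: card_image)
  then have "fs.dependent (g ` A)"
    using fs.independent_span_bound[of B "g ` A"] assms by auto
  then obtain u where u: "\<exists>v\<in>g ` A. u v \<noteq> 0" "(\<Sum>v\<in>g ` A. fun_scale (u v) v) = 0"
    using fs.dependent_finite[of "g ` A"] assms(1) by auto
  have "(\<Sum>x\<in>A. u (g x) * g x y) = 0" for y
  proof -
    have "(\<Sum>x\<in>A. u (g x) * g x y) = (\<Sum>v\<in>g ` A. fun_scale (u v) v) y"
      using True by (simp add: sum.reindex fun_scale_def sum_apply)
    then show ?thesis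
      using u(2) by simp
  qed
  then show ?thesis
    using u(1) by (intro exI[of _ "u \<circ> g"]) auto
next
  case False
  then obtain x x' where x: "x \<in> A" "x' \<in> A" "x \<noteq> x'" "g x = g x'"
    by (auto simp: inj_on_def)
  define c where "c z = (if z = x then 1 else if z = x' then -1 else (0::'k))" for z
  have "(\<Sum>z\<in>A. c z * g z y) = 0" for y
  proof -
    have "(\<Sum>z\<in>A. c z * g z y) = (\<Sum>z\<in>{x, x'}. c z * g z y)"
      using x assms(1) by (intro sum.mono_neutral_right) (auto simp: c_def)
    then show ?thesis
      using x by (simp add: c_def)
  qed
  then show ?thesis
    using x by (intro exI[of _ c]) (auto simp: c_def)
qed

section \<open>Toric varieties and their dimension\<close>

lemma proj_closedD:
  assumes "proj_closed V Z"
  shows "\<exists>T \<subseteq> (\<Union>e. forms V e).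
    \<forall>p. p \<in> Z \<longleftrightarrow> p \<in> vecs V \<and> p \<noteq> 0 \<and> (\<forall>F\<in>T. eval_mpol F p = 0)"
  using assms unfolding proj_closed_def by auto

lemma proj_closedI:
  assumes "T \<subseteq> (\<Union>e. forms V e)"
    "\<And>p. p \<in> Z \<longleftrightarrow> p \<in> vecs V \<and> p \<noteq> 0 \<and> (\<forall>F\<in>T. eval_mpol F p = 0)"
  shows "proj_closed V Z"
  unfolding proj_closed_def using assms by (intro exI[of _ T]) auto

text \<open>The common zeros of all forms vanishing on \<open>A\<close> are a closed set containing
  \<open>A\<close>; conversely, the forms defining any closed superset of \<open>A\<close> vanish on
  \<open>A\<close>.\<close>

lemma mem_proj_closed_hull:
  assumes "A \<subseteq> vecs V - {0}"
  shows "proj_closed V hull A = {p \<in> vecs V - {0}. \<forall>F \<in> (\<Union>e. forms V e).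
    (\<forall>q\<in>A. eval_mpol F q = 0) \<longrightarrow> eval_mpol F p = 0}" (is "_ = ?R")
proof
  have "proj_closed V ?R"
    unfolding proj_closed_def
    by (intro exI[of _ "{F \<in> (\<Union>e. forms V e). \<forall>q\<in>A. eval_mpol F q = 0}"]) blast
  moreover have "A \<subseteq> ?R"
    using assms by blast
  ultimately show "proj_closed V hull A \<subseteq> ?R"
    by (rule hull_minimal[rotated])
  show "?R \<subseteq> proj_closed V hull A"
  proof
    fix p assume p: "p \<in> ?R"
    have "p \<in> Z" if "proj_closed V Z" "A \<subseteq> Z" for Z
    proof -
      obtain T where T: "T \<subseteq> (\<Union>e. forms V e)"
          "\<forall>p. p \<in> Z \<longleftrightarrow> p \<in> vecs V \<and> p \<noteq> 0 \<and> (\<forall>F\<in>T. eval_mpol F p = 0)"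
        using proj_closedD[OF \<open>proj_closed V Z\<close>] by (elim exE conjE)
      have "eval_mpol F p = 0" if F: "F \<in> T" for F
      proof -
        have "\<forall>q\<in>A. eval_mpol F q = 0"
          using subsetD[OF \<open>A \<subseteq> Z\<close>] F T(2) by simp
        moreover have "F \<in> (\<Union>e. forms V e)"
          using F T(1) by (rule rev_subsetD)
        ultimately show ?thesis
          using p by auto
      qed
      then show ?thesis
        using p T(2) by simp
    qed
    then show "p \<in> proj_closed V hull A"
      by (auto simp: hull_def)
  qed
qed

lemma proj_closed_hull:
  assumes "A \<subseteq> vecs V - {0}"
  shows "proj_closed V (proj_closed V hull A)"
  unfolding mem_proj_closed_hull[OF assms] proj_closed_def
  by (intro exI[of _ "{F \<in> (\<Union>e. forms V e). \<forall>q\<in>A. eval_mpol F q = 0}"]) blast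

lemma proj_closed_Int_zeros:
  assumes "proj_closed V Z" "F \<in> forms V e"
  shows "proj_closed V {z \<in> Z. eval_mpol F z = 0}"
proof -
  obtain T where "T \<subseteq> (\<Union>e. forms V e)"
      "\<forall>p. p \<in> Z \<longleftrightarrow> p \<in> vecs V \<and> p \<noteq> 0 \<and> (\<forall>F\<in>T. eval_mpol F p = 0)"
    using proj_closedD[OF assms(1)] by (elim exE conjE)
  then show ?thesis
    using assms(2) by (intro proj_closedI[of "insert F T"]) auto
qed

lemma proj_irreducible_nonempty: "proj_irreducible V Z \<Longrightarrow> Z \<noteq> {}"
  by (simp add: proj_irreducible_def)

lemma proj_irreducible_closed: "proj_irreducible V Z \<Longrightarrow> proj_closed V Z"
  by (simp add: proj_irreducible_def)

text \<open>The zeros of \<open>F\<close> and of \<open>G\<close> cut \<open>Z\<close> into two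
  closed pieces, one of which must be all of \<open>Z\<close>: the ideal of an irreducible set is
  prime, tested on forms.\<close>

lemma proj_irreducible_prime:
  assumes Z: "proj_irreducible V Z" and F: "F \<in> forms V e" and G: "G \<in> forms V e'"
    and FG: "\<And>z. z \<in> Z \<Longrightarrow> eval_mpol F z = 0 \<or> eval_mpol G z = 0"
  shows "(\<forall>z\<in>Z. eval_mpol F z = 0) \<or> (\<forall>z\<in>Z. eval_mpol G z = 0)"
proof -
  have "Z = {z \<in> Z. eval_mpol F z = 0} \<union> {z \<in> Z. eval_mpol G z = 0}"
    using FG by blast
  moreover have "proj_closed V {z \<in> Z. eval_mpol F z = 0}" "proj_closed V {z \<in> Z. eval_mpol G z = 0}"
    using proj_closed_Int_zeros[OF proj_irreducible_closed[OF Z]] F G by blast+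
  ultimately have "Z = {z \<in> Z. eval_mpol F z = 0} \<or> Z = {z \<in> Z. eval_mpol G z = 0}"
    using Z unfolding proj_irreducible_def by blast
  then show ?thesis
    by blast
qed

lemma proj_closed_separation:
  assumes "proj_closed V A" "p \<in> vecs V - {0}" "p \<notin> A"
  obtains e F where "F \<in> forms V e" "\<And>q. q \<in> A \<Longrightarrow> eval_mpol F q = 0" "eval_mpol F p \<noteq> 0"
proof -
  obtain T where T: "T \<subseteq> (\<Union>e. forms V e)"
      "\<forall>p. p \<in> A \<longleftrightarrow> p \<in> vecs V \<and> p \<noteq> 0 \<and> (\<forall>F\<in>T. eval_mpol F p = 0)"
    using proj_closedD[OF assms(1)] by (elim exE conjE)
  then obtain F where "F \<in> T" "eval_mpol F p \<noteq> 0"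
    using assms(2,3) by auto
  then show ?thesis
    using T that by blast
qed

lemma proj_closed_subset_vecs: "proj_closed V Z \<Longrightarrow> Z \<subseteq> vecs V - {0}"
  unfolding proj_closed_def by blast

section \<open>Closures of images of monomial maps\<close>

definition mono_map :: "'v expo set \<Rightarrow> ('v \<Rightarrow> 'k::field) \<Rightarrow> 'v expo \<Rightarrow> 'k" where
  "mono_map M a = (\<lambda>m. if m \<in> M then mono_val m a else 0)"

text \<open>The parameter set \<open>U\<close> is free so that the smaller members of a chain of
  subvarieties, images of a line or of a point of the plane, come from the same
  construction.\<close>

definition mono_closure :: "'v expo set \<Rightarrow> ('v \<Rightarrow> 'k::field) set \<Rightarrow> ('v expo \<Rightarrow> 'k) set" where
  "mono_closure M U = proj_closed M hull (mono_map M ` U - {0})"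

lemma monomial_variety_eq: "monomial_variety M = mono_closure M UNIV"
  by (simp add: monomial_variety_def mono_closure_def mono_map_def full_SetCompr_eq)

lemma mono_map_in_vecs [simp]: "mono_map M a \<in> vecs M"
  by (simp add: mono_map_def vecs_def)

lemma mono_map_image_subset: "mono_map M ` U - {0} \<subseteq> vecs M - {0}"
  by auto

lemma proj_closed_mono_closure: "proj_closed M (mono_closure M U)"
  unfolding mono_closure_def by (rule proj_closed_hull[OF mono_map_image_subset])

lemma mono_closure_mono: "U \<subseteq> U' \<Longrightarrow> mono_closure M U \<subseteq> mono_closure M U'"
  unfolding mono_closure_def by (intro hull_mono) blast

lemma mono_map_in_closure: "a \<in> U \<Longrightarrow> mono_map M a \<noteq> 0 \<Longrightarrow> mono_map M a \<in> mono_closure M U"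
  unfolding mono_closure_def by (intro hull_inc) blast

lemma vanish_mono_closure:
  assumes "F \<in> forms M e" and van: "\<And>a. a \<in> U \<Longrightarrow> eval_mpol F (mono_map M a) = 0"
    and p: "p \<in> mono_closure M U"
  shows "eval_mpol F p = 0"
proof -
  have "\<forall>q\<in>mono_map M ` U - {0}. eval_mpol F q = 0"
    using van by blast
  then show ?thesis
    using p assms(1) unfolding mono_closure_def mem_proj_closed_hull[OF mono_map_image_subset] by blast
qed

text \<open>If two proper closed subsets covered the closure, some \<open>F\<close> and
  \<open>G\<close> would vanish on them but not at the images of points \<open>a\<close> and
  \<open>b\<close> of \<open>U\<close>. Along the line from \<open>a\<close> to \<open>b\<close>,
  which stays in \<open>U\<close>, both pull back to nonzero univariate polynomials, so some point
  of the line escapes both subsets.\<close>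

lemma proj_irreducible_mono_closure:
  fixes U :: "('v \<Rightarrow> 'k::field_char_0) set"
  assumes lines: "\<And>a b t. a \<in> U \<Longrightarrow> b \<in> U \<Longrightarrow> (\<lambda>i. a i + t * (b i - a i)) \<in> U"
    and ne: "a \<in> U" "mono_map M a \<noteq> 0"
  shows "proj_irreducible M (mono_closure M U)"
  unfolding proj_irreducible_def
proof (intro conjI allI impI)
  let ?X = "mono_closure M U"
  show cl: "proj_closed M ?X"
    by (rule proj_closed_mono_closure)
  show "?X \<noteq> {}"
    using mono_map_in_closure[OF ne] by blast
  fix A B assume "proj_closed M A \<and> proj_closed M B \<and> ?X = A \<union> B"
  then have A: "proj_closed M A" and B: "proj_closed M B" and AB: "?X = A \<union> B"
    by auto
  have *: "\<exists>b\<in>U. \<exists>e F. F \<in> forms M e \<and> (\<forall>q\<in>C. eval_mpol F q = 0) \<and>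
      mono_map M b \<noteq> 0 \<and> eval_mpol F (mono_map M b) \<noteq> 0"
    if C: "proj_closed M C" "C \<subseteq> ?X" "?X \<noteq> C" for C
  proof -
    have "\<not> mono_map M ` U - {0} \<subseteq> C"
      using C hull_minimal[of "mono_map M ` U - {0}" C "proj_closed M"] 
      unfolding mono_closure_def by blast
    then obtain b where b: "b \<in> U" "mono_map M b \<noteq> 0" "mono_map M b \<notin> C"
      by blast
    then obtain e F where "F \<in> forms M e" "\<And>q. q \<in> C \<Longrightarrow> eval_mpol F q = 0"
        "eval_mpol F (mono_map M b) \<noteq> 0"
      using proj_closed_separation[OF C(1), of "mono_map M b"] mono_map_in_vecs[of M b] by blast
    then show ?thesis
      using b by blast
  qed
  show "?X = A \<or> ?X = B"
  proof (rule ccontr)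
    assume "\<not> (?X = A \<or> ?X = B)"
    with *[OF A] *[OF B] AB obtain a b e e' F G where
      a: "a \<in> U" "F \<in> forms M e" "\<And>q. q \<in> A \<Longrightarrow> eval_mpol F q = 0" "mono_map M a \<noteq> 0"
         "eval_mpol F (mono_map M a) \<noteq> 0" and
      b: "b \<in> U" "G \<in> forms M e'" "\<And>q. q \<in> B \<Longrightarrow> eval_mpol G q = 0" "eval_mpol G (mono_map M b) \<noteq> 0"
      by blast
    define c where "c t = (\<lambda>i. a i + t * (b i - a i))" for t
    define g where "g m = (if m \<in> M then \<Prod>i\<in>keys m. [:a i, b i - a i:] ^ lookup m i else 0)" for m
    have g: "(\<lambda>m. poly (g m) t) = mono_map M (c t)" for t
      by (auto simp: g_def mono_map_def c_def mono_val_def poly_prod algebra_simps)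
    obtain m where m: "mono_map M a m \<noteq> 0"
      using a(4) by (auto simp: fun_eq_iff)
    have c01: "c 0 = a" "c 1 = b"
      by (simp_all add: c_def)
    \<comment> \<open>The third factor keeps one coordinate of the image nonzero, so that the point
      found lies where the rational map is defined.\<close>
    let ?f = "subst_poly F g * subst_poly G g * g m"
    have "poly (subst_poly F g) 0 \<noteq> 0" "poly (subst_poly G g) 1 \<noteq> 0"
      using a b by (simp_all add: poly_subst_poly g c01)
    moreover have "poly (g m) 0 \<noteq> 0"
      using m g[of 0] c01 by (metis)
    ultimately have "?f \<noteq> 0"
      by auto
    then obtain t where t: "poly ?f t \<noteq> 0"
      by (rule obtain_nonroot)
    have nz: "eval_mpol F (mono_map M (c t)) \<noteq> 0" "eval_mpol G (mono_map M (c t)) \<noteq> 0"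
      using t by (simp_all add: poly_subst_poly g)
    have "mono_map M (c t) m \<noteq> 0"
      using t g[of t] by (metis mult_zero_right poly_mult)
    moreover have "c t \<in> U"
      unfolding c_def using lines a(1) b(1) by blast
    ultimately have "mono_map M (c t) \<in> ?X"
      by (intro mono_map_in_closure) auto
    then show False
      using AB a(3) b(3) nz by blast
  qed
qed

section \<open>Bounding the length of chains of irreducible subsets by counting forms\<close>

lemma forms_pullback:
  fixes F :: "('v expo, 'k::field) mpol"
  assumes F: "F \<in> forms M s" and M: "M \<subseteq> expos V d"
  obtains G where "G \<in> forms V (s * d)" "\<And>a. eval_mpol F (mono_map M a) = eval_mpol G a"
proof
  define G where "G = (\<Sum>\<mu>\<in>keys F. single 0 (lookup F \<mu>) * (\<Prod>m\<in>keys \<mu>. single m 1 ^ lookup \<mu> m))"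
  have key: "keys \<mu> \<subseteq> M" "tdeg \<mu> = s" if "\<mu> \<in> keys F" for \<mu>
    using F that by (auto simp: forms_def expos_def)
  show "G \<in> forms V (s * d)"
    unfolding G_def
  proof (intro forms_sum forms_smult)
    fix \<mu> assume \<mu>: "\<mu> \<in> keys F"
    have "(\<Prod>m\<in>keys \<mu>. single m 1 ^ lookup \<mu> m) \<in> forms V (\<Sum>m\<in>keys \<mu>. lookup \<mu> m * d)"
      using key[OF \<mu>] M by (intro forms_prod forms_power) (auto intro!: forms_single)
    also have "(\<Sum>m\<in>keys \<mu>. lookup \<mu> m * d) = s * d"
      using key[OF \<mu>] by (simp add: tdeg_def flip: sum_distrib_right)
    finally show "(\<Prod>m\<in>keys \<mu>. single m 1 ^ lookup \<mu> m) \<in> forms V (s * d)" .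
  qed
  have prod: "eval_mpol (\<Prod>x\<in>A. f x) a = (\<Prod>x\<in>A. eval_mpol (f x) a)" for f A and a :: "'v \<Rightarrow> 'k"
    by (induction A rule: infinite_finite_induct) simp_all
  fix a :: "'v \<Rightarrow> 'k"
  have "mono_val \<mu> (mono_map M a) = (\<Prod>m\<in>keys \<mu>. mono_val m a ^ lookup \<mu> m)" if "\<mu> \<in> keys F" for \<mu>
    using key[OF that] by (auto simp: mono_val_def[of \<mu>] mono_map_def intro!: prod.cong)
  then show "eval_mpol F (mono_map M a) = eval_mpol G a"
    by (simp add: eval_mpol_def[of F] G_def eval_mpol_sum prod)
qed

lemma forms_in_span:
  assumes "G \<in> forms V e"
  shows "(\<lambda>a. eval_mpol G a) \<in> fs.span (mono_val ` expos V e)"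
proof -
  have "(\<lambda>a. eval_mpol G a) = (\<Sum>m\<in>keys G. fun_scale (lookup G m) (mono_val m))"
    by (rule ext) (simp add: eval_mpol_def sum_apply fun_scale_def)
  also have "\<dots> \<in> fs.span (mono_val ` expos V e)"
    using assms by (intro fs.span_sum fs.span_scale fs.span_base) (auto simp: forms_def)
  finally show ?thesis .
qed

lemma tdeg_three: "keys m \<subseteq> {..2::nat} \<Longrightarrow> tdeg m = lookup m 0 + lookup m 1 + lookup m 2"
  by (subst tdeg_superset[of "{..2}"]) (auto simp: numeral_2_eq_2)

lemma expos_three_eqI:
  assumes "m \<in> expos {..2::nat} d" "m' \<in> expos {..2} d" "lookup m 0 = lookup m' 0"
    "lookup m 1 = lookup m' 1"
  shows "m = m'"
proof (rule poly_mapping_eqI)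
  fix i
  have "lookup m 2 = lookup m' 2"
    using assms tdeg_three[of m] tdeg_three[of m'] by (simp add: expos_def)
  moreover have "i \<notin> {..2} \<Longrightarrow> lookup m i = 0" "i \<notin> {..2} \<Longrightarrow> lookup m' i = 0"
    using assms by (auto simp: expos_def in_keys_iff)
  moreover have "i = 0 \<or> i = 1 \<or> i = 2 \<or> i \<notin> {..2}"
    by auto
  ultimately show "lookup m i = lookup m' i"
    using assms(3,4) by metis
qed

lemma card_expos_three: "card (expos {..2::nat} D) \<le> (D + 1)\<^sup>2"
proof -
  have "card (expos {..2::nat} D) \<le> card ({..D} \<times> {..D})"
  proof (rule card_inj_on_le[of "\<lambda>m. (lookup m 0, lookup m 1)"])
    show "inj_on (\<lambda>m. (lookup m 0, lookup m 1)) (expos {..2::nat} D)"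
      by (intro inj_onI expos_three_eqI) auto
    show "(\<lambda>m. (lookup m 0, lookup m 1)) ` expos {..2::nat} D \<subseteq> {..D} \<times> {..D}"
      by (auto simp: expos_def tdeg_three)
  qed simp
  then show ?thesis
    by (simp add: power2_eq_square)
qed

text \<open>Comparison of coefficients in a polynomial relation in \<open>F\<close>, with
  \<open>F\<close> zero on \<open>Z0\<close> but not on \<open>Z1\<close>. The lower coefficients
  vanish on \<open>Z0\<close> by induction, hence on \<open>Z1\<close> by the assumption on
  \<open>P\<close>. A power of \<open>F\<close> then cancels by primality, and restriction to
  \<open>Z0\<close> isolates the next coefficient. That assumption comes from the level below:
  there, vanishing on \<open>Z0\<close> already forces all scalars in \<open>P j\<close> to be
  zero.\<close>

lemma chain_step:
  assumes Z1: "proj_irreducible V Z1" and sub: "Z0 \<subseteq> Z1" and F: "F \<in> forms V f"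
    and F0: "\<And>z. z \<in> Z0 \<Longrightarrow> eval_mpol F z = 0" and F1: "z1 \<in> Z1" "eval_mpol F z1 \<noteq> 0"
    and hN: "h \<le> N" and P: "\<And>j. j \<le> h \<Longrightarrow> P j \<in> forms V ((N - j) * f)"
    and P0: "\<And>j. j \<le> h \<Longrightarrow> \<forall>z\<in>Z0. eval_mpol (P j) z = 0 \<Longrightarrow> \<forall>z\<in>Z1. eval_mpol (P j) z = 0"
    and rel: "\<And>z. z \<in> Z1 \<Longrightarrow> (\<Sum>j\<le>h. eval_mpol F z ^ j * eval_mpol (P j) z) = 0"
    and "j \<le> h"
  shows "\<forall>z\<in>Z0. eval_mpol (P j) z = 0"
  using \<open>j \<le> h\<close>
proof (induction j rule: less_induct)
  case (less j)
  have low: "eval_mpol (P i) z = 0" if "i < j" "z \<in> Z1" for i z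
  proof -
    have "i \<le> h"
      using that(1) less.prems by simp
    then show ?thesis
      using P0 less.IH[OF that(1)] that(2) by blast
  qed
  \<comment> \<open>What is left of the relation after division by \<open>F ^ j\<close>. The degrees
    \<open>(N - i) * f\<close> of the coefficients make it homogeneous.\<close>
  define Q where "Q = (\<Sum>i=j..h. F ^ (i - j) * P i)"
  have Q: "Q \<in> forms V ((N - j) * f)"
    unfolding Q_def
  proof (rule forms_sum)
    fix i assume i: "i \<in> {j..h}"
    have "F ^ (i - j) * P i \<in> forms V ((i - j) * f + (N - i) * f)"
      using i P by (intro forms_mult forms_power F) auto
    moreover have "(i - j) * f + (N - i) * f = (N - j) * f"
    proof -
      have "i - j + (N - i) = N - j"
        using i hN by auto
      then show ?thesis
        by (metis distrib_right)
    qed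
    ultimately show "F ^ (i - j) * P i \<in> forms V ((N - j) * f)"
      by simp
  qed
  have "eval_mpol (F ^ j) z = 0 \<or> eval_mpol Q z = 0" if z: "z \<in> Z1" for z
  proof -
    have "eval_mpol F z ^ j * eval_mpol Q z = (\<Sum>i=j..h. eval_mpol F z ^ i * eval_mpol (P i) z)"
      by (simp add: Q_def eval_mpol_sum sum_distrib_left mult.assoc[symmetric] flip: power_add)
    also have "\<dots> = (\<Sum>i\<le>h. eval_mpol F z ^ i * eval_mpol (P i) z)"
      using low[OF _ z] by (intro sum.mono_neutral_left) auto
    finally show ?thesis
      using rel[OF z] by simp
  qed
  then have "(\<forall>z\<in>Z1. eval_mpol (F ^ j) z = 0) \<or> (\<forall>z\<in>Z1. eval_mpol Q z = 0)"
    by (rule proj_irreducible_prime[OF Z1 forms_power[OF F] Q])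
  then have Q1: "\<forall>z\<in>Z1. eval_mpol Q z = 0"
    using F1 by auto
  show ?case
  proof
    fix z assume z: "z \<in> Z0"
    have "eval_mpol Q z = (\<Sum>i=j..h. if i = j then eval_mpol (P j) z else 0)"
      unfolding Q_def eval_mpol_sum by (intro sum.cong refl) (auto simp: F0[OF z])
    then show "eval_mpol (P j) z = 0"
      using Q1 z sub less.prems by auto
  qed
qed

text \<open>A constant vanishing somewhere vanishes everywhere, so the separating form has positive
  degree. This keeps the exponents positive when the forms are raised to a common degree, and thus
  keeps their zeros.\<close>

lemma chain_form:
  assumes "proj_irreducible V A" "proj_irreducible V B" "A \<subset> B"
  obtains e F z where "e > 0" "F \<in> forms V e" "\<And>q. q \<in> A \<Longrightarrow> eval_mpol F q = 0"
    "z \<in> B" "eval_mpol F z \<noteq> 0"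
proof -
  obtain z where z: "z \<in> B" "z \<notin> A"
    using assms(3) by blast
  then have "z \<in> vecs V - {0}"
    using proj_closed_subset_vecs[OF proj_irreducible_closed[OF assms(2)]] by blast
  then obtain e F where F: "F \<in> forms V e" "\<And>q. q \<in> A \<Longrightarrow> eval_mpol F q = 0" "eval_mpol F z \<noteq> 0"
    using proj_closed_separation[OF proj_irreducible_closed[OF assms(1)] _ z(2)] by blast
  obtain q where q: "q \<in> A"
    using proj_irreducible_nonempty[OF assms(1)] by blast
  have "e \<noteq> 0"
  proof
    assume "e = 0"
    then have "keys F \<subseteq> {0}"
      using F(1) by (auto simp: forms_def expos_def)
    then have "eval_mpol F z = eval_mpol F q"
      by (simp add: eval_mpol_superset[of "{0}"])
    then show False
      using F(2)[OF q] F(3) by simp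
  qed
  then show ?thesis
    using that[of e F z] F z by blast
qed

text \<open>Along a chain \<open>Z 0 \<subset> Z 1 \<subset> Z 2 \<subset> Z 3\<close> take \<open>F\<^sub>i\<close> vanishing on \<open>Z (i - 1)\<close> but not on \<open>Z i\<close>, and \<open>F\<^sub>0\<close> not
  vanishing on \<open>Z 0\<close>, all of the same degree. The monomials in them are linearly independent on \<open>Z 3\<close>; their number grows
  like a cubic polynomial in the degree, that of the monomials in three variables like a quadratic one.\<close>

lemma no_chain_of_length_three:
  fixes Z :: "nat \<Rightarrow> (nat expo \<Rightarrow> 'k::field_char_0) set"
  assumes M: "M \<subseteq> expos {..2} d"
    and irr: "\<And>i. i \<le> 3 \<Longrightarrow> proj_irreducible M (Z i)" and top: "Z 3 \<subseteq> monomial_variety M"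
    and strict: "\<And>i. i < 3 \<Longrightarrow> Z i \<subset> Z (Suc i)"
  shows False
proof -
  have Z: "proj_irreducible M (Z 0)" "proj_irreducible M (Z 1)" "proj_irreducible M (Z 2)"
      "proj_irreducible M (Z 3)" "Z 0 \<subset> Z 1" "Z 1 \<subset> Z 2" "Z 2 \<subset> Z 3"
    using irr strict[of 0] strict[of 1] strict[of 2] by (simp_all add: numeral_2_eq_2 numeral_3_eq_3)
  obtain e1 F1' z1 where F1': "e1 > 0" "F1' \<in> forms M e1" "\<And>q. q \<in> Z 0 \<Longrightarrow> eval_mpol F1' q = 0"
      and z1: "z1 \<in> Z 1" "eval_mpol F1' z1 \<noteq> 0"
    using chain_form[OF Z(1,2,5)] by metis
  obtain e2 F2' z2 where F2': "e2 > 0" "F2' \<in> forms M e2" "\<And>q. q \<in> Z 1 \<Longrightarrow> eval_mpol F2' q = 0"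
      and z2: "z2 \<in> Z 2" "eval_mpol F2' z2 \<noteq> 0"
    using chain_form[OF Z(2,3,6)] by metis
  obtain e3 F3' z3 where F3': "e3 > 0" "F3' \<in> forms M e3" "\<And>q. q \<in> Z 2 \<Longrightarrow> eval_mpol F3' q = 0"
      and z3: "z3 \<in> Z 3" "eval_mpol F3' z3 \<noteq> 0"
    using chain_form[OF Z(3,4,7)] by metis
  obtain z0 where z0: "z0 \<in> Z 0"
    using proj_irreducible_nonempty[OF Z(1)] by blast
  then have "z0 \<in> vecs M - {0}"
    using proj_closed_subset_vecs[OF proj_irreducible_closed[OF Z(1)]] by blast
  then obtain m0 where m0: "m0 \<in> M" "z0 m0 \<noteq> 0"
    by (auto simp: vecs_def fun_eq_iff)
  \<comment> \<open>Each form is raised to the product of the other two degrees, which brings all of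
    them to degree \<open>f\<close>; \<open>F0\<close> is a power of a coordinate that is nonzero at
    \<open>z0\<close>.\<close>
  define f where "f = e1 * e2 * e3"
  define F0 where "F0 = single (single m0 f) (1::'k)"
  define F1 where "F1 = F1' ^ (e2 * e3)"
  define F2 where "F2 = F2' ^ (e1 * e3)"
  define F3 where "F3 = F3' ^ (e1 * e2)"
  have F0: "F0 \<in> forms M f" "eval_mpol F0 z0 \<noteq> 0"
    using m0 by (auto simp: F0_def expos_def intro!: forms_single)
  have F1: "F1 \<in> forms M f" "\<And>q. q \<in> Z 0 \<Longrightarrow> eval_mpol F1 q = 0" "eval_mpol F1 z1 \<noteq> 0"
    using forms_power[OF F1'(2), of "e2 * e3"] F1' F2'(1) F3'(1) z1 by (auto simp: F1_def f_def mult_ac)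
  have F2: "F2 \<in> forms M f" "\<And>q. q \<in> Z 1 \<Longrightarrow> eval_mpol F2 q = 0" "eval_mpol F2 z2 \<noteq> 0"
    using forms_power[OF F2'(2), of "e1 * e3"] F2' F1'(1) F3'(1) z2 by (auto simp: F2_def f_def mult_ac)
  have F3: "F3 \<in> forms M f" "\<And>q. q \<in> Z 2 \<Longrightarrow> eval_mpol F3 q = 0" "eval_mpol F3 z3 \<noteq> 0"
    using forms_power[OF F3'(2), of "e1 * e2"] F3' F1'(1) F2'(1) z3 by (auto simp: F3_def f_def mult_ac)
  \<comment> \<open>Chosen so that
    \<open>(D + 1)^2 <= ((3 * f * d + 1) * (h + 1))^2 = h * (h + 1)^2\<close>, which is less than
    the number \<open>(h + 1)^3\<close> of products \<open>W j k l\<close>.\<close>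
  define h where "h = (3 * f * d + 1)\<^sup>2"
  \<comment> \<open>The power of \<open>F0\<close> homogenizes: all products have degree
    \<open>3 * h * f\<close>, and three exponents of size at most \<open>h\<close> leave the
    subtraction untruncated.\<close>
  define W where "W j k l = F3 ^ j * F2 ^ k * F1 ^ l * F0 ^ (3 * h - j - k - l)" for j k l
  define A where "A = {..h} \<times> {..h} \<times> {..h}"
  define D where "D = 3 * h * f * d"
  have W: "W j k l \<in> forms M (3 * h * f)" if "(j, k, l) \<in> A" for j k l
  proof -
    have le: "j \<le> h" "k \<le> h" "l \<le> h"
      using that by (auto simp: A_def)
    have "W j k l \<in> forms M (j * f + k * f + l * f + (3 * h - j - k - l) * f)"
      unfolding W_def by (intro forms_mult forms_power F0 F1 F2 F3)
    also have "j * f + k * f + l * f + (3 * h - j - k - l) * f = 3 * h * f"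
      using le by (simp flip: distrib_right)
    finally show ?thesis .
  qed
  have "\<exists>c. (\<exists>x\<in>A. c x \<noteq> 0) \<and>
      (\<forall>a. (\<Sum>x\<in>A. c x * (case x of (j, k, l) \<Rightarrow> \<lambda>a. eval_mpol (W j k l) (mono_map M a)) a) = 0)"
  proof (rule exists_relation[of A "mono_val ` expos {..2} D"])
    show "finite A" "finite ((mono_val :: nat expo \<Rightarrow> (nat \<Rightarrow> 'k) \<Rightarrow> 'k) ` expos {..2} D)"
      by (simp_all add: A_def finite_expos)
    fix x assume x: "x \<in> A"
    obtain j k l where jkl: "x = (j, k, l)"
      by (metis prod_cases3)
    obtain G where "G \<in> forms {..2} (3 * h * f * d)" "\<And>a. eval_mpol (W j k l) (mono_map M a) = eval_mpol G a"
      using forms_pullback[OF W M] x jkl by blast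
    then show "(case x of (j, k, l) \<Rightarrow> \<lambda>a. eval_mpol (W j k l) (mono_map M a))
        \<in> fs.span (mono_val ` expos {..2} D)"
      using forms_in_span[of G "{..2}" D] by (simp add: jkl D_def)
  next
    have "card ((mono_val :: nat expo \<Rightarrow> (nat \<Rightarrow> 'k) \<Rightarrow> 'k) ` expos {..2} D) \<le> (D + 1)\<^sup>2"
      by (rule order.trans[OF card_image_le[OF finite_expos] card_expos_three]) simp
    also have "\<dots> \<le> ((3 * f * d + 1) * (h + 1))\<^sup>2"
      by (intro power_mono) (simp_all add: D_def algebra_simps)
    also have "\<dots> = h * (h + 1)\<^sup>2"
      unfolding power_mult_distrib h_def ..
    also have "\<dots> < (h + 1) * (h + 1)\<^sup>2"
      by (intro mult_strict_right_mono) simp_all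
    also have "\<dots> = card A"
      by (simp add: A_def power2_eq_square)
    finally show "card ((mono_val :: nat expo \<Rightarrow> (nat \<Rightarrow> 'k) \<Rightarrow> 'k) ` expos {..2} D) < card A" .
  qed
  then obtain c where c: "\<exists>x\<in>A. c x \<noteq> 0"
      "\<And>a. (\<Sum>x\<in>A. c x * (case x of (j, k, l) \<Rightarrow> \<lambda>a. eval_mpol (W j k l) (mono_map M a)) a) = 0"
    by blast
  \<comment> \<open>The relation is regrouped as a polynomial in \<open>F3\<close> whose
    coefficients are polynomials in \<open>F2\<close>, and those in \<open>F1\<close>, so that each
    inclusion of the chain removes one form.\<close>
  define P1 where "P1 j k l = single 0 (c (j, k, l)) * F0 ^ (3 * h - j - k - l)" for j k l
  define P2 where "P2 j k = (\<Sum>l\<le>h. F1 ^ l * P1 j k l)" for j k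
  define P3 where "P3 j = (\<Sum>k\<le>h. F2 ^ k * P2 j k)" for j
  define P where "P = (\<Sum>j\<le>h. F3 ^ j * P3 j)"
  have P1: "P1 j k l \<in> forms M ((3 * h - j - k - l) * f)" for j k l
    unfolding P1_def by (intro forms_smult forms_power F0)
  have P2: "P2 j k \<in> forms M ((3 * h - j - k) * f)" if "j \<le> h" "k \<le> h" for j k
    unfolding P2_def
  proof (rule forms_sum)
    fix l assume "l \<in> {..h}"
    then have eq: "(3 * h - j - k) * f = l * f + (3 * h - j - k - l) * f"
      using that by (simp flip: distrib_right)
    show "F1 ^ l * P1 j k l \<in> forms M ((3 * h - j - k) * f)"
      unfolding eq by (intro forms_mult forms_power F1 P1)
  qed
  have P3: "P3 j \<in> forms M ((3 * h - j) * f)" if "j \<le> h" for j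
    unfolding P3_def
  proof (rule forms_sum)
    fix k assume k: "k \<in> {..h}"
    then have eq: "(3 * h - j) * f = k * f + (3 * h - j - k) * f"
      using that by (simp flip: distrib_right)
    show "F2 ^ k * P2 j k \<in> forms M ((3 * h - j) * f)"
      unfolding eq using k that by (intro forms_mult forms_power F2 P2) auto
  qed
  have P: "P \<in> forms M (3 * h * f)"
    unfolding P_def
  proof (rule forms_sum)
    fix j assume j: "j \<in> {..h}"
    then have eq: "3 * h * f = j * f + (3 * h - j) * f"
      by (simp flip: distrib_right)
    show "F3 ^ j * P3 j \<in> forms M (3 * h * f)"
      unfolding eq using j by (intro forms_mult forms_power F3 P3) auto
  qed
  have Pz: "eval_mpol P z = 0" if "z \<in> Z 3" for z
  proof -
    have "eval_mpol P (mono_map M a) = 0" for a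
    proof -
      have "eval_mpol P (mono_map M a) = (\<Sum>j\<le>h. \<Sum>k\<le>h. \<Sum>l\<le>h. c (j, k, l) * eval_mpol (W j k l) (mono_map M a))"
        by (simp add: P_def P3_def P2_def P1_def W_def eval_mpol_sum sum_distrib_left mult_ac)
      also have "\<dots> = (\<Sum>(j, k, l)\<in>A. c (j, k, l) * eval_mpol (W j k l) (mono_map M a))"
        by (simp add: A_def sum.cartesian_product)
      finally show ?thesis
        using c(2)[of a] by (simp add: case_prod_unfold)
    qed
    then show ?thesis
      using vanish_mono_closure[OF P] that top unfolding monomial_variety_eq by blast
  qed
  \<comment> \<open>Base of the climb: on \<open>Z 0\<close> only a scalar times a power of
    \<open>F0\<close> is left, and \<open>F0\<close> is nonzero at \<open>z0\<close>.\<close>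
  have c1: "c (j, k, l) = 0" if "\<forall>z\<in>Z 0. eval_mpol (P1 j k l) z = 0" for j k l
  proof -
    have "eval_mpol (P1 j k l) z0 = 0"
      using that z0 by blast
    then show ?thesis
      using F0(2) by (simp add: P1_def)
  qed
  \<comment> \<open>Vanishing on the larger set passes through \<open>chain_step\<close> to the
    coefficients on the smaller one, where the previous level gives zero scalars. That level also
    supplies the assumption that vanishing on \<open>Z 0\<close> extends to
    \<open>Z 1\<close>.\<close>
  have c2: "c (j, k, l) = 0" if "\<forall>z\<in>Z 1. eval_mpol (P2 j k) z = 0" "j \<le> h" "k \<le> h" "l \<le> h" for j k l
  proof (rule c1, rule chain_step[of M "Z 1" "Z 0" F1 f z1 h "3 * h - j - k" "P1 j k" l])
    show "Z 0 \<subseteq> Z 1"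
      using Z(5) by blast
    show "h \<le> 3 * h - j - k"
      using that by simp
    show "eval_mpol F1 z = 0" if "z \<in> Z 0" for z
      using F1(2)[OF that] .
    show "P1 j k i \<in> forms M ((3 * h - j - k - i) * f)" for i
      by (rule P1)
    show "\<forall>z\<in>Z 1. eval_mpol (P1 j k i) z = 0" if "\<forall>z\<in>Z 0. eval_mpol (P1 j k i) z = 0" for i
      using c1[OF that] by (simp add: P1_def)
    show "(\<Sum>i\<le>h. eval_mpol F1 z ^ i * eval_mpol (P1 j k i) z) = 0" if "z \<in> Z 1" for z
      using that \<open>\<forall>z\<in>Z 1. eval_mpol (P2 j k) z = 0\<close> by (simp add: P2_def eval_mpol_sum)
  qed (fact that Z(2) F1(1) F1(3) z1(1))+
  have c3: "c (j, k, l) = 0" if "\<forall>z\<in>Z 2. eval_mpol (P3 j) z = 0" "j \<le> h" "k \<le> h" "l \<le> h" for j k l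
  proof (rule c2, rule chain_step[of M "Z 2" "Z 1" F2 f z2 h "3 * h - j" "P2 j" k])
    show "Z 1 \<subseteq> Z 2"
      using Z(6) by blast
    show "h \<le> 3 * h - j"
      using that by simp
    show "eval_mpol F2 z = 0" if "z \<in> Z 1" for z
      using F2(2)[OF that] .
    show "P2 j i \<in> forms M ((3 * h - j - i) * f)" if "i \<le> h" for i
      using P2 \<open>j \<le> h\<close> that by blast
    show "\<forall>z\<in>Z 2. eval_mpol (P2 j i) z = 0" if "\<forall>z\<in>Z 1. eval_mpol (P2 j i) z = 0" "i \<le> h" for i
      using c2[OF that(1) \<open>j \<le> h\<close> that(2)] by (simp add: P2_def P1_def eval_mpol_sum)
    show "(\<Sum>i\<le>h. eval_mpol F2 z ^ i * eval_mpol (P2 j i) z) = 0" if "z \<in> Z 2" for z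
      using that \<open>\<forall>z\<in>Z 2. eval_mpol (P3 j) z = 0\<close> by (simp add: P3_def eval_mpol_sum)
  qed (fact that Z(3) F2(1) F2(3) z2(1))+
  have "c (j, k, l) = 0" if "j \<le> h" "k \<le> h" "l \<le> h" for j k l
  proof (rule c3, rule chain_step[of M "Z 3" "Z 2" F3 f z3 h "3 * h" P3 j])
    show "Z 2 \<subseteq> Z 3"
      using Z(7) by blast
    show "h \<le> 3 * h"
      by simp
    show "eval_mpol F3 z = 0" if "z \<in> Z 2" for z
      using F3(2)[OF that] .
    show "P3 i \<in> forms M ((3 * h - i) * f)" if "i \<le> h" for i
      using P3 that by blast
    show "\<forall>z\<in>Z 3. eval_mpol (P3 i) z = 0" if "\<forall>z\<in>Z 2. eval_mpol (P3 i) z = 0" "i \<le> h" for i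
      using c3[OF that(1,2)] by (simp add: P3_def P2_def P1_def eval_mpol_sum)
    show "(\<Sum>i\<le>h. eval_mpol F3 z ^ i * eval_mpol (P3 i) z) = 0" if "z \<in> Z 3" for z
      using Pz[OF that] by (simp add: P_def eval_mpol_sum)
  qed (fact that Z(4) F3(1) F3(3) z3(1))+
  then show False
    using c(1) by (auto simp: A_def)
qed

section \<open>Tangent spaces and toric charts\<close>

lemma subspace_cone_tangent: "fs.subspace (cone_tangent V X p)"
  unfolding cone_tangent_def
  by (intro fs.subspaceI) (auto simp: vecs_def fun_scale_def distrib_left sum.distrib
      mult.left_commute simp flip: sum_distrib_left)

text \<open>Differentiate \<open>F (g t) = 0\<close> at \<open>t = 0\<close>. The curve only has to
  satisfy the equations of \<open>X\<close>, so it may pass through the origin of the cone.\<close>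

lemma velocity_in_cone_tangent:
  fixes g :: "'v \<Rightarrow> 'k::field_char_0 poly"
  assumes "finite V" and g: "\<And>i. i \<notin> V \<Longrightarrow> g i = 0" and p: "\<And>i. poly (g i) 0 = p i"
    and X: "\<And>F e t. F \<in> forms V e \<Longrightarrow> \<forall>q\<in>X. eval_mpol F q = 0 \<Longrightarrow>
      eval_mpol F (\<lambda>i. poly (g i) t) = 0"
  shows "(\<lambda>i. poly (pderiv (g i)) 0) \<in> cone_tangent V X p"
  unfolding cone_tangent_def
proof (intro CollectI conjI ballI impI)
  show "(\<lambda>i. poly (pderiv (g i)) 0) \<in> vecs V"
    using g by (auto simp: vecs_def)
  fix F assume F: "F \<in> (\<Union>e. forms V e)" "\<forall>q\<in>X. eval_mpol F q = 0"
  then obtain e where e: "F \<in> forms V e"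
    by blast
  have "subst_poly F g = 0"
    by (rule poly_eq_0_if_cofinite[of "{}"]) (use X[OF e F(2)] in \<open>simp_all add: poly_subst_poly\<close>)
  then have "poly (pderiv (subst_poly F g)) 0 = 0"
    by simp
  then show "(\<Sum>j\<in>V. eval_mpol (pdiff j F) p * poly (pderiv (g j)) 0) = 0"
    using e \<open>finite V\<close> poly_pderiv_subst_poly[of V F g 0]
    by (simp add: p forms_def expos_def subset_iff)
qed

text \<open>The differential of \<open>F\<close> at \<open>p\<close> in direction \<open>v\<close>
  is the derivative along the straight line \<open>p + t v\<close>. Any polynomial \<open>f\<close>
  describing \<open>F\<close> on that line may be used, which avoids computing partial
  derivatives.\<close>

lemma cone_tangent_derivative:
  fixes F :: "('v, 'k::field_char_0) mpol"
  assumes "finite V" "F \<in> forms V e" "\<forall>q\<in>X. eval_mpol F q = 0" "v \<in> cone_tangent V X p"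
    and f: "\<And>t. eval_mpol F (\<lambda>i. p i + t * v i) = poly f t"
  shows "poly (pderiv f) 0 = 0"
proof -
  define g where "g i = [:p i, v i:]" for i
  have "poly (subst_poly F g) t = poly f t" for t
    using f[of t] by (simp add: poly_subst_poly g_def mult.commute)
  then have "subst_poly F g = f"
    by (simp add: poly_eq_poly_eq_iff[symmetric] fun_eq_iff)
  then have "poly (pderiv f) 0 = (\<Sum>j\<in>V. eval_mpol (pdiff j F) p * v j)"
    using poly_pderiv_subst_poly[of V F g 0] assms(1,2)
    by (simp add: g_def pderiv_pCons forms_def expos_def subset_iff)
  also have "\<dots> = 0"
    using assms(2-4) unfolding cone_tangent_def by blast
  finally show ?thesis .
qed

text \<open>A chart of a toric surface at a vertex \<open>v\<close>: the exponents \<open>m\<close> satisfy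
  \<open>m - v = i m (u - v) + j m (w - v)\<close>, and the last condition says that \<open>u - v\<close> and \<open>w - v\<close>
  are part of a basis of the lattice.\<close>

definition toric_chart :: "'k::field itself \<Rightarrow> nat expo set \<Rightarrow> nat expo \<Rightarrow> nat expo \<Rightarrow> nat expo \<Rightarrow>
    (nat expo \<Rightarrow> nat) \<Rightarrow> (nat expo \<Rightarrow> nat) \<Rightarrow> bool" where
  "toric_chart _ M v u w i j \<longleftrightarrow> v \<in> M \<and> u \<in> M \<and> w \<in> M \<and>
     i v = 0 \<and> j v = 0 \<and> i u = 1 \<and> j u = 0 \<and> i w = 0 \<and> j w = 1 \<and>
     (\<forall>m\<in>M. \<forall>a :: nat \<Rightarrow> 'k. mono_val m a * mono_val v a ^ (i m + j m) =
        mono_val v a * mono_val u a ^ i m * mono_val w a ^ j m) \<and>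
     (\<forall>\<alpha> \<beta> :: 'k. \<alpha> \<noteq> 0 \<longrightarrow> \<beta> \<noteq> 0 \<longrightarrow>
        (\<exists>a c. c \<noteq> 0 \<and> (\<forall>m\<in>M. mono_val m a = c * \<alpha> ^ i m * \<beta> ^ j m)))"

lemma forms_binomial:
  assumes "m \<in> M" "v \<in> M" "u \<in> M" "w \<in> M"
  obtains F e where "F \<in> forms M e"
    "\<And>q. eval_mpol F q = q m * q v ^ (i + j) - q v * q u ^ i * (q w ^ j :: 'k::field)"
proof
  let ?x = "\<lambda>k. single (single k 1) (1::'k)"
  let ?F = "?x m * ?x v ^ (i + j) - ?x v * ?x u ^ i * ?x w ^ j"
  have x: "?x k \<in> forms M 1" if "k \<in> M" for k
    using that by (intro forms_single) (simp add: expos_def)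
  have "?x m * ?x v ^ (i + j) \<in> forms M (1 + (i + j) * 1)"
    "?x v * ?x u ^ i * ?x w ^ j \<in> forms M (1 + i * 1 + j * 1)"
    using assms by (intro forms_mult forms_power x; simp)+
  then show "?F \<in> forms M (i + j + 1)"
    by (intro forms_diff) (simp_all add: add_ac)
  show "eval_mpol ?F q = q m * q v ^ (i + j) - q v * q u ^ i * q w ^ j" for q
    by simp
qed

text \<open>For nonzero \<alpha> and \<beta> the point is proportional to one in the image of the
  torus. The axes are then reached one parameter at a time, since a univariate polynomial that
  vanishes away from 0 is zero.\<close>

lemma forms_vanish_on_chart:
  fixes s \<alpha> \<beta> :: "'k::field_char_0"
  assumes chart: "toric_chart TYPE('k) M v u w i j" and F: "F \<in> forms M e"
    and X: "\<forall>q\<in>monomial_variety M. eval_mpol F q = 0"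
  shows "eval_mpol F (\<lambda>m. if m \<in> M then s * \<alpha> ^ i m * \<beta> ^ j m else 0) = 0"
proof -
  define q where "q \<alpha> \<beta> = (\<lambda>m. if m \<in> M then \<alpha> ^ i m * \<beta> ^ j m else (0::'k))" for \<alpha> \<beta>
  have q0: "eval_mpol F (q \<alpha> \<beta>) = 0" if nz: "\<alpha> \<noteq> 0" "\<beta> \<noteq> 0" for \<alpha> \<beta>
  proof -
    obtain a c where c: "c \<noteq> 0" "\<forall>m\<in>M. mono_val m a = c * \<alpha> ^ i m * \<beta> ^ j m"
      using chart nz unfolding toric_chart_def by blast
    have eq: "mono_map M a = (\<lambda>m. c * q \<alpha> \<beta> m)"
      using c(2) by (auto simp: mono_map_def q_def mult_ac)
    have "v \<in> M"
      using chart by (simp add: toric_chart_def)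
    then have "mono_map M a v \<noteq> 0"
      using c(1) nz by (simp add: eq q_def)
    then have "mono_map M a \<in> monomial_variety M"
      unfolding monomial_variety_eq by (intro mono_map_in_closure) auto
    then have "c ^ e * eval_mpol F (q \<alpha> \<beta>) = 0"
      using X eval_forms_scale[OF F, of c "q \<alpha> \<beta>"] by (simp add: eq)
    then show ?thesis
      using c(1) by simp
  qed
  have q1: "eval_mpol F (q \<alpha> \<beta>) = 0" if nz: "\<alpha> \<noteq> 0" for \<alpha> \<beta>
  proof -
    let ?g = "\<lambda>m. if m \<in> M then [:\<alpha> ^ i m:] * [:0, 1:] ^ j m else 0"
    have g: "(\<lambda>m. poly (?g m) t) = q \<alpha> t" for t
      by (auto simp: q_def)
    have "subst_poly F ?g = 0"
      by (rule poly_eq_0_if_cofinite[of "{0}"]) (use q0[OF nz] in \<open>simp_all only: poly_subst_poly g, auto\<close>)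
    then show ?thesis
      using poly_subst_poly[of F ?g \<beta>] unfolding g by simp
  qed
  have q2: "eval_mpol F (q \<alpha> \<beta>) = 0"
  proof -
    let ?g = "\<lambda>m. if m \<in> M then [:\<beta> ^ j m:] * [:0, 1:] ^ i m else 0"
    have g: "(\<lambda>m. poly (?g m) t) = q t \<beta>" for t
      by (auto simp: q_def)
    have "subst_poly F ?g = 0"
      by (rule poly_eq_0_if_cofinite[of "{0}"]) (use q1 in \<open>simp_all only: poly_subst_poly g, auto\<close>)
    then show ?thesis
      using poly_subst_poly[of F ?g \<alpha>] unfolding g by simp
  qed
  have "(\<lambda>m. if m \<in> M then s * \<alpha> ^ i m * \<beta> ^ j m else 0) = (\<lambda>m. s * q \<alpha> \<beta> m)"
    by (auto simp: q_def)
  then show ?thesis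
    using q2 by (simp add: eval_forms_scale[OF F])
qed

text \<open>Where the coordinate \<open>v\<close> is nonzero, the binomials present the cone over
  the surface as a graph over the coordinates \<open>v\<close>, \<open>u\<close>, \<open>w\<close>.
  A tangent vector is therefore determined by these three, and varying the scale \<open>s\<close>
  and the chart parameters \<alpha>, \<beta> realizes all of them.\<close>

lemma dim_cone_tangent:
  fixes p :: "nat expo \<Rightarrow> 'k::field_char_0"
  assumes "finite M" and chart: "toric_chart TYPE('k) M v u w i j"
    and p: "p \<in> monomial_variety M" "p v \<noteq> 0"
  shows "vector_space.dim fun_scale (cone_tangent M (monomial_variety M) p) = 3"
proof -
  let ?X = "monomial_variety M :: (nat expo \<Rightarrow> 'k) set"
  let ?T = "cone_tangent M ?X p"
  have M: "v \<in> M" "u \<in> M" "w \<in> M" and ij: "i v = 0" "j v = 0" "i u = 1" "j u = 0" "i w = 0" "j w = 1"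
    and rel: "\<And>m (a :: nat \<Rightarrow> 'k). m \<in> M \<Longrightarrow> mono_val m a * mono_val v a ^ (i m + j m) =
        mono_val v a * mono_val u a ^ i m * mono_val w a ^ j m"
    using chart by (auto simp: toric_chart_def)
  have bin: "\<exists>F e. F \<in> forms M e \<and> (\<forall>q\<in>?X. eval_mpol F q = 0) \<and>
      (\<forall>q. eval_mpol F q = q m * q v ^ (i m + j m) - q v * q u ^ i m * q w ^ j m)" if m: "m \<in> M" for m
  proof -
    obtain F e where F: "F \<in> forms M e"
      "\<And>q. eval_mpol F q = q m * q v ^ (i m + j m) - q v * q u ^ i m * (q w ^ j m :: 'k)"
      using forms_binomial[OF m M] by blast
    have "eval_mpol F q = 0" if "q \<in> ?X" for q
    proof (rule vanish_mono_closure[OF F(1)])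
      show "q \<in> mono_closure M UNIV"
        using that by (simp add: monomial_variety_eq)
      show "eval_mpol F (mono_map M a) = 0" for a
        using M m rel[OF m, of a] by (simp add: F(2) mono_map_def)
    qed
    then show ?thesis
      using F by blast
  qed
  define s where "s = p v"
  define \<alpha> where "\<alpha> = p u / s"
  define \<beta> where "\<beta> = p w / s"
  have s: "s \<noteq> 0"
    using p(2) by (simp add: s_def)
  have pM: "p m = 0" if "m \<notin> M" for m
    using p(1) that proj_closed_subset_vecs[OF proj_closed_mono_closure[of M UNIV]]
    by (auto simp: monomial_variety_eq vecs_def)
  have pm: "p m = s * \<alpha> ^ i m * \<beta> ^ j m" if m: "m \<in> M" for m
  proof -
    have "p m * p v ^ (i m + j m) = p v * p u ^ i m * p w ^ j m"
      using bin[OF m] p(1) by fastforce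
    then have "p m * s ^ (i m + j m) = s * \<alpha> ^ i m * \<beta> ^ j m * s ^ (i m + j m)"
      using s by (simp add: \<alpha>_def \<beta>_def power_divide power_add s_def[symmetric])
    then show ?thesis
      using s by simp
  qed
  \<comment> \<open>In such a direction the binomial of \<open>m\<close> changes only through its
    factor \<open>q m\<close>, so it is linear along the line with slope
    \<open>t m * p v ^ (i m + j m)\<close>.\<close>
  have zero: "t = 0" if t: "t \<in> ?T" "t v = 0" "t u = 0" "t w = 0" for t
  proof
    fix m
    show "t m = 0 m"
    proof (cases "m \<in> M")
      case False
      then show ?thesis
        using t(1) by (simp add: cone_tangent_def vecs_def)
    next
      case True
      obtain F e where F: "F \<in> forms M e" "\<forall>q\<in>?X. eval_mpol F q = 0"
        "\<And>q. eval_mpol F q = q m * q v ^ (i m + j m) - q v * q u ^ i m * q w ^ j m"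
        using bin[OF True] by blast
      let ?f = "[:p m * p v ^ (i m + j m) - p v * p u ^ i m * p w ^ j m, t m * p v ^ (i m + j m):]"
      have "poly (pderiv ?f) 0 = 0"
        by (rule cone_tangent_derivative[OF \<open>finite M\<close> F(1,2) t(1)]) (simp add: F(3) t algebra_simps)
      then show ?thesis
        using p(2) by (simp add: pderiv_pCons)
    qed
  qed
  have tangent: "(\<lambda>m. poly (pderiv (g m)) 0) \<in> ?T"
    if "\<And>m. m \<notin> M \<Longrightarrow> g m = 0" "\<And>m. poly (g m) 0 = p m"
      "\<And>t m. m \<in> M \<Longrightarrow> poly (g m) t = S t * A t ^ i m * B t ^ j m" for g S A B
  proof (rule velocity_in_cone_tangent)
    fix F e t assume F: "F \<in> forms M e" "\<forall>q\<in>?X. eval_mpol F q = 0"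
    have "(\<lambda>m. poly (g m) t) = (\<lambda>m. if m \<in> M then S t * A t ^ i m * B t ^ j m else 0)"
      using that by auto
    then show "eval_mpol F (\<lambda>m. poly (g m) t) = 0"
      using forms_vanish_on_chart[OF chart F] by simp
  qed (use that \<open>finite M\<close> in auto)
  \<comment> \<open>Three curves through \<open>p\<close>: each moves one of \<open>s\<close>,
    \<alpha>, \<beta> and fixes the other two.\<close>
  define gs where "gs m = (if m \<in> M then smult (\<alpha> ^ i m * \<beta> ^ j m) [:s, 1:] else 0)" for m
  define ga where "ga m = (if m \<in> M then smult (s * \<beta> ^ j m) ([:\<alpha>, 1:] ^ i m) else 0)" for m
  define gb where "gb m = (if m \<in> M then smult (s * \<alpha> ^ i m) ([:\<beta>, 1:] ^ j m) else 0)" for m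
  define ts where "ts m = poly (pderiv (gs m)) 0" for m
  define ta where "ta m = poly (pderiv (ga m)) 0" for m
  define tb where "tb m = poly (pderiv (gb m)) 0" for m
  have "(\<lambda>m. ts m) \<in> ?T"
    unfolding ts_def by (rule tangent[of gs "\<lambda>t. s + t" "\<lambda>_. \<alpha>" "\<lambda>_. \<beta>"]) (auto simp: gs_def pm pM algebra_simps)
  moreover have "(\<lambda>m. ta m) \<in> ?T"
    unfolding ta_def by (rule tangent[of ga "\<lambda>_. s" "\<lambda>t. \<alpha> + t" "\<lambda>_. \<beta>"]) (auto simp: ga_def pm pM)
  moreover have "(\<lambda>m. tb m) \<in> ?T"
    unfolding tb_def by (rule tangent[of gb "\<lambda>_. s" "\<lambda>_. \<alpha>" "\<lambda>t. \<beta> + t"]) (auto simp: gb_def pm pM)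
  ultimately have T: "ts \<in> ?T" "ta \<in> ?T" "tb \<in> ?T"
    by simp_all
  have val: "ts v = 1" "ts u = \<alpha>" "ts w = \<beta>" "ta v = 0" "ta u = s" "ta w = 0" "tb v = 0" "tb u = 0" "tb w = s"
    by (simp_all add: ts_def ta_def tb_def gs_def ga_def gb_def M ij pderiv_smult pderiv_pCons)
  have comb0: "c1 = 0 \<and> c2 = 0 \<and> c3 = 0"
    if "fun_scale c1 ts + fun_scale c2 ta + fun_scale c3 tb = 0" for c1 c2 c3
  proof -
    have eq: "c1 * ts m + c2 * ta m + c3 * tb m = 0" for m
      using fun_cong[OF that, of m] by (simp add: fun_scale_def)
    show ?thesis
      using eq[of v] eq[of u] eq[of w] s by (simp add: val)
  qed
  have ne: "ts \<noteq> ta" "ts \<noteq> tb" "ta \<noteq> tb"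
    using val s by force+
  show ?thesis
  proof (rule fs.dim_unique[of "{ts, ta, tb}"])
    show "{ts, ta, tb} \<subseteq> ?T"
      using T by blast
    show "card {ts, ta, tb} = 3"
      using ne by simp
    show "fs.independent {ts, ta, tb}"
    proof (rule fs.independent_if_scalars_zero)
      fix f x assume "(\<Sum>x\<in>{ts, ta, tb}. fun_scale (f x) x) = 0" "x \<in> {ts, ta, tb}"
      then show "f x = 0"
        using ne comb0[of "f ts" "f ta" "f tb"] by (auto simp: add.assoc)
    qed simp
    show "?T \<subseteq> fs.span {ts, ta, tb}"
    proof
      fix t assume t: "t \<in> ?T"
      \<comment> \<open>The coefficients solve the triangular system given by \<open>val\<close>, so
        that \<open>t'\<close> agrees with \<open>t\<close> at \<open>v\<close>, \<open>u\<close>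
        and \<open>w\<close>.\<close>
      define t' where "t' = fun_scale (t v) ts + fun_scale ((t u - t v * \<alpha>) / s) ta +
        fun_scale ((t w - t v * \<beta>) / s) tb"
      have "t - t' \<in> ?T"
        unfolding t'_def using T t
        by (intro fs.subspace_diff fs.subspace_add fs.subspace_scale subspace_cone_tangent)
      then have "t - t' = 0"
        by (rule zero) (use s in \<open>simp_all add: t'_def fun_scale_def val\<close>)
      moreover have "t' \<in> fs.span {ts, ta, tb}"
        unfolding t'_def by (intro fs.span_add fs.span_scale fs.span_base) auto
      ultimately show "t \<in> fs.span {ts, ta, tb}"
        by simp
    qed
  qed
qed

text \<open>A chain of length two is the closure of the images of a point, of the line where the
  last variable is 0, and of the whole plane. The two monomials on that line separate the first two
  members, the monomial \<open>m2\<close> separates the last two. Longer chains are excluded by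
  \<open>no_chain_of_length_three\<close>.\<close>

lemma proj_dim_monomial_variety:
  assumes M: "M \<subseteq> expos {..2} d" and m: "m0 \<in> M" "m1 \<in> M" "m2 \<in> M"
    and e: "lookup m0 2 = 0" "lookup m1 2 = 0" "m0 \<noteq> m1" "lookup m2 2 \<noteq> 0"
  shows "proj_dim M (monomial_variety M :: (nat expo \<Rightarrow> 'k::field_char_0) set) = 2"
proof -
  let ?X = "monomial_variety M :: (nat expo \<Rightarrow> 'k) set"
  define U where "U n = (if n = 0 then {a. a 2 = 0 \<and> a 0 = a 1} else if n = 1 then {a. a 2 = 0} else
      (UNIV :: (nat \<Rightarrow> 'k) set))" for n :: nat
  define Z where "Z n = mono_closure M (U n)" for n
  have van2: "mono_map M a m2 = 0" if "a \<in> U 1" for a :: "nat \<Rightarrow> 'k"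
    using that m e by (auto simp: U_def mono_map_def mono_val_def in_keys_iff)
  have key: "keys m \<subseteq> {0, 1}" if "m \<in> M" "lookup m 2 = 0" for m
  proof -
    have "keys m \<subseteq> {..2}"
      using that M by (auto simp: expos_def)
    moreover have "2 \<notin> keys m"
      using that by (simp add: in_keys_iff)
    moreover have "{..2} = {0, 1, 2::nat}"
      by auto
    ultimately show ?thesis
      by auto
  qed
  have val: "mono_val m (a :: nat \<Rightarrow> 'k) = a 0 ^ lookup m 0 * a 1 ^ lookup m 1"
    if "m \<in> M" "lookup m 2 = 0" for m a
    using key[OF that] by (simp add: mono_val_superset[of "{0, 1}"])
  have deg: "lookup m 0 + lookup m 1 = d" if "m \<in> M" "lookup m 2 = 0" for m
    using that M by (auto simp: expos_def tdeg_three)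
  have l0: "lookup m0 0 \<noteq> lookup m1 0"
    using deg[OF m(1) e(1)] deg[OF m(2) e(2)] e(3) m M expos_three_eqI[of m0 d m1] by fastforce
  define b where "b = (\<lambda>i::nat. if i \<le> 1 then 1 else (0::'k))"
  have b: "b \<in> U n" for n
    by (auto simp: U_def b_def)
  have mb: "mono_map M b m0 = 1"
    using m e val[OF m(1) e(1)] by (simp add: mono_map_def b_def)
  have mb0: "mono_map M b \<noteq> 0"
    using mb by auto
  have irr: "proj_irreducible M (Z n)" for n
    unfolding Z_def
    by (rule proj_irreducible_mono_closure[OF _ b[of n] mb0]) (auto simp: U_def)
  have Z01: "Z 0 \<subset> Z 1"
  proof
    show "Z 0 \<subseteq> Z 1"
      unfolding Z_def by (intro mono_closure_mono) (auto simp: U_def)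
    let ?F = "single (single m0 1) (1::'k) - single (single m1 1) 1"
    have F: "?F \<in> forms M 1"
      using m by (intro forms_diff forms_single) (auto simp: expos_def)
    have F0: "eval_mpol ?F (mono_map M a) = 0" if "a \<in> U 0" for a
      using that m deg[OF m(1) e(1)] deg[OF m(2) e(2)]
      by (simp add: mono_map_def val e U_def flip: power_add)
    \<comment> \<open>At this point the two monomials take the values \<open>2 ^ lookup m0 0\<close>
      and \<open>2 ^ lookup m1 0\<close>, which differ in characteristic zero.\<close>
    define a where "a = (\<lambda>i::nat. if i = 0 then 2 else if i = 1 then 1 else (0::'k))"
    have "eval_mpol ?F (mono_map M a) = 2 ^ lookup m0 0 - 2 ^ lookup m1 0"
      using m by (simp add: mono_map_def val e a_def)
    moreover have "(2::'k) ^ lookup m0 0 \<noteq> 2 ^ lookup m1 0"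
    proof
      assume "(2::'k) ^ lookup m0 0 = 2 ^ lookup m1 0"
      then have "(of_nat (2 ^ lookup m0 0) :: 'k) = of_nat (2 ^ lookup m1 0)"
        by simp
      then have "(2::nat) ^ lookup m0 0 = 2 ^ lookup m1 0"
        by (simp only: of_nat_eq_iff)
      then show False
        using l0 by simp
    qed
    ultimately have ne: "eval_mpol ?F (mono_map M a) \<noteq> 0"
      by simp
    then have "mono_map M a \<notin> Z 0"
      using vanish_mono_closure[OF F F0] unfolding Z_def by blast
    moreover have "mono_map M a \<noteq> 0"
      using ne eval_forms_0[OF F] by (auto simp: zero_fun_def)
    then have "mono_map M a \<in> Z 1"
      unfolding Z_def by (intro mono_map_in_closure) (auto simp: U_def a_def)
    ultimately show "Z 0 \<noteq> Z 1"
      by blast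
  qed
  have Z12: "Z 1 \<subset> Z 2"
  proof
    show "Z 1 \<subseteq> Z 2"
      unfolding Z_def by (intro mono_closure_mono) (auto simp: U_def)
    let ?F = "single (single m2 1) (1::'k)"
    have F: "?F \<in> forms M 1"
      using m by (intro forms_single) (auto simp: expos_def)
    have F0: "eval_mpol ?F (mono_map M a) = 0" if "a \<in> U 1" for a
      using that van2 by simp
    define a where "a = (\<lambda>i::nat. 1::'k)"
    have "eval_mpol ?F (mono_map M a) = 1"
      using m by (simp add: mono_map_def a_def mono_val_def)
    then have ne: "eval_mpol ?F (mono_map M a) \<noteq> 0"
      by simp
    then have "mono_map M a \<notin> Z 1"
      using vanish_mono_closure[OF F F0] unfolding Z_def by blast
    moreover have "mono_map M a \<noteq> 0"
      using ne eval_forms_0[OF F] by (auto simp: zero_fun_def)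
    then have "mono_map M a \<in> Z 2"
      unfolding Z_def by (intro mono_map_in_closure) (auto simp: U_def a_def)
    ultimately show "Z 1 \<noteq> Z 2"
      by blast
  qed
  have Z2: "Z 2 = ?X"
    by (simp add: Z_def U_def monomial_variety_eq)
  define P where "P m \<longleftrightarrow> (\<exists>Z :: nat \<Rightarrow> (nat expo \<Rightarrow> 'k) set.
    (\<forall>i \<le> m. proj_irreducible M (Z i) \<and> Z i \<subseteq> ?X) \<and> (\<forall>i < m. Z i \<subset> Z (Suc i)))" for m
  have "P 2"
    unfolding P_def
  proof (intro exI[of _ Z] conjI allI impI irr)
    fix i :: nat
    show "Z i \<subseteq> ?X"
      unfolding Z_def monomial_variety_eq by (intro mono_closure_mono) simp
    assume "i < 2"
    then have "i = 0 \<or> i = 1"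
      by auto
    then show "Z i \<subset> Z (Suc i)"
      using Z01 Z12 by (auto simp: numeral_2_eq_2)
  qed
  moreover have "n \<le> 2" if "P n" for n
  proof (rule ccontr)
    assume n: "\<not> n \<le> 2"
    from \<open>P n\<close> obtain Z where "\<forall>i \<le> n. proj_irreducible M (Z i) \<and> Z i \<subseteq> ?X" "\<forall>i < n. Z i \<subset> Z (Suc i)"
      unfolding P_def by (elim exE conjE)
    then show False
      using n no_chain_of_length_three[OF M, of Z] by auto
  qed
  ultimately have "Sup {enat m | m. P m} = enat 2"
    by (intro antisym Sup_least Sup_upper) auto
  then show ?thesis
    by (simp add: proj_dim_def P_def numeral_eq_enat)
qed

lemma smooth_monomial_surface:
  assumes M: "M \<subseteq> expos {..2} d" and m: "m0 \<in> M" "m1 \<in> M" "m2 \<in> M"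
    and e: "lookup m0 2 = 0" "lookup m1 2 = 0" "m0 \<noteq> m1" "lookup m2 2 \<noteq> 0"
    and charts: "\<And>p :: nat expo \<Rightarrow> 'k::field_char_0. p \<in> monomial_variety M \<Longrightarrow>
      \<exists>v u w i j. toric_chart TYPE('k) M v u w i j \<and> p v \<noteq> 0"
  shows "smooth_variety M (monomial_variety M :: (nat expo \<Rightarrow> 'k) set)"
  unfolding smooth_variety_def
proof (intro conjI ballI)
  have "mono_val m2 (\<lambda>_. 1::'k) = 1"
    by (simp add: mono_val_def)
  then have "mono_map M (\<lambda>_. 1::'k) m2 \<noteq> 0"
    using m by (simp add: mono_map_def)
  then have "mono_map M (\<lambda>_. 1::'k) \<noteq> 0"
    by auto
  then show "proj_irreducible M (monomial_variety M :: (nat expo \<Rightarrow> 'k) set)"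
    unfolding monomial_variety_eq by (intro proj_irreducible_mono_closure[of _ "\<lambda>_. 1"]) auto
  have fin: "finite M"
    using M finite_expos[of "{..2::nat}" d] finite_subset by auto
  fix p :: "nat expo \<Rightarrow> 'k" assume p: "p \<in> monomial_variety M"
  obtain v u w i j where "toric_chart TYPE('k) M v u w i j" "p v \<noteq> 0"
    using charts[OF p] by blast
  then have "vector_space.dim fun_scale (cone_tangent M (monomial_variety M) p) = 3"
    using dim_cone_tangent[OF fin] p by blast
  moreover have "proj_dim M (monomial_variety M :: (nat expo \<Rightarrow> 'k) set) = 2"
    by (rule proj_dim_monomial_variety[OF M m e])
  ultimately show "enat (vector_space.dim fun_scale (cone_tangent M (monomial_variety M) p)) =
      proj_dim M (monomial_variety M :: (nat expo \<Rightarrow> 'k) set) + 1"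
    by (simp add: numeral_eq_enat one_enat_def)
qed

section \<open>Smooth toric surfaces from truncated triangles\<close>

lemma mono_val_power:
  assumes "finite A" "keys m \<subseteq> A"
  shows "mono_val m c ^ n = (\<Prod>i\<in>A. c i ^ (n * lookup m i))"
  by (simp add: mono_val_superset[OF assms] prod_power_distrib power_mult[symmetric] mult.commute)

text \<open>If \<open>m\<close> is a weighted mean of \<open>m'\<close> and \<open>m''\<close>, the
  matching binomial vanishes on the variety. A nonzero coordinate can thus be pushed to an end of a
  segment, and in the end to a vertex of the polygon.\<close>

lemma power_relation_nonzero:
  fixes p :: "nat expo \<Rightarrow> 'k::field_char_0"
  assumes M: "m \<in> M" "m' \<in> M" "m'' \<in> M" and ab: "a + b > 0"
    and conv: "\<And>i. (a + b) * lookup m i = a * lookup m' i + b * lookup m'' i"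
    and p: "p \<in> monomial_variety M" "p m \<noteq> 0"
  shows "p m' \<noteq> 0 \<or> p m'' \<noteq> 0"
proof -
  let ?x = "\<lambda>k. single (single k 1) (1::'k)"
  let ?F = "?x m ^ (a + b) - ?x m' ^ a * ?x m'' ^ b"
  have x: "?x k \<in> forms M 1" if "k \<in> M" for k
    using that by (intro forms_single) (simp add: expos_def)
  have "?x m ^ (a + b) \<in> forms M ((a + b) * 1)" "?x m' ^ a * ?x m'' ^ b \<in> forms M (a * 1 + b * 1)"
    using M by (intro forms_mult forms_power x; simp)+
  then have F: "?F \<in> forms M (a + b)"
    by (intro forms_diff) simp_all
  have "eval_mpol ?F (mono_map M c) = 0" for c
  proof -
    let ?A = "keys m \<union> keys m' \<union> keys m''"
    have "mono_val m c ^ (a + b) = (\<Prod>i\<in>?A. c i ^ ((a + b) * lookup m i))"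
      by (rule mono_val_power) auto
    also have "\<dots> = (\<Prod>i\<in>?A. c i ^ (a * lookup m' i)) * (\<Prod>i\<in>?A. c i ^ (b * lookup m'' i))"
      unfolding conv power_add prod.distrib ..
    also have "\<dots> = mono_val m' c ^ a * mono_val m'' c ^ b"
      by (subst (1 2) mono_val_power[of ?A]) auto
    finally show ?thesis
      using M by (simp add: mono_map_def)
  qed
  then have "eval_mpol ?F p = 0"
    using vanish_mono_closure[OF F] p(1) unfolding monomial_variety_eq by blast
  then have "p m ^ (a + b) = p m' ^ a * p m'' ^ b"
    by simp
  then show ?thesis
    using p(2) ab by (auto simp: zero_power)
qed

definition expo3 :: "nat \<Rightarrow> nat \<Rightarrow> nat \<Rightarrow> nat \<Rightarrow> nat \<Rightarrow> nat \<Rightarrow> nat expo" where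
  "expo3 X a Y b Z c = single X a + single Y b + single Z c"

text \<open>An arbitrary ordering of the variables 0, 1, 2, so that a single argument serves all
  vertices and edges.\<close>

locale three_variables =
  fixes X Y Z :: nat
  assumes le: "X \<le> 2" "Y \<le> 2" "Z \<le> 2" and ne: "X \<noteq> Y" "X \<noteq> Z" "Y \<noteq> Z"
begin

lemma set_eq: "{..2} = {X, Y, Z}"
  using le ne by auto

lemma lookup_expo3 [simp]:
  "lookup (expo3 X a Y b Z c) X = a" "lookup (expo3 X a Y b Z c) Y = b"
  "lookup (expo3 X a Y b Z c) Z = c"
  using ne by (auto simp: expo3_def lookup_add lookup_single)

lemma keys_expo3: "keys (expo3 X a Y b Z c) \<subseteq> {..2}"
  unfolding set_eq by (auto simp: expo3_def keys_add_nat split: if_splits)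

lemma expo3_in_expos: "a + b + c = d \<Longrightarrow> expo3 X a Y b Z c \<in> expos {..2} d"
  using keys_expo3 by (simp add: expos_def) (simp add: expo3_def)

lemma mono_val_three:
  assumes "keys m \<subseteq> {..2}"
  shows "mono_val m x = x X ^ lookup m X * x Y ^ lookup m Y * x Z ^ lookup m Z"
  using assms ne unfolding set_eq by (simp add: mono_val_superset[of "{X, Y, Z}"] mult.assoc)

lemma tdeg_three': "keys m \<subseteq> {..2} \<Longrightarrow> tdeg m = lookup m X + lookup m Y + lookup m Z"
  using ne unfolding set_eq by (simp add: tdeg_superset[of "{X, Y, Z}"])

lemma ball_le_2: "(\<forall>i\<le>2. P i) \<longleftrightarrow> P X \<and> P Y \<and> P Z"
  using set_eq by (metis atMost_iff insert_iff empty_iff)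

end

text \<open>The lattice points of the triangle with its corners cut off: the corners \<open>x\<^sup>d\<close> and \<open>y\<^sup>d\<close> at height
  \<open>1\<close>, the corner \<open>z\<^sup>d\<close> at height \<open>k\<close>. Inner points may be missing.\<close>

definition cut_height :: "nat \<Rightarrow> nat \<Rightarrow> nat" where
  "cut_height k X = (if X = 2 then k else 1)"

text \<open>A cut at height 1 creates an edge whose only lattice points are its ends, which lie on
  the old edges. A cut at height 2 adds a midpoint, and the second alternative in
  \<open>bdry\<close> is there to provide it.\<close>

locale truncated_triangle =
  fixes M :: "nat expo set" and d k :: nat
  assumes d: "d \<ge> 4" and k: "k = 1 \<or> k = 2"
    and M: "M \<subseteq> expos {..2} d"
    and cut_le: "\<And>m i. m \<in> M \<Longrightarrow> i \<le> 2 \<Longrightarrow> lookup m i + cut_height k i \<le> d"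
    and bdry: "\<And>m. m \<in> expos {..2} d \<Longrightarrow> \<forall>i\<le>2. lookup m i + cut_height k i \<le> d \<Longrightarrow>
      (\<exists>i\<le>2. lookup m i = 0 \<or> cut_height k i = 2 \<and> lookup m i + 2 = d) \<Longrightarrow> m \<in> M"
begin

lemma cut_bounds: "1 \<le> cut_height k i" "cut_height k i \<le> 2" "i \<noteq> j \<Longrightarrow> cut_height k i + cut_height k j \<le> 3"
  using k by (auto simp: cut_height_def)

text \<open>With \<open>D = d - l\<close>, the vertex is \<open>(D, l, 0)\<close>. One lattice step
  along the cut edge, \<open>(0, -1, 1)\<close>, leads to \<open>u\<close>, and one along the old
  edge, \<open>(-1, 1, 0)\<close>, leads to \<open>w\<close>; these two directions are a basis of
  the vectors with sum zero. The ordering of the variables selects one of the six vertices.\<close>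

lemma chart:
  assumes "three_variables X Y Z"
  shows "\<exists>u w i j. toric_chart TYPE('k::field_char_0) M
    (expo3 X (d - cut_height k X) Y (cut_height k X) Z 0) u w i j"
proof -
  interpret three_variables X Y Z by fact
  define l where "l = cut_height k X"
  define D where "D = d - l"
  have l: "1 \<le> l" "l \<le> 2" "l + cut_height k Y \<le> 3" "d = D + l" "D \<ge> 2" "cut_height k Z \<le> 2" "cut_height k Y \<le> 2"
    using cut_bounds(1,2)[of X] cut_bounds(2)[of Y] cut_bounds(2)[of Z] cut_bounds(3)[OF ne(1)] d
    by (simp_all add: l_def D_def)
  define v where "v = expo3 X D Y l Z 0"
  define u where "u = expo3 X D Y (l - 1) Z 1"
  define w where "w = expo3 X (D - 1) Y (l + 1) Z 0"
  define i where "i m = lookup m Z" for m :: "nat expo"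
  define j where "j m = D - lookup m X" for m :: "nat expo"
  have v: "v \<in> M"
  proof (rule bdry)
    show "v \<in> expos {..2} d"
      unfolding v_def using l by (intro expo3_in_expos) simp
    show "\<forall>i\<le>2. lookup v i + cut_height k i \<le> d"
      unfolding ball_le_2 v_def using l d by (auto simp flip: l_def)
    show "\<exists>i\<le>2. lookup v i = 0 \<or> cut_height k i = 2 \<and> lookup v i + 2 = d"
      using le by (intro exI[of _ Z]) (simp add: v_def)
  qed
  have u: "u \<in> M"
  proof (rule bdry)
    show "u \<in> expos {..2} d"
      unfolding u_def using l by (intro expo3_in_expos) simp
    show "\<forall>i\<le>2. lookup u i + cut_height k i \<le> d"
      unfolding ball_le_2 u_def using l d by (auto simp flip: l_def)
    \<comment> \<open>For \<open>l = 1\<close> the neighbour \<open>u\<close> is the other end of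
      the cut edge and lies on an old edge; for \<open>l = 2\<close> it is the midpoint.\<close>
    show "\<exists>i\<le>2. lookup u i = 0 \<or> cut_height k i = 2 \<and> lookup u i + 2 = d"
    proof (cases "l = 1")
      case True
      then show ?thesis
        using le by (intro exI[of _ Y]) (simp add: u_def)
    next
      case False
      then have "l = 2"
        using l by simp
      then show ?thesis
        using le l by (intro exI[of _ X]) (simp add: u_def flip: l_def)
    qed
  qed
  have w: "w \<in> M"
  proof (rule bdry)
    show "w \<in> expos {..2} d"
      unfolding w_def using l by (intro expo3_in_expos) simp
    show "\<forall>i\<le>2. lookup w i + cut_height k i \<le> d"
      unfolding ball_le_2 w_def using l d by (auto simp flip: l_def)
    show "\<exists>i\<le>2. lookup w i = 0 \<or> cut_height k i = 2 \<and> lookup w i + 2 = d"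
      using le by (intro exI[of _ Z]) (simp add: w_def)
  qed
  have mM: "keys m \<subseteq> {..2}" "lookup m X \<le> D" "lookup m X + j m = D" 
      "lookup m Y + i m = l + j m" if "m \<in> M" for m
  proof -
    show *: "keys m \<subseteq> {..2}"
      using M that by (auto simp: expos_def)
    have "tdeg m = d"
      using M that by (auto simp: expos_def)
    then have "lookup m X + lookup m Y + lookup m Z = d"
      using tdeg_three'[OF *] by simp
    moreover show "lookup m X \<le> D"
      using cut_le[OF that le(1)] l by (simp flip: l_def)
    ultimately show "lookup m X + j m = D" "lookup m Y + i m = l + j m"
      using l by (simp_all add: i_def j_def)
  qed
  have rel: "mono_val m a * mono_val v a ^ (i m + j m) = mono_val v a * mono_val u a ^ i m * mono_val w a ^ j m"
    if m: "m \<in> M" for m and a :: "nat \<Rightarrow> 'k"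
  proof -
    obtain D' where D': "D = Suc D'"
      using l by (cases D) auto
    obtain l' where l': "l = Suc l'"
      using l by (cases l) auto
    have eX: "lookup m X + D * (i m + j m) = D + D * i m + (D - 1) * j m"
      using mM(3)[OF m] by (simp add: D' algebra_simps)
    have eY: "lookup m Y + l * (i m + j m) = l + (l - 1) * i m + (l + 1) * j m"
      using mM(4)[OF m] by (simp add: l' algebra_simps)
    have "mono_val m a * mono_val v a ^ (i m + j m) =
        a X ^ (lookup m X + D * (i m + j m)) * a Y ^ (lookup m Y + l * (i m + j m)) * a Z ^ i m"
      using mM(1)[OF m] mM(1)[OF v]
      by (simp add: mono_val_three v_def i_def power_add power_mult power_mult_distrib)
    also have "\<dots> = mono_val v a * mono_val u a ^ i m * mono_val w a ^ j m"
      unfolding eX eY using mM(1)[OF v] mM(1)[OF u] mM(1)[OF w]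
      by (simp add: mono_val_three v_def u_def w_def power_add power_mult power_mult_distrib)
    finally show ?thesis .
  qed
  have par: "\<exists>a c. c \<noteq> 0 \<and> (\<forall>m\<in>M. mono_val m a = c * \<alpha> ^ i m * \<beta> ^ j m)"
    if "\<alpha> \<noteq> 0" "\<beta> \<noteq> 0" for \<alpha> \<beta> :: 'k
  proof (intro exI conjI ballI)
    \<comment> \<open>The ratios to the coordinate \<open>v\<close> are z/y at \<open>u\<close> and
      y/x at \<open>w\<close>. Setting x = 1 and equating them with \<alpha> and \<beta> gives y =
      \<beta> and z = \<alpha>\<beta>; the value at \<open>v\<close> is then
      \<open>\<beta> ^ l\<close>.\<close>
    let ?a = "\<lambda>n. if n = X then 1 else if n = Y then \<beta> else \<alpha> * \<beta>"
    show "\<beta> ^ l \<noteq> 0"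
      using that by simp
    fix m assume m: "m \<in> M"
    have "mono_val m ?a = \<alpha> ^ i m * \<beta> ^ (lookup m Y + i m)"
      using ne by (simp add: mono_val_three[OF mM(1)[OF m]] i_def power_mult_distrib power_add)
    then show "mono_val m ?a = \<beta> ^ l * \<alpha> ^ i m * \<beta> ^ j m"
      by (simp add: mM(4)[OF m] power_add)
  qed
  have "i v = 0" "j v = 0" "i u = 1" "j u = 0" "i w = 0" "j w = 1"
    using l by (simp_all add: i_def j_def v_def u_def w_def)
  then have "toric_chart TYPE('k) M v u w i j"
    unfolding toric_chart_def using u v w rel par by blast
  then show ?thesis
    unfolding v_def D_def l_def by blast
qed

lemma edge:
  fixes p :: "nat expo \<Rightarrow> 'k::field_char_0"
  assumes "three_variables X Y Z" and m: "m \<in> M" "lookup m Z = 0"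
    and p: "p \<in> monomial_variety M" "p m \<noteq> 0"
  shows "\<exists>v u w i j. toric_chart TYPE('k) M v u w i j \<and> p v \<noteq> 0"
proof -
  interpret three_variables X Y Z by fact
  interpret yx: three_variables Y X Z
    by unfold_locales (use le ne in auto)
  have c: "1 \<le> cut_height k X" "1 \<le> cut_height k Y" "cut_height k X + cut_height k Y \<le> 3"
    using cut_bounds ne by auto
  let ?v = "expo3 X (d - cut_height k X) Y (cut_height k X) Z 0"
  let ?v' = "expo3 Y (d - cut_height k Y) X (cut_height k Y) Z 0"
  obtain u w i j where ch: "toric_chart TYPE('k) M ?v u w i j"
    using chart[OF assms(1), where 'k='k] by blast
  obtain u' w' i' j' where ch': "toric_chart TYPE('k) M ?v' u' w' i' j'"
    using chart[OF yx.three_variables_axioms, where 'k='k] by blast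
  have vM: "?v \<in> M" "?v' \<in> M"
    using ch ch' by (simp_all add: toric_chart_def)
  have km: "keys m \<subseteq> {..2}" "tdeg m = d"
    using M m by (auto simp: expos_def)
  have deg: "lookup m X + lookup m Y = d"
    using tdeg_three'[OF km(1)] km(2) m(2) by simp
  have bd: "lookup m X + cut_height k X \<le> d" "lookup m Y + cut_height k Y \<le> d"
    using cut_le[OF m(1)] le by auto
  \<comment> \<open>The lattice distances of \<open>m\<close> from the far vertex \<open>?v'\<close>
    and from \<open>?v\<close>, which are the weights of \<open>?v\<close> and \<open>?v'\<close>.
    Their sum, the length of the edge, is at least \<open>d - 3\<close>.\<close>
  define a where "a = lookup m X - cut_height k Y"
  define b where "b = lookup m Y - cut_height k X"
  have ab: "lookup m X = a + cut_height k Y" "lookup m Y = b + cut_height k X" "d - cut_height k X = a + b + cut_height k Y"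
      "d - cut_height k Y = a + b + cut_height k X"
    using deg bd by (auto simp: a_def b_def)
  have conv: "(a + b) * lookup m n = a * lookup ?v n + b * lookup ?v' n" for n
  proof (cases "n \<in> {..2}")
    case True
    then have "n = X \<or> n = Y \<or> n = Z"
      by (simp add: set_eq)
    then show ?thesis
      using m(2) ab by (auto simp: algebra_simps)
  next
    case False
    have "n \<notin> keys m" "n \<notin> keys ?v" "n \<notin> keys ?v'"
      using False km(1) keys_expo3 yx.keys_expo3 by blast+
    then show ?thesis
      by (simp add: in_keys_iff)
  qed
  have "a + b > 0"
    using ab c d by linarith
  then have "p ?v \<noteq> 0 \<or> p ?v' \<noteq> 0"
    by (rule power_relation_nonzero[OF m(1) vM _ conv p])
  then show ?thesis
    using ch ch' by blast
qed

text \<open>An inner exponent lies on the segment of constant last exponent. Its ends are on the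
  sides where variable 0 or 1 is absent, and the cut of the last corner does not remove them. One
  application of \<open>power_relation_nonzero\<close> reaches an edge, a second one a
  vertex.\<close>

lemma covered_by_charts:
  fixes p :: "nat expo \<Rightarrow> 'k::field_char_0"
  assumes p: "p \<in> monomial_variety M"
  shows "\<exists>v u w i j. toric_chart TYPE('k) M v u w i j \<and> p v \<noteq> 0"
proof -
  interpret xyz: three_variables 0 1 2
    by unfold_locales auto
  have "p \<in> vecs M - {0}"
    using p proj_closed_subset_vecs[OF proj_closed_mono_closure[of M UNIV]] 
    unfolding monomial_variety_eq by blast
  then obtain m where m: "m \<in> M" "p m \<noteq> 0"
    by (auto simp: vecs_def fun_eq_iff)
  have km: "keys m \<subseteq> {..2}" "tdeg m = d"
    using M m by (auto simp: expos_def)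
  have "\<exists>m'\<in>M. p m' \<noteq> 0 \<and> (lookup m' 0 = 0 \<or> lookup m' 1 = 0 \<or> lookup m' 2 = 0)"
  proof (cases "lookup m 0 + lookup m 1 = 0 \<or> lookup m 2 = 0")
    case True
    then show ?thesis
      using m by auto
  next
    case False
    let ?a = "lookup m 0" and ?b = "lookup m 1" and ?c = "lookup m 2"
    have deg: "?a + ?b + ?c = d"
      using xyz.tdeg_three'[OF km(1)] km(2) by simp
    let ?v = "expo3 0 (?a + ?b) 1 0 2 ?c" and ?v' = "expo3 0 0 1 (?a + ?b) 2 ?c"
    have c2: "?c + cut_height k 2 \<le> d"
      using cut_le[OF m(1)] by simp
    have in_M: "?v \<in> M" "?v' \<in> M"
    proof -
      show "?v \<in> M"
      proof (rule bdry)
        show "?v \<in> expos {..2} d"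
          using deg by (intro xyz.expo3_in_expos) simp
        show "\<forall>i\<le>2. lookup ?v i + cut_height k i \<le> d"
          unfolding xyz.ball_le_2 xyz.lookup_expo3 using deg False d c2 by (auto simp: cut_height_def)
        show "\<exists>i\<le>2. lookup ?v i = 0 \<or> cut_height k i = 2 \<and> lookup ?v i + 2 = d"
          by (intro exI[of _ 1]) (simp only: xyz.lookup_expo3, simp)
      qed
      show "?v' \<in> M"
      proof (rule bdry)
        show "?v' \<in> expos {..2} d"
          using deg by (intro xyz.expo3_in_expos) simp
        show "\<forall>i\<le>2. lookup ?v' i + cut_height k i \<le> d"
          unfolding xyz.ball_le_2 xyz.lookup_expo3 using deg False d c2 by (auto simp: cut_height_def)
        show "\<exists>i\<le>2. lookup ?v' i = 0 \<or> cut_height k i = 2 \<and> lookup ?v' i + 2 = d"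
          by (intro exI[of _ 0]) (simp only: xyz.lookup_expo3, simp)
      qed
    qed
    have conv: "(?a + ?b) * lookup m n = ?a * lookup ?v n + ?b * lookup ?v' n" for n
    proof (cases "n \<in> {..2}")
      case True
      then have "n = 0 \<or> n = 1 \<or> n = 2"
        by auto
      then show ?thesis
        by (elim disjE) (simp_all only: xyz.lookup_expo3, simp_all add: algebra_simps)
    next
      case False
      have "n \<notin> keys m" "n \<notin> keys ?v" "n \<notin> keys ?v'"
        using False km(1) xyz.keys_expo3 by blast+
      then show ?thesis
        by (simp add: in_keys_iff)
    qed
    have "p ?v \<noteq> 0 \<or> p ?v' \<noteq> 0"
      by (rule power_relation_nonzero[OF m(1) in_M _ conv p m(2)]) (use False in auto)
    then show ?thesis
      using in_M xyz.lookup_expo3 by metis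
  qed
  then obtain m' where m': "m' \<in> M" "p m' \<noteq> 0"
      "lookup m' 0 = 0 \<or> lookup m' 1 = 0 \<or> lookup m' 2 = 0"
    by blast
  have "three_variables 1 2 0" "three_variables 0 2 1" "three_variables 0 1 2"
    by unfold_locales auto
  then show ?thesis
    using edge[OF _ m'(1) _ p m'(2)] m'(3) by blast
qed

lemma smooth: "smooth_variety M (monomial_variety M :: (nat expo \<Rightarrow> 'k::field_char_0) set)"
proof -
  interpret xyz: three_variables 0 1 2
    by unfold_locales auto
  let ?m = "\<lambda>a b c. expo3 0 a 1 b 2 c"
  have in_M: "?m a b c \<in> M" if "a + b + c = d" "a < d" "b < d" "c + 2 \<le> d" "c = 0 \<or> b = 0" for a b c
  proof (rule bdry)
    show "?m a b c \<in> expos {..2} d"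
      using that by (intro xyz.expo3_in_expos) simp
    show "\<forall>i\<le>2. lookup (?m a b c) i + cut_height k i \<le> d"
      unfolding xyz.ball_le_2 xyz.lookup_expo3 using that d k by (auto simp: cut_height_def)
    show "\<exists>i\<le>2. lookup (?m a b c) i = 0 \<or> cut_height k i = 2 \<and> lookup (?m a b c) i + 2 = d"
      using that(5) xyz.lookup_expo3[of a b c] by (metis one_le_numeral order_refl)
  qed
  have m: "?m (d - 1) 1 0 \<in> M" "?m (d - 2) 2 0 \<in> M" "?m (d - 1) 0 1 \<in> M"
    by (rule in_M; use d in simp)+
  show ?thesis
  proof (rule smooth_monomial_surface[OF M m])
    show "?m (d - 1) 1 0 \<noteq> ?m (d - 2) 2 0"
      using xyz.lookup_expo3(2) by (metis one_eq_numeral_iff num.distinct(1))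
  qed (auto simp only: xyz.lookup_expo3 covered_by_charts)
qed

end

section \<open>Monomial ideals\<close>

interpretation mpoly: cring "mpoly_ring V :: ('v, 'k::field) mpol ring" for V
  by (rule cring_mpoly_ring)

lemma mpoly_ring_simps [simp]:
  "p \<in> carrier (mpoly_ring V) \<longleftrightarrow> (\<forall>m\<in>keys p. keys m \<subseteq> V)"
  "p \<otimes>\<^bsub>mpoly_ring V\<^esub> q = p * q" "p \<oplus>\<^bsub>mpoly_ring V\<^esub> q = p + q"
  "\<zero>\<^bsub>mpoly_ring V\<^esub> = 0" "\<one>\<^bsub>mpoly_ring V\<^esub> = 1"
  by (simp_all add: mpoly_ring_def)

lemma mpoly_ring_uminus:
  fixes p :: "('v, 'k::field) mpol"
  assumes "p \<in> carrier (mpoly_ring V)"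
  shows "\<ominus>\<^bsub>mpoly_ring V\<^esub> p = - p"
  by (rule mpoly.minus_equality) (use assms in simp_all)

lemma mpoly_ring_diff:
  fixes p q :: "('v, 'k::field) mpol"
  assumes "q \<in> carrier (mpoly_ring V)"
  shows "p \<ominus>\<^bsub>mpoly_ring V\<^esub> q = p - q"
  using mpoly_ring_uminus[OF assms] by (simp add: a_minus_def)

lemma forms_subset_carrier: "forms V d \<subseteq> carrier (mpoly_ring V)"
  by (auto simp: forms_def expos_def subset_iff)

lemma mpoly_idealI:
  fixes I :: "('v, 'k::field) mpol set"
  assumes sub: "I \<subseteq> carrier (mpoly_ring V)" and zero: "0 \<in> I"
    and add: "\<And>p q. p \<in> I \<Longrightarrow> q \<in> I \<Longrightarrow> p + q \<in> I"
    and mult: "\<And>p q. p \<in> I \<Longrightarrow> q \<in> carrier (mpoly_ring V) \<Longrightarrow> q * p \<in> I"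
  shows "ideal I (mpoly_ring V)"
proof (rule idealI)
  show "ring (mpoly_ring V :: ('v, 'k) mpol ring)"
    by (rule mpoly.ring_axioms)
  show "subgroup I (add_monoid (mpoly_ring V))"
  proof
    fix p assume p: "p \<in> I"
    have "- p = single 0 (- 1) * p"
      by (simp add: single_uminus)
    moreover have "single 0 (- 1) * p \<in> I"
      using p by (intro mult) simp_all
    moreover have "inv\<^bsub>add_monoid (mpoly_ring V)\<^esub> p = - p"
      using mpoly_ring_uminus[of p V] p sub unfolding a_inv_def by blast
    ultimately show "inv\<^bsub>add_monoid (mpoly_ring V)\<^esub> p \<in> I"
      by simp
  qed (use sub zero add in auto)
  show "q \<otimes>\<^bsub>mpoly_ring V\<^esub> p \<in> I" "p \<otimes>\<^bsub>mpoly_ring V\<^esub> q \<in> I"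
    if "p \<in> I" "q \<in> carrier (mpoly_ring V)" for p q
    using mult[OF that] by (simp_all add: mult.commute)
qed

lemma mpoly_ideal_closed:
  fixes I :: "('v, 'k::field) mpol set"
  assumes I: "ideal I (mpoly_ring V)"
  shows "I \<subseteq> carrier (mpoly_ring V)" "0 \<in> I" "p \<in> I \<Longrightarrow> q \<in> I \<Longrightarrow> p + q \<in> I"
    "p \<in> I \<Longrightarrow> q \<in> carrier (mpoly_ring V) \<Longrightarrow> q * p \<in> I"
proof -
  interpret ideal I "mpoly_ring V" by fact
  show "I \<subseteq> carrier (mpoly_ring V)"
    by (rule a_subset)
  show "0 \<in> I"
    using zero_closed by simp
  show "p + q \<in> I" if "p \<in> I" "q \<in> I"
    using a_closed[OF that] by simp
  show "q * p \<in> I" if "p \<in> I" "q \<in> carrier (mpoly_ring V)"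
    using I_l_closed[OF that] by simp
qed

lemma mpoly_ideal_sum:
  fixes I :: "('v, 'k::field) mpol set"
  assumes I: "ideal I (mpoly_ring V)" and "\<And>x. x \<in> A \<Longrightarrow> f x \<in> I"
  shows "sum f A \<in> I"
  using assms(2) by (induction A rule: infinite_finite_induct) (auto intro: mpoly_ideal_closed[OF I])

lemma mpoly_coset_eq_iff:
  fixes I :: "('v, 'k::field) mpol set"
  assumes I: "ideal I (mpoly_ring V)" and "p \<in> carrier (mpoly_ring V)" "q \<in> carrier (mpoly_ring V)"
  shows "I +>\<^bsub>mpoly_ring V\<^esub> p = I +>\<^bsub>mpoly_ring V\<^esub> q \<longleftrightarrow> p - q \<in> I"
  using mpoly.quotient_eq_iff_same_a_r_cos[OF assms] mpoly_ring_diff[OF assms(3), of p] by simp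

lemma mult_map_coset:
  fixes I :: "(nat, 'k::field) mpol set"
  assumes I: "ideal I (PR n)" and "L \<in> carrier (PR n)" "F \<in> carrier (PR n)"
  shows "mult_map n I L (I +>\<^bsub>PR n\<^esub> F) = I +>\<^bsub>PR n\<^esub> (L * F)"
  using ideal.rcoset_mult_add[OF I assms(2,3)] by (simp add: mult_map_def FactRing_def)

text \<open>Membership is decided monomial by monomial through divisibility. The cofactor
  \<open>t\<close> needs no condition on its variables, since exponents are natural numbers and
  those of \<open>m\<close> lie in \<open>V\<close>.\<close>

definition mono_ideal :: "'v set \<Rightarrow> 'v expo set \<Rightarrow> ('v, 'k::field) mpol set" where
  "mono_ideal V E = {p. \<forall>m\<in>keys p. keys m \<subseteq> V \<and> (\<exists>e\<in>E. \<exists>t. m = e + t)}"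

lemma ideal_mono_ideal: "ideal (mono_ideal V E :: ('v, 'k::field) mpol set) (mpoly_ring V)"
proof (rule mpoly_idealI)
  show "mono_ideal V E \<subseteq> carrier (mpoly_ring V)"
    by (auto simp: mono_ideal_def)
  show "0 \<in> mono_ideal V E"
    by (simp add: mono_ideal_def)
  show "p + q \<in> mono_ideal V E" if "p \<in> mono_ideal V E" "q \<in> mono_ideal V E" for p q :: "('v, 'k) mpol"
    using that Poly_Mapping.keys_add[of p q] unfolding mono_ideal_def by blast
  show "q * p \<in> mono_ideal V E" if p: "p \<in> mono_ideal V E" and q: "q \<in> carrier (mpoly_ring V)" for p q :: "('v, 'k) mpol"
    unfolding mono_ideal_def
  proof (intro CollectI ballI)
    fix m assume "m \<in> keys (q * p)"
    then obtain a b where ab: "m = a + b" "a \<in> keys q" "b \<in> keys p"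
      using Poly_Mapping.keys_mult[of q p] by blast
    then obtain e t where "e \<in> E" "b = e + t"
      using p unfolding mono_ideal_def by blast
    then have "m = e + (a + t)"
      by (simp add: ab(1) add_ac)
    moreover have "keys m \<subseteq> V"
      using ab p q by (auto simp: keys_add_nat mono_ideal_def)
    ultimately show "keys m \<subseteq> V \<and> (\<exists>e\<in>E. \<exists>t. m = e + t)"
      using \<open>e \<in> E\<close> by blast
  qed
qed

lemma genideal_monomials:
  assumes E: "\<And>e. e \<in> E \<Longrightarrow> keys e \<subseteq> V"
  shows "Idl\<^bsub>mpoly_ring V\<^esub> ((\<lambda>m. single m 1) ` E) = (mono_ideal V E :: ('v, 'k::field) mpol set)"
proof
  have gens: "(\<lambda>m. single m 1) ` E \<subseteq> (mono_ideal V E :: ('v, 'k) mpol set)"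
  proof clarify
    fix e assume e: "e \<in> E"
    then have "\<exists>e'\<in>E. \<exists>t. e = e' + t"
      by (intro bexI[of _ e] exI[of _ 0]) simp_all
    then show "single e 1 \<in> (mono_ideal V E :: ('v, 'k) mpol set)"
      using E[OF e] by (simp add: mono_ideal_def)
  qed
  show "Idl\<^bsub>mpoly_ring V\<^esub> ((\<lambda>m. single m 1) ` E) \<subseteq> (mono_ideal V E :: ('v, 'k) mpol set)"
    by (rule mpoly.genideal_minimal[OF ideal_mono_ideal gens])
  show "(mono_ideal V E :: ('v, 'k) mpol set) \<subseteq> Idl\<^bsub>mpoly_ring V\<^esub> ((\<lambda>m. single m 1) ` E)" (is "_ \<subseteq> ?I")
  proof
    have sub: "(\<lambda>m. single m 1) ` E \<subseteq> carrier (mpoly_ring V :: ('v, 'k) mpol ring)"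
      using E by auto
    have I: "ideal ?I (mpoly_ring V)"
      by (rule mpoly.genideal_ideal[OF sub])
    fix p :: "('v, 'k) mpol" assume p: "p \<in> mono_ideal V E"
    have "single m (lookup p m) \<in> ?I" if m: "m \<in> keys p" for m
    proof -
      obtain e t where et: "e \<in> E" "m = e + t" "keys m \<subseteq> V"
        using p m unfolding mono_ideal_def by blast
      have "single t (lookup p m) * single e 1 \<in> ?I"
      proof (rule mpoly_ideal_closed(4)[OF I])
        show "single e 1 \<in> ?I"
          using mpoly.genideal_self[OF sub] et(1) by blast
        show "single t (lookup p m) \<in> carrier (mpoly_ring V)"
          using et by (auto simp: keys_add_nat)
      qed
      then show ?thesis
        by (simp add: mult_single et(2) add.commute)
    qed
    then have "(\<Sum>m\<in>keys p. single m (lookup p m)) \<in> ?I"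
      by (rule mpoly_ideal_sum[OF I])
    then show "p \<in> ?I"
      using poly_mapping_sum_singles[of p] by simp
  qed
qed

text \<open>In the degree of the generators the cofactor has degree 0, so membership in the ideal
  reduces to an inclusion of supports.\<close>

lemma forms_in_mono_ideal:
  assumes E: "E \<subseteq> expos V d" and p: "p \<in> forms V d"
  shows "p \<in> mono_ideal V E \<longleftrightarrow> keys p \<subseteq> E"
proof
  assume I: "p \<in> mono_ideal V E"
  show "keys p \<subseteq> E"
  proof
    fix m assume m: "m \<in> keys p"
    then obtain e t where et: "e \<in> E" "m = e + t"
      using I unfolding mono_ideal_def by blast
    have "tdeg m = d" "tdeg e = d"
      using p m E et(1) by (auto simp: forms_def expos_def)
    then have "tdeg t = 0"
      by (simp add: et(2))
    then show "m \<in> E"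
      using et by simp
  qed
next
  assume "keys p \<subseteq> E"
  then show "p \<in> mono_ideal V E"
    using E by (fastforce simp: mono_ideal_def expos_def intro: exI[of _ 0])
qed

lemma low_forms_in_mono_ideal:
  assumes E: "E \<subseteq> expos V d" and p: "p \<in> forms V d'" "p \<in> mono_ideal V E" and "d' < d"
  shows "p = 0"
proof (rule ccontr)
  assume "p \<noteq> 0"
  then obtain m where m: "m \<in> keys p"
    by (metis all_not_in_conv keys_eq_empty)
  then obtain e t where "e \<in> E" "m = e + t"
    using p(2) unfolding mono_ideal_def by blast
  moreover have "tdeg m = d'" "tdeg e = d"
    using m p(1) E \<open>e \<in> E\<close> by (auto simp: forms_def expos_def)
  ultimately show False
    using \<open>d' < d\<close> by simp
qed

lemma single_in_mono_ideal:
  assumes E: "E \<subseteq> expos V d" and "m \<in> expos V d"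
  shows "single m 1 \<in> (mono_ideal V E :: ('v, 'k::field) mpol set) \<longleftrightarrow> m \<in> E"
  using forms_in_mono_ideal[OF E, of "single m (1::'k)"] assms(2) by simp

section \<open>The minimal number of generators\<close>

lemma independent_indicators:
  assumes "finite E"
  shows "fs.independent ((\<lambda>e m. if m = e then 1 else 0 :: 'k::field) ` E)"
proof (rule fs.independent_if_scalars_zero)
  let ?\<delta> = "\<lambda>e m. if m = e then 1 else 0 :: 'k"
  have inj: "inj_on ?\<delta> E"
    by (rule inj_onI) (metis zero_neq_one)
  show "finite (?\<delta> ` E)"
    using assms by simp
  fix f x assume sum: "(\<Sum>x\<in>?\<delta> ` E. fun_scale (f x) x) = 0" and "x \<in> ?\<delta> ` E"
  then obtain e where e: "e \<in> E" "x = ?\<delta> e"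
    by blast
  have "0 = (\<Sum>x\<in>?\<delta> ` E. fun_scale (f x) x) e"
    using sum by simp
  also have "\<dots> = (\<Sum>e'\<in>E. if e = e' then f (?\<delta> e') else 0)"
    by (simp add: sum.reindex[OF inj] sum_apply fun_scale_def if_distrib[of "(*) _"] cong: if_cong)
  also have "\<dots> = f x"
    using assms e by simp
  finally show "f x = 0" ..
qed

lemma card_indicators: "card ((\<lambda>e m. if m = e then 1 else 0 :: 'k::field) ` E) = card E"
  by (rule card_image, rule inj_onI) (metis zero_neq_one)

text \<open>Taking the degree \<open>d\<close> part of an ideal that starts in degree \<open>d\<close> kills all the nonconstant
  coefficients, so that generators of the ideal span its degree \<open>d\<close> part as a vector space.\<close>

lemma num_gens_mono_ideal:
  assumes E: "E \<subseteq> expos {..n} d"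
  shows "num_gens n (mono_ideal {..n} E :: (nat, 'k::field) mpol set) = card E"
  unfolding num_gens_def
proof (rule Least_equality)
  let ?I = "mono_ideal {..n} E :: (nat, 'k) mpol set"
  have fin: "finite E"
    using E finite_expos[of "{..n}" d] finite_subset by auto
  have key: "keys e \<subseteq> {..n}" if "e \<in> E" for e
    using E that by (auto simp: expos_def)
  show "\<exists>S\<subseteq>carrier (PR n). finite S \<and> card S = card E \<and> ?I = Idl\<^bsub>PR n\<^esub> S"
  proof (intro exI[of _ "(\<lambda>m. single m 1) ` E"] conjI)
    show "card ((\<lambda>m. single m (1::'k)) ` E) = card E"
      by (rule card_image, rule inj_onI) (metis keys_single singleton_inject zero_neq_one)
    show "?I = Idl\<^bsub>PR n\<^esub> ((\<lambda>m. single m 1) ` E)"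
      using genideal_monomials[of E "{..n}"] key by auto
  qed (use fin key in auto)
  fix r assume "\<exists>S\<subseteq>carrier (PR n). finite S \<and> card S = r \<and> ?I = Idl\<^bsub>PR n\<^esub> S"
  then obtain S where S: "S \<subseteq> carrier (PR n)" "finite S" "card S = r" "?I = Idl\<^bsub>PR n\<^esub> S"
    by blast
  define h where "h p = (\<lambda>m. if m \<in> E then lookup p m else 0)" for p :: "(nat, 'k) mpol"
  have SI: "S \<subseteq> ?I"
    using mpoly.genideal_self[OF S(1)] S(4) by simp
  have low: "tdeg m \<ge> d" if "p \<in> ?I" "m \<in> keys p" for p m
    using that E tdeg_add unfolding mono_ideal_def expos_def by fastforce
  \<comment> \<open>The elements whose degree \<open>d\<close> part is spanned by those of the
    generators form an ideal. It contains \<open>S\<close>, hence all of \<open>?I\<close>.\<close>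
  define K where "K = {p \<in> ?I. h p \<in> fs.span (h ` S)}"
  have "ideal K (PR n)"
  proof (rule mpoly_idealI)
    show "K \<subseteq> carrier (PR n)" 
      using mpoly_ideal_closed(1)[OF ideal_mono_ideal] unfolding K_def by blast
    have "h 0 = 0"
      by (auto simp: h_def)
    then show "0 \<in> K"
      by (simp add: K_def mpoly_ideal_closed(2)[OF ideal_mono_ideal] fs.span_zero)
    show "p + q \<in> K" if "p \<in> K" "q \<in> K" for p q
    proof -
      have "h (p + q) = h p + h q"
        by (auto simp: h_def lookup_add)
      then show ?thesis
        using that by (simp add: K_def mpoly_ideal_closed(3)[OF ideal_mono_ideal] fs.span_add)
    qed
    show "q * p \<in> K" if p: "p \<in> K" and q: "q \<in> carrier (PR n)" for p q
    proof -
      have pI: "p \<in> ?I"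
        using p by (simp add: K_def)
      have "lookup (q * p) m = lookup q 0 * lookup p m" if m: "m \<in> E" for m
      proof -
        have dm: "tdeg m = d"
          using m E by (auto simp: expos_def)
        have "lookup (q * p) m = (\<Sum>a\<in>keys q. \<Sum>b\<in>keys p. if a = 0 \<and> b = m then lookup q 0 * lookup p m else 0)"
          unfolding lookup_mult_sum
        proof (intro sum.cong refl)
          fix a b assume ab: "a \<in> keys q" "b \<in> keys p"
          have "a + b = m \<longleftrightarrow> a = 0 \<and> b = m"
            using low[OF pI ab(2)] dm by auto
          then show "(if a + b = m then lookup q a * lookup p b else 0) =
              (if a = 0 \<and> b = m then lookup q 0 * lookup p m else 0)"
            by auto
        qed
        also have "\<dots> = (\<Sum>a\<in>keys q. if a = 0 then (\<Sum>b\<in>keys p. if b = m then lookup q 0 * lookup p m else 0) else 0)"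
          by (intro sum.cong refl) auto
        also have "\<dots> = lookup q 0 * lookup p m"
          by (simp add: in_keys_iff)
        finally show ?thesis .
      qed
      then have "h (q * p) = fun_scale (lookup q 0) (h p)"
        by (auto simp: h_def fun_scale_def)
      then show ?thesis
        using p mpoly_ideal_closed(4)[OF ideal_mono_ideal pI q] by (simp add: K_def fs.span_scale)
    qed
  qed
  moreover have "S \<subseteq> K"
    using SI by (auto simp: K_def intro: fs.span_base)
  ultimately have IK: "?I \<subseteq> K"
    unfolding S(4) by (rule mpoly.genideal_minimal)
  have "(\<lambda>e m. if m = e then 1 else 0 :: 'k) ` E \<subseteq> fs.span (h ` S)"
  proof clarify
    fix e assume e: "e \<in> E"
    then have "single e 1 \<in> K"
      using IK single_in_mono_ideal[OF E, of e] E by auto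
    moreover have "h (single e 1) = (\<lambda>m. if m = e then 1 else 0)"
      using e by (auto simp: h_def lookup_single)
    ultimately show "(\<lambda>m. if m = e then 1 else 0) \<in> fs.span (h ` S)"
      by (simp add: K_def)
  qed
  then have "card E \<le> card (h ` S)"
    using fs.independent_span_bound[OF finite_imageI[OF S(2)] independent_indicators[OF fin, where 'k='k]]
    by (simp add: card_indicators)
  also have "\<dots> \<le> r"
    using card_image_le[OF S(2)] S(3) by auto
  finally show "card E \<le> r" .
qed

section \<open>Artinian quotients by monomial ideals\<close>

lemma decreasing_subspaces_stabilize:
  fixes S :: "nat \<Rightarrow> ('v \<Rightarrow> 'k::field) set"
  assumes "finite T" and sub: "\<And>i. fs.subspace (S i)" and span: "\<And>i. S i \<subseteq> fs.span T"
    and dec: "\<And>i. S (Suc i) \<subseteq> S i"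
  shows "\<exists>m. \<forall>i\<ge>m. S i = S m"
proof -
  \<comment> \<open>A member of least dimension; a proper inclusion after it would allow an
    independent set to be enlarged beyond that dimension.\<close>
  obtain m where m: "\<And>i. fs.dim (S m) \<le> fs.dim (S i)"
    using ex_has_least_nat[of "\<lambda>_. True" 0 "\<lambda>i. fs.dim (S i)"] by auto
  have fin: "finite B" if "B \<subseteq> S i" "fs.independent B" for B i
    using fs.independent_span_bound[OF assms(1) that(2)] that(1) span by blast
  have "S i = S m" if "i \<ge> m" for i
  proof
    show im: "S i \<subseteq> S m"
      using that by (induction i rule: dec_induct) (use dec in blast)+
    show "S m \<subseteq> S i"
    proof (rule ccontr)
      assume "\<not> S m \<subseteq> S i"
      then obtain x where x: "x \<in> S m" "x \<notin> S i"
        by blast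
      obtain B where B: "B \<subseteq> S i" "fs.independent B" "S i \<subseteq> fs.span B" "card B = fs.dim (S i)"
        using fs.basis_exists by blast
      obtain C where C: "C \<subseteq> S m" "fs.independent C" "S m \<subseteq> fs.span C" "card C = fs.dim (S m)"
        using fs.basis_exists by blast
      have "x \<notin> fs.span B"
        using x(2) fs.span_minimal[OF B(1) sub] by blast
      then have ind: "fs.independent (insert x B)" "x \<notin> B"
        using B(2) fs.independent_insertI fs.span_base by blast+
      have "insert x B \<subseteq> fs.span C"
        using x(1) B(1) im C(3) by blast
      then have "card (insert x B) \<le> card C"
        using fs.independent_span_bound[OF fin[OF C(1,2)] ind(1)] by blast
      then show False
        using ind(2) fin[OF B(1,2)] B(4) C(4) m[of i] by simp
    qed
  qed
  then show ?thesis
    by blast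
qed

lemma finite_box: "finite {m :: nat expo. keys m \<subseteq> {..n} \<and> (\<forall>i. lookup m i < d)}"
proof (rule finite_subset)
  show "finite (\<Union>e\<le>(n + 1) * d. expos {..n} e)"
    by (auto intro: finite_expos)
  show "{m. keys m \<subseteq> {..n} \<and> (\<forall>i. lookup m i < d)} \<subseteq> (\<Union>e\<le>(n + 1) * d. expos {..n} e)"
  proof
    fix m assume "m \<in> {m. keys m \<subseteq> {..n} \<and> (\<forall>i. lookup m i < d)}"
    then have m: "keys m \<subseteq> {..n}" "\<forall>i. lookup m i < d"
      by simp_all
    have "tdeg m = (\<Sum>i\<le>n. lookup m i)"
      using m(1) by (intro tdeg_superset) auto
    also have "\<dots> \<le> (\<Sum>i\<le>n. d)"
      using m(2) by (intro sum_mono) (simp add: less_imp_le)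
    finally have "tdeg m \<le> (n + 1) * d"
      by simp
    then show "m \<in> (\<Union>e\<le>(n + 1) * d. expos {..n} e)"
      using m(1) by (simp add: expos_def)
  qed
qed

text \<open>The powers of the variables in \<open>E\<close> put every monomial outside a finite box
  into the ideal. A chain of ideals of the quotient therefore becomes a chain of subspaces of the
  functions on the box.\<close>

lemma artinian_mono_ideal:
  assumes corners: "\<And>i. i \<le> n \<Longrightarrow> single i d \<in> E"
  shows "artinian_ring (PR n Quot (mono_ideal {..n} E :: (nat, 'k::field) mpol set))"
  unfolding artinian_ring_def
proof (intro conjI allI impI)
  let ?I = "mono_ideal {..n} E :: (nat, 'k) mpol set"
  let ?Q = "PR n Quot ?I"
  have I: "ideal ?I (PR n)"
    by (rule ideal_mono_ideal)
  show "ring ?Q"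
    by (rule ideal.quotient_is_ring[OF I])
  fix J :: "nat \<Rightarrow> (nat, 'k) mpol set set"
  assume J: "\<forall>i. ideal (J i) ?Q \<and> J (Suc i) \<subseteq> J i"
  define K where "K i = \<Union> (J i)" for i
  have K: "ideal (K i) (PR n)" for i
    unfolding K_def using J mpoly.quot_ideal_imp_ring_ideal[OF I] by blast
  have Jcarr: "J i \<subseteq> carrier ?Q" for i
    using J ideal.axioms(1) additive_subgroup.a_subset by blast
  have mem: "a \<in> K i \<longleftrightarrow> ?I +>\<^bsub>PR n\<^esub> a \<in> J i" if "a \<in> carrier (PR n)" for a i
    unfolding K_def by (rule mpoly.canonical_proj_vimage_mem_iff[OF I Jcarr that])
  have IK: "?I \<subseteq> K i" for i
  proof
    fix p assume p: "p \<in> ?I"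
    have "?I +>\<^bsub>PR n\<^esub> p = ?I +>\<^bsub>PR n\<^esub> 0"
      using p subsetD[OF mpoly_ideal_closed(1)[OF I] p] by (subst mpoly_coset_eq_iff[OF I]) simp_all
    moreover have "0 \<in> K i"
      by (rule mpoly_ideal_closed(2)[OF K])
    ultimately show "p \<in> K i"
      using subsetD[OF mpoly_ideal_closed(1)[OF I] p] mem[of p i] mem[of 0 i] by simp
  qed
  define B where "B = {m :: nat expo. keys m \<subseteq> {..n} \<and> (\<forall>i. lookup m i < d)}"
  have fin: "finite B"
    unfolding B_def by (rule finite_box)
  \<comment> \<open>Truncation to the box. Polynomials with the same truncation differ by an element
    of \<open>?I\<close>, which is contained in every \<open>K i\<close>, so \<open>K i\<close> is
    determined by its image.\<close>
  define r where "r p = (\<lambda>m. if m \<in> B then lookup p m else 0)" for p :: "(nat, 'k) mpol"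
  have in_I: "p \<in> ?I" if p: "p \<in> carrier (PR n)" "keys p \<inter> B = {}" for p
    unfolding mono_ideal_def
  proof (intro CollectI ballI conjI)
    fix m assume m: "m \<in> keys p"
    show km: "keys m \<subseteq> {..n}"
      using p m by simp
    have "m \<notin> B"
      using p(2) m by blast
    then obtain i where i: "lookup m i \<ge> d"
      using km by (auto simp: B_def not_less)
    \<comment> \<open>For \<open>d = 0\<close> the index \<open>i\<close> may exceed
      \<open>n\<close>, but all \<open>single i 0\<close> are the zero exponent.\<close>
    have "single i d \<in> E"
    proof (cases "d = 0")
      case True
      then show ?thesis
        using corners[of 0] by simp
    next
      case False
      then have "i \<in> keys m"
        using i by (simp add: in_keys_iff)
      then show ?thesis
        using corners km by auto
    qed
    moreover have "m = single i d + (m - single i d)"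
      using i by (intro poly_mapping_eqI) (auto simp: lookup_add lookup_minus lookup_single when_def)
    ultimately show "\<exists>e\<in>E. \<exists>t. m = e + t"
      by blast
  qed
  define S where "S i = r ` K i" for i
  have r_add: "r (p + q) = r p + r q" and r_scale: "r (single 0 c * p) = fun_scale c (r p)" for p q c
    using lookup_single_mult_add[of 0 c p] by (auto simp: r_def lookup_add fun_scale_def)
  have "\<exists>m. \<forall>i\<ge>m. S i = S m"
  proof (rule decreasing_subspaces_stabilize)
    show "finite ((\<lambda>e m. if m = e then 1 else 0 :: 'k) ` B)"
      using fin by simp
    fix i
    show "fs.subspace (S i)"
    proof (rule fs.subspaceI)
      have "r 0 = 0"
        by (auto simp: r_def)
      then show "0 \<in> S i"
        unfolding S_def using mpoly_ideal_closed(2)[OF K] by (metis imageI)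
      show "x + y \<in> S i" if "x \<in> S i" "y \<in> S i" for x y
        using that mpoly_ideal_closed(3)[OF K] unfolding S_def by (auto simp flip: r_add)
      have "single 0 c * p \<in> K i" if "p \<in> K i" for c p
        using mpoly_ideal_closed(4)[OF K that, of "single 0 c"] by simp
      then show "fun_scale c x \<in> S i" if "x \<in> S i" for c x
        using that unfolding S_def by (auto simp flip: r_scale)
    qed
    show "S i \<subseteq> fs.span ((\<lambda>e m. if m = e then 1 else 0) ` B)"
      unfolding S_def
    proof clarify
      fix p
      have eq: "r p = (\<Sum>e\<in>B. fun_scale (lookup p e) (\<lambda>m. if m = e then 1 else 0))"
        using fin by (auto simp: r_def sum_apply fun_scale_def if_distrib[of "(*) _"] cong: if_cong)
      show "r p \<in> fs.span ((\<lambda>e m. if m = e then 1 else 0) ` B)"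
        unfolding eq by (intro fs.span_sum fs.span_scale fs.span_base imageI)
    qed
    have "K (Suc i) \<subseteq> K i"
      using J unfolding K_def by blast
    then show "S (Suc i) \<subseteq> S i"
      unfolding S_def by blast
  qed
  then obtain m where m: "\<And>i. i \<ge> m \<Longrightarrow> S i = S m"
    by blast
  have K_le: "K i \<subseteq> K j" if eq: "S i = S j" for i j
  proof
    fix p assume p: "p \<in> K i"
    then have "r p \<in> S i"
      unfolding S_def by (rule imageI)
    then have "r p \<in> S j"
      by (simp only: eq)
    then obtain q where q: "q \<in> K j" "r p = r q"
      unfolding S_def image_iff by (elim bexE)
    have pq: "p \<in> carrier (PR n)" "q \<in> carrier (PR n)"
      using p q mpoly_ideal_closed(1)[OF K] by blast+
    have "lookup (p - q) m = 0" if "m \<in> B" for m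
      using fun_cong[OF q(2), of m] that by (simp add: r_def lookup_minus)
    then have "keys (p - q) \<inter> B = {}"
      by (auto simp: in_keys_iff)
    moreover have "p - q \<in> carrier (PR n)"
      using pq mpoly_ring_diff[OF pq(2), of p] mpoly.minus_closed[OF pq] by simp
    ultimately have "p - q \<in> K j"
      using in_I IK by blast
    then have "(p - q) + q \<in> K j"
      using q(1) mpoly_ideal_closed(3)[OF K] by blast
    then show "p \<in> K j"
      by simp
  qed
  have J_le: "J i \<subseteq> J j" if "K i \<subseteq> K j" for i j
  proof
    fix c assume c: "c \<in> J i"
    then obtain a where a: "a \<in> carrier (PR n)" "c = ?I +>\<^bsub>PR n\<^esub> a"
      using Jcarr[of i] unfolding FactRing_def using A_RCOSETS_def'[of "PR n" ?I] by auto
    then show "c \<in> J j"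
      using mem[OF a(1)] c that by blast
  qed
  show "\<exists>m. \<forall>i\<ge>m. J i = J m"
    using m K_le J_le by (metis subset_antisym)
qed

text \<open>For \<open>x\<^sub>i\<^sup>d\<close> not in \<open>E\<close> the powers of \<open>x\<^sub>i\<close> generate a strictly descending chain modulo the ideal.\<close>

lemma artinian_mono_ideal_corners:
  assumes E: "E \<subseteq> expos {..n} d" and i: "i \<le> n"
    and art: "artinian_ring (PR n Quot (mono_ideal {..n} E :: (nat, 'k::field) mpol set))"
  shows "single i d \<in> E"
proof (rule ccontr)
  assume notin: "single i d \<notin> E"
  let ?I = "mono_ideal {..n} E :: (nat, 'k) mpol set"
  have I: "ideal ?I (PR n)"
    by (rule ideal_mono_ideal)
  \<comment> \<open>The ideal generated by the power \<open>N\<close> of the variable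
    \<open>i\<close> and by the other variables. It contains \<open>?I\<close> because
    \<open>E\<close> has no pure power of that variable.\<close>
  define K where "K N = {p :: (nat, 'k) mpol. (\<forall>m\<in>keys p. keys m \<subseteq> {..n}) \<and> (\<forall>j. single i j \<in> keys p \<longrightarrow> j \<ge> N)}" for N
  have K: "ideal (K N) (PR n)" for N
  proof (rule mpoly_idealI)
    show "p + q \<in> K N" if "p \<in> K N" "q \<in> K N" for p q
      using that Poly_Mapping.keys_add[of p q] unfolding K_def by blast
    show "q * p \<in> K N" if p: "p \<in> K N" and q: "q \<in> carrier (PR n)" for p q
      unfolding K_def
    proof (intro CollectI conjI ballI allI impI)
      show "keys m \<subseteq> {..n}" if "m \<in> keys (q * p)" for m
        using that Poly_Mapping.keys_mult[of q p] p q by (fastforce simp: K_def keys_add_nat)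
      fix j assume "single i j \<in> keys (q * p)"
      then obtain a b where ab: "single i j = a + b" "a \<in> keys q" "b \<in> keys p"
        using Poly_Mapping.keys_mult[of q p] by blast
      have "lookup b l = 0" if "l \<noteq> i" for l
        using that arg_cong[OF ab(1), of "\<lambda>m. lookup m l"] by (simp add: lookup_add lookup_single)
      then have "b = single i (lookup b i)"
        by (intro poly_mapping_eqI) (auto simp: lookup_single when_def)
      then have "lookup b i \<ge> N"
        using p ab(3) unfolding K_def by auto
      moreover have "j = lookup a i + lookup b i"
        using arg_cong[OF ab(1), of "\<lambda>m. lookup m i"] by (simp add: lookup_add)
      ultimately show "N \<le> j"
        by simp
    qed
  qed (auto simp: K_def)
  have IK: "?I \<subseteq> K N" for N
  proof
    fix p assume p: "p \<in> ?I"
    have "single i j \<notin> keys p" for j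
    proof
      assume "single i j \<in> keys p"
      then obtain e t where et: "e \<in> E" "single i j = e + t"
        using p unfolding mono_ideal_def by blast
      have "lookup e l = 0" if "l \<noteq> i" for l
        using that arg_cong[OF et(2), of "\<lambda>m. lookup m l"] by (simp add: lookup_add lookup_single)
      then have e: "e = single i (lookup e i)"
        by (intro poly_mapping_eqI) (auto simp: lookup_single when_def)
      have "tdeg e = d"
        using E et(1) by (auto simp: expos_def)
      then have "lookup e i = d"
        using arg_cong[OF e, of tdeg] by simp
      then show False
        using e et(1) notin by simp
    qed
    then show "p \<in> K N"
      using p by (auto simp: K_def mono_ideal_def)
  qed
  define J where "J N = (\<lambda>p. ?I +>\<^bsub>PR n\<^esub> p) ` K N" for N
  have "\<forall>N. ideal (J N) (PR n Quot ?I) \<and> J (Suc N) \<subseteq> J N"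
  proof (intro allI conjI)
    show "ideal (J N) (PR n Quot ?I)" for N
      unfolding J_def by (rule mpoly.ring_ideal_imp_quot_ideal[OF I K])
    show "J (Suc N) \<subseteq> J N" for N
      unfolding J_def by (intro image_mono) (auto simp: K_def)
  qed
  then obtain N where N: "J (Suc N) = J N"
    using art unfolding artinian_ring_def by (metis le_Suc_eq order_refl)
  let ?p = "single (single i N) (1::'k)"
  have "?p \<in> K N"
    using i by (auto simp: K_def) (metis lookup_single_eq order_refl)
  then have "?I +>\<^bsub>PR n\<^esub> ?p \<in> J N"
    unfolding J_def by (rule imageI)
  then have "?I +>\<^bsub>PR n\<^esub> ?p \<in> J (Suc N)"
    by (simp only: N)
  then obtain q where q: "q \<in> K (Suc N)" "?I +>\<^bsub>PR n\<^esub> ?p = ?I +>\<^bsub>PR n\<^esub> q"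
    unfolding J_def image_iff by (elim bexE)
  have "?p \<in> carrier (PR n)" "q \<in> carrier (PR n)"
    using q(1) \<open>?p \<in> K N\<close> unfolding K_def by auto
  then have "?p - q \<in> ?I"
    using q(2) mpoly_coset_eq_iff[OF I] by blast
  then have "?p - q + q \<in> K (Suc N)"
    using IK mpoly_ideal_closed(3)[OF K] q(1) by blast
  then show False
    by (auto simp: K_def dest!: spec[of _ N])
qed

section \<open>Failure of the weak Lefschetz property\<close>

interpretation xyz: three_variables 0 1 2
  by unfold_locales auto

lemma expo3_eq_iff [simp]:
  "expo3 0 a 1 b 2 c = expo3 0 a' 1 b' 2 c' \<longleftrightarrow> a = a' \<and> b = b' \<and> c = c'"
  using xyz.lookup_expo3 by metis

lemma expos_three_cases:
  assumes "m \<in> expos {..2} d"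
  obtains a b c where "m = expo3 0 a 1 b 2 c" "a + b + c = d"
proof
  have m: "keys m \<subseteq> {..2}" "tdeg m = d"
    using assms by (auto simp: expos_def)
  show deg: "lookup m 0 + lookup m 1 + lookup m 2 = d"
    using xyz.tdeg_three'[OF m(1)] m(2) by simp
  show "m = expo3 0 (lookup m 0) 1 (lookup m 1) 2 (lookup m 2)"
    by (rule expos_three_eqI[OF assms xyz.expo3_in_expos[OF deg]]) (simp_all only: xyz.lookup_expo3)
qed

lemma mono_val_expo3: "mono_val (expo3 0 a 1 b 2 c) x = x 0 ^ a * x 1 ^ b * x 2 ^ c"
  by (simp add: expo3_def mono_val_add)

lemmas expo3_simps [simp] =
  xyz.lookup_expo3[unfolded One_nat_def] expo3_eq_iff[unfolded One_nat_def] mono_val_expo3[unfolded One_nat_def]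

text \<open>A nonzero polynomial in three variables takes a nonzero value at a point \<open>(t, t ^ N, t ^ (N * N))\<close>,
  because for large \<open>N\<close> distinct monomials become distinct powers of \<open>t\<close>.\<close>

lemma exists_nonzero_value:
  fixes G :: "(nat, 'k::field_char_0) mpol"
  assumes G: "G \<in> carrier (PR 2)" "G \<noteq> 0"
  obtains a where "eval_mpol G a \<noteq> 0" "a 0 \<noteq> 0" "a 1 \<noteq> 0" "a 2 \<noteq> 0"
proof -
  define N where "N = Suc (\<Sum>m\<in>keys G. tdeg m)"
  \<comment> \<open>A number in base \<open>N\<close> whose digits are the exponents;
    \<open>N\<close> exceeds every exponent occurring in \<open>G\<close>.\<close>
  define wt where "wt m = lookup m 0 + N * (lookup m 1 + N * lookup m 2)" for m :: "nat expo"
  have km: "keys m \<subseteq> {..2}" if "m \<in> keys G" for m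
    using G(1) that by simp
  have N: "lookup m i < N" if "m \<in> keys G" for m i
  proof -
    have "lookup m i \<le> tdeg m"
      by (cases "i \<in> keys m") (auto simp: tdeg_def in_keys_iff intro: member_le_sum)
    also have "\<dots> \<le> (\<Sum>m\<in>keys G. tdeg m)"
      using that by (intro member_le_sum) auto
    finally show ?thesis
      by (simp add: N_def)
  qed
  have inj: "m = m'" if "m \<in> keys G" "m' \<in> keys G" "wt m = wt m'" for m m'
  proof -
    have digits: "a = a' \<and> b = b'" if "a < N" "a' < N" "a + N * b = a' + N * b'" for a a' b b'
    proof -
      have "(a + N * b) mod N = a" "(a' + N * b') mod N = a'"
        "(a + N * b) div N = b" "(a' + N * b') div N = b'"
        using that(1,2) by simp_all
      then show ?thesis
        using that(3) by metis
    qed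
    have eq: "lookup m 0 = lookup m' 0" "lookup m 1 = lookup m' 1" "lookup m 2 = lookup m' 2"
      using digits[OF N[OF that(1)] N[OF that(2)] that(3)[unfolded wt_def]]
        digits[OF N[OF that(1)] N[OF that(2)]] by blast+
    then have "m \<in> expos {..2} (tdeg m)" "m' \<in> expos {..2} (tdeg m)"
      using km[OF that(1)] km[OF that(2)] by (simp_all add: expos_def tdeg_three)
    then show ?thesis
      using eq expos_three_eqI by blast
  qed
  define P where "P = (\<Sum>m\<in>keys G. monom (lookup G m) (wt m))"
  obtain m0 where m0: "m0 \<in> keys G"
    using G(2) by (metis all_not_in_conv keys_eq_empty)
  have "coeff P (wt m0) = (\<Sum>m\<in>keys G. if m = m0 then lookup G m else 0)"
    unfolding P_def coeff_sum coeff_monom using inj[OF _ m0] by (intro sum.cong refl) auto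
  also have "\<dots> = lookup G m0"
    using m0 by simp
  finally have "coeff P (wt m0) \<noteq> 0"
    using m0 by (simp add: in_keys_iff)
  \<comment> \<open>The extra factor forces \<open>t\<close> to be nonzero, and with it all three
    coordinates.\<close>
  then have "P * [:0, 1:] \<noteq> 0"
    by auto
  then obtain t where "poly (P * [:0, 1:]) t \<noteq> 0"
    by (rule obtain_nonroot)
  then have t: "poly P t \<noteq> 0" "t \<noteq> 0"
    by auto
  define a where "a i = (if i = 0 then t else if i = 1 then t ^ N else t ^ (N * N))" for i :: nat
  have "mono_val m a = t ^ wt m" if "m \<in> keys G" for m
    unfolding xyz.mono_val_three[OF km[OF that]]
    by (simp add: a_def wt_def distrib_left power_add mult.assoc flip: power_mult)
  then have "eval_mpol G a = poly P t"
    by (simp add: eval_mpol_def P_def poly_sum poly_monom)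
  then show ?thesis
    using that[of a] t by (simp add: a_def)
qed

lemma eval_lin_form: "eval_mpol (lin_form 2 a) x = a 0 * x 0 + a 1 * x 1 + a 2 * x 2"
  by (simp add: lin_form_def eval_mpol_sum numeral_2_eq_2)

lemma lin_form_in_forms: "lin_form n a \<in> forms {..n} 1"
  unfolding lin_form_def by (intro forms_sum forms_single) (simp add: expos_def)

lemma mult_lin_form_in_forms:
  assumes "F \<in> forms {..n} (d - 1)" "d \<ge> 1"
  shows "lin_form n a * F \<in> forms {..n} d"
  using forms_mult[OF lin_form_in_forms assms(1), of a] assms(2) by simp

text \<open>Linear dependence of the monomials in \<open>E\<close> on the line \<open>x + y + z = 0\<close>, which is parametrized by
  \<open>(1, t, - (1 + t))\<close>; the signs are absorbed in \<open>c\<close>. By the torus action all the lines that avoid the coordinate points behave in the same way.\<close>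

definition line_dependent :: "'k::field itself \<Rightarrow> nat expo set \<Rightarrow> bool" where
  "line_dependent _ E \<longleftrightarrow> (\<exists>c :: nat expo \<Rightarrow> 'k. (\<exists>m\<in>E. c m \<noteq> 0) \<and>
     (\<forall>t. (\<Sum>m\<in>E. c m * (t ^ lookup m 1 * (1 + t) ^ lookup m 2)) = 0))"

text \<open>Failure of injectivity gives a form \<open>F\<close> outside the ideal with
  \<open>L * F\<close> inside it. The product is a nonzero combination of the monomials in
  \<open>E\<close> that vanishes on the line \<open>L = 0\<close>.\<close>

lemma fails_WLP_imp_line_dependent:
  assumes E: "E \<subseteq> expos {..2} d" and "d \<ge> 1"
    and fails: "fails_WLP 2 (mono_ideal {..2} E :: (nat, 'k::field_char_0) mpol set) (d - 1)"
  shows "line_dependent TYPE('k) E"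
proof -
  let ?I = "mono_ideal {..2} E :: (nat, 'k) mpol set"
  have I: "ideal ?I (PR 2)"
    by (rule ideal_mono_ideal)
  obtain G :: "(nat, 'k) mpol" where G: "G \<in> carrier (PR 2)" "G \<noteq> 0"
      "\<And>a. eval_mpol G a \<noteq> 0 \<Longrightarrow> \<not> inj_on (mult_map 2 ?I (lin_form 2 a)) (quot_piece 2 ?I (d - 1))"
    using fails unfolding fails_WLP_def general_lin_form_def by blast
  obtain a where a: "eval_mpol G a \<noteq> 0" "a 0 \<noteq> 0" "a 1 \<noteq> 0" "a 2 \<noteq> 0"
    by (rule exists_nonzero_value[OF G(1,2)])
  let ?L = "lin_form 2 a"
  have carr: "F \<in> carrier (PR 2)" if "F \<in> forms {..2} e" for F :: "(nat, 'k) mpol" and e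
    using that forms_subset_carrier by blast
  obtain F1 F2 where F12: "F1 \<in> forms {..2} (d - 1)" "F2 \<in> forms {..2} (d - 1)"
      "?I +>\<^bsub>PR 2\<^esub> F1 \<noteq> ?I +>\<^bsub>PR 2\<^esub> F2"
      "mult_map 2 ?I ?L (?I +>\<^bsub>PR 2\<^esub> F1) = mult_map 2 ?I ?L (?I +>\<^bsub>PR 2\<^esub> F2)"
    using G(3)[OF a(1)] unfolding inj_on_def quot_piece_def by blast
  have L: "?L \<in> carrier (PR 2)"
    by (rule carr[OF lin_form_in_forms])
  define F where "F = F1 - F2"
  have F: "F \<in> forms {..2} (d - 1)"
    unfolding F_def using F12 by (intro forms_diff)
  have "F \<notin> ?I"
    using F12(3) mpoly_coset_eq_iff[OF I carr[OF F12(1)] carr[OF F12(2)]] by (simp add: F_def)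
  then have "F \<noteq> 0"
    using mpoly_ideal_closed(2)[OF I] by auto
  have LF: "?L * F1 \<in> forms {..2} d" "?L * F2 \<in> forms {..2} d" "?L * F \<in> forms {..2} d"
    using mult_lin_form_in_forms F12 F \<open>d \<ge> 1\<close> by blast+
  have "?L * F1 - ?L * F2 \<in> ?I"
    using F12(4) mpoly_coset_eq_iff[OF I carr[OF LF(1)] carr[OF LF(2)]]
      mult_map_coset[OF I L carr[OF F12(1)]] mult_map_coset[OF I L carr[OF F12(2)]] by simp
  then have "?L * F \<in> ?I"
    by (simp add: F_def right_diff_distrib)
  then have keys: "keys (?L * F) \<subseteq> E"
    using forms_in_mono_ideal[OF E LF(3)] by simp
  have "?L \<noteq> 0"
  proof
    assume "?L = 0"
    then have "eval_mpol ?L (\<lambda>i. if i = 0 then 1 else 0) = 0"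
      by simp
    then show False
      using a by (simp add: eval_lin_form)
  qed
  then have "?L * F \<noteq> 0"
    using \<open>F \<noteq> 0\<close> by simp
  then obtain m0 where m0: "m0 \<in> keys (?L * F)"
    by (metis all_not_in_conv keys_eq_empty)
  have fin: "finite E"
    using E finite_expos[of "{..2::nat}" d] finite_subset by auto
  \<comment> \<open>These scalars rescale the line to the standard one: it contains the points
    \<open>(A, t * B, (1 + t) * C)\<close>, and the minus sign in \<open>C\<close> makes the three
    terms cancel.\<close>
  obtain A B C where ABC: "a 0 * A = 1" "a 1 * B = 1" "a 2 * C = - 1"
    using a by (metis divide_self_if mult.commute times_divide_eq_left mult_1_left nonzero_mult_div_cancel_left)
  define c where "c m = lookup (?L * F) m * (A ^ lookup m 0 * B ^ lookup m 1 * C ^ lookup m 2)" for m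
  have "A \<noteq> 0" "B \<noteq> 0" "C \<noteq> 0"
    using ABC by auto
  then have "c m0 \<noteq> 0"
    using m0 by (simp add: c_def in_keys_iff)
  moreover have "(\<Sum>m\<in>E. c m * (t ^ lookup m 1 * (1 + t) ^ lookup m 2)) = 0" for t
  proof -
    define x where "x i = (if i = 0 then A else if i = 1 then t * B else (1 + t) * C)" for i :: nat
    have "eval_mpol ?L x = a 0 * A + t * (a 1 * B) + (1 + t) * (a 2 * C)"
      by (simp add: eval_lin_form x_def mult_ac)
    then have "eval_mpol ?L x = 0"
      unfolding ABC by simp
    then have "eval_mpol (?L * F) x = 0"
      by simp
    have "lookup (?L * F) m * mono_val m x = c m * (t ^ lookup m 1 * (1 + t) ^ lookup m 2)"
      if "m \<in> E" for m
    proof -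
      have "keys m \<subseteq> {..2}"
        using E that by (auto simp: expos_def)
      then show ?thesis
        by (simp add: xyz.mono_val_three c_def x_def power_mult_distrib mult_ac)
    qed
    then have "(\<Sum>m\<in>E. c m * (t ^ lookup m 1 * (1 + t) ^ lookup m 2)) =
        (\<Sum>m\<in>E. lookup (?L * F) m * mono_val m x)"
      by (intro sum.cong refl) simp
    also have "\<dots> = eval_mpol (?L * F) x"
      by (rule eval_mpol_superset[OF fin keys, symmetric])
    finally show ?thesis
      using \<open>eval_mpol (?L * F) x = 0\<close> by (simp only:)
  qed
  ultimately show ?thesis
    using m0 keys unfolding line_dependent_def by blast
qed

text \<open>The restriction to the line \<open>L = 0\<close> maps the forms of degree \<open>d\<close> onto a space of dimension \<open>d + 1\<close>,
  which cannot be spanned by \<open>d + 1\<close> dependent elements; so a syzygy also destroys surjectivity.\<close>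

lemma fails_WLPI:
  assumes E: "E \<subseteq> expos {..2} d" and "d \<ge> 1" and card: "card E \<le> d + 1"
    and syz: "\<And>a :: nat \<Rightarrow> 'k. a 0 \<noteq> 0 \<Longrightarrow> a 1 \<noteq> 0 \<Longrightarrow> a 2 \<noteq> 0 \<Longrightarrow>
      \<exists>F\<in>forms {..2} (d - 1). F \<noteq> 0 \<and> lin_form 2 a * F \<in> mono_ideal {..2} E"
  shows "fails_WLP 2 (mono_ideal {..2} E :: (nat, 'k::field_char_0) mpol set) (d - 1)"
  unfolding fails_WLP_def general_lin_form_def
proof (intro bexI conjI allI impI)
  let ?I = "mono_ideal {..2} E :: (nat, 'k) mpol set"
  \<comment> \<open>Off the hypersurface xyz = 0 in the space of coefficients, all three
    coefficients of the linear form are nonzero.\<close>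
  let ?G = "single (expo3 0 1 1 1 2 1) (1::'k)"
  have I: "ideal ?I (PR 2)"
    by (rule ideal_mono_ideal)
  show "?G \<noteq> 0"
    by (metis keys_eq_empty keys_single insert_not_empty zero_neq_one)
  show "?G \<in> carrier (PR 2)"
    using xyz.keys_expo3[of 1 1 1] by simp
  fix a :: "nat \<Rightarrow> 'k" assume "eval_mpol ?G a \<noteq> 0"
  moreover have "eval_mpol ?G a = a 0 * a 1 * a 2"
    by (simp only: eval_mpol_single mono_val_expo3 power_one_right mult_1)
  ultimately have a: "a 0 \<noteq> 0" "a 1 \<noteq> 0" "a 2 \<noteq> 0"
    by auto
  let ?L = "lin_form 2 a"
  obtain F where F: "F \<in> forms {..2} (d - 1)" "F \<noteq> 0" "?L * F \<in> ?I"
    using syz[OF a] by blast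
  have carr: "F \<in> carrier (PR 2)" if "F \<in> forms {..2} e" for F :: "(nat, 'k) mpol" and e
    using that forms_subset_carrier by blast
  have L: "?L \<in> carrier (PR 2)"
    by (rule carr[OF lin_form_in_forms])
  note mult = mult_map_coset[OF I L carr]
  have zero: "(0 :: (nat, 'k) mpol) \<in> forms {..2} (d - 1)"
    by simp
  show "\<not> inj_on (mult_map 2 ?I ?L) (quot_piece 2 ?I (d - 1))"
  proof
    assume inj: "inj_on (mult_map 2 ?I ?L) (quot_piece 2 ?I (d - 1))"
    have "F - 0 \<notin> ?I"
      using low_forms_in_mono_ideal[OF E F(1)] F(2) \<open>d \<ge> 1\<close> by auto
    then have "?I +>\<^bsub>PR 2\<^esub> F \<noteq> ?I +>\<^bsub>PR 2\<^esub> 0"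
      using mpoly_coset_eq_iff[OF I carr[OF F(1)] carr[OF zero]] by simp
    moreover have "mult_map 2 ?I ?L (?I +>\<^bsub>PR 2\<^esub> F) = mult_map 2 ?I ?L (?I +>\<^bsub>PR 2\<^esub> 0)"
      using mpoly_coset_eq_iff[OF I carr[OF mult_lin_form_in_forms[OF F(1) \<open>d \<ge> 1\<close>]] carr[OF zero]] F(3)
      unfolding mult[OF F(1)] mult[OF zero] by simp
    ultimately show False
      using inj F(1) zero unfolding quot_piece_def inj_on_def by blast
  qed
  show "mult_map 2 ?I ?L ` quot_piece 2 ?I (d - 1) \<noteq> quot_piece 2 ?I (Suc (d - 1))"
  proof
    assume surj: "mult_map 2 ?I ?L ` quot_piece 2 ?I (d - 1) = quot_piece 2 ?I (Suc (d - 1))"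
    define x where "x t i = (if i = 0 then 1 else if i = 1 then t else - (a 0 + a 1 * t) / a 2)" for t and i :: nat
    have Lx: "eval_mpol ?L (x t) = 0" for t
      using a by (simp add: eval_lin_form x_def)
    have fin: "finite E"
      using E finite_expos[of "{..2::nat}" d] finite_subset by auto
    define g where "g e = (\<lambda>t. mono_val e (x t))" for e
    have LF: "?L * F \<in> forms {..2} d"
      by (rule mult_lin_form_in_forms[OF F(1) \<open>d \<ge> 1\<close>])
    have keysLF: "keys (?L * F) \<subseteq> E"
      using forms_in_mono_ideal[OF E LF] F(3) by simp
    have "?L \<noteq> 0"
    proof
      assume "?L = 0"
      then have "eval_mpol ?L (\<lambda>i. if i = 0 then 1 else 0) = 0"
        by simp
      then show False
        using a by (simp add: eval_lin_form)
    qed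
    then have "?L * F \<noteq> 0"
      using F(2) by simp
    then obtain e0 where e0: "e0 \<in> keys (?L * F)"
      by (metis all_not_in_conv keys_eq_empty)
    define c0 where "c0 = lookup (?L * F) e0"
    have c0: "c0 \<noteq> 0" "e0 \<in> E"
      using e0 keysLF by (auto simp: c0_def in_keys_iff)
    \<comment> \<open>Since \<open>L * F\<close> vanishes on the line, \<open>e0\<close> is
      redundant there: at most \<open>d\<close> functions span the restrictions of all monomials in
      \<open>E\<close>.\<close>
    let ?B = "g ` (E - {e0})"
    have in_B: "g e \<in> fs.span ?B" if "e \<in> E - {e0}" for e
      using that by (intro fs.span_base) auto
    have "g e0 = (\<Sum>e\<in>E - {e0}. fun_scale (- lookup (?L * F) e / c0) (g e))"
    proof
      fix t
      have "0 = (\<Sum>e\<in>E. lookup (?L * F) e * g e t)"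
        using eval_mpol_superset[OF fin keysLF, of "x t"] Lx[of t] by (simp add: g_def)
      also have "\<dots> = c0 * g e0 t + (\<Sum>e\<in>E - {e0}. lookup (?L * F) e * g e t)"
        using fin c0 by (simp add: sum.remove[of _ e0] c0_def)
      finally have "g e0 t = - (\<Sum>e\<in>E - {e0}. lookup (?L * F) e * g e t) / c0"
        using c0 by (simp add: field_simps eq_neg_iff_add_eq_0)
      also have "\<dots> = (\<Sum>e\<in>E - {e0}. fun_scale (- lookup (?L * F) e / c0) (g e)) t"
        by (simp add: sum_apply fun_scale_def sum_divide_distrib sum_negf)
      finally show "g e0 t = \<dots>" .
    qed
    also have "\<dots> \<in> fs.span ?B"
      using in_B by (intro fs.span_sum fs.span_scale)
    finally have "g e0 \<in> fs.span ?B" .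
    with in_B have in_span: "g e \<in> fs.span ?B" if "e \<in> E" for e
      using that by (cases "e = e0") auto
    have powers: "(\<lambda>t. t ^ i) \<in> fs.span ?B" if i: "i \<le> d" for i
    proof -
      \<comment> \<open>Its restriction to the line is \<open>t ^ i\<close>. Surjectivity writes
        \<open>?p\<close> as a multiple of \<open>L\<close>, which is zero on the line, plus a form
        supported on \<open>E\<close>.\<close>
      let ?p = "single (expo3 0 (d - i) 1 i 2 0) (1::'k)"
      have p: "?p \<in> forms {..2} d"
        using i by (intro forms_single xyz.expo3_in_expos) simp
      then have "?I +>\<^bsub>PR 2\<^esub> ?p \<in> quot_piece 2 ?I (Suc (d - 1))"
        unfolding quot_piece_def using \<open>d \<ge> 1\<close> by simp
      then have "?I +>\<^bsub>PR 2\<^esub> ?p \<in> mult_map 2 ?I ?L ` quot_piece 2 ?I (d - 1)"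
        by (simp only: surj)
      then obtain F' where F': "F' \<in> forms {..2} (d - 1)" "?I +>\<^bsub>PR 2\<^esub> ?p = ?I +>\<^bsub>PR 2\<^esub> (?L * F')"
        unfolding quot_piece_def using mult by auto
      let ?q = "?p - ?L * F'"
      have LF': "?L * F' \<in> forms {..2} d"
        by (rule mult_lin_form_in_forms[OF F'(1) \<open>d \<ge> 1\<close>])
      have q: "?q \<in> forms {..2} d" "?q \<in> ?I"
        using forms_diff[OF p LF'] F'(2) mpoly_coset_eq_iff[OF I carr[OF p] carr[OF LF']] by auto
      then have keysq: "keys ?q \<subseteq> E"
        using forms_in_mono_ideal[OF E q(1)] by simp
      have "t ^ i = (\<Sum>e\<in>E. fun_scale (lookup ?q e) (g e)) t" for t
      proof -
        have "t ^ i = eval_mpol ?q (x t)"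
          by (simp add: Lx mono_val_expo3) (simp add: x_def)
        also have "\<dots> = (\<Sum>e\<in>E. lookup ?q e * g e t)"
          using eval_mpol_superset[OF fin keysq] by (simp add: g_def)
        finally show ?thesis
          by (simp add: sum_apply fun_scale_def)
      qed
      then have "(\<lambda>t. t ^ i) = (\<Sum>e\<in>E. fun_scale (lookup ?q e) (g e))"
        by (rule ext)
      also have "\<dots> \<in> fs.span ?B"
        using in_span by (intro fs.span_sum fs.span_scale)
      finally show ?thesis .
    qed
    have "\<exists>c. (\<exists>i\<in>{..d}. c i \<noteq> 0) \<and> (\<forall>t. (\<Sum>i\<in>{..d}. c i * (\<lambda>t. t ^ i) t) = (0::'k))"
    proof (rule exists_relation[of _ ?B])
      have "card ?B \<le> card (E - {e0})"
        using fin by (intro card_image_le) simp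
      also have "\<dots> < card E"
        using c0(2) fin by (intro psubset_card_mono) auto
      finally show "card ?B < card {..d}"
        using card by simp
    qed (use fin powers in auto)
    then obtain c :: "nat \<Rightarrow> 'k" where c: "\<exists>i\<le>d. c i \<noteq> 0" "\<And>t. (\<Sum>i\<le>d. c i * t ^ i) = 0"
      by auto
    have "(\<Sum>i\<le>d. monom (c i) i) = 0"
      by (rule poly_eq_0_if_cofinite[of "{}"]) (simp_all add: poly_sum poly_monom c(2))
    then have "coeff (\<Sum>i\<le>d. monom (c i) i) j = 0" for j
      by simp
    moreover have "coeff (\<Sum>i\<le>d. monom (c i) i) j = (if j \<le> d then c j else 0)" for j
      by (simp add: coeff_sum)
    ultimately show False
      using c(1) by metis
  qed
qed

section \<open>Togliatti systems in terms of exponent sets\<close>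

lemma togliattiI:
  assumes E: "E \<subseteq> expos {..2} d" and "d \<ge> 1" and card: "card E \<le> d + 1"
    and corners: "\<And>i. i \<le> 2 \<Longrightarrow> single i d \<in> E"
    and syz: "\<And>a :: nat \<Rightarrow> 'k. a 0 \<noteq> 0 \<Longrightarrow> a 1 \<noteq> 0 \<Longrightarrow> a 2 \<noteq> 0 \<Longrightarrow>
      \<exists>F\<in>forms {..2} (d - 1). F \<noteq> 0 \<and> lin_form 2 a * F \<in> mono_ideal {..2} E"
  shows "togliatti 2 d (mono_ideal {..2} E :: (nat, 'k::field_char_0) mpol set)"
  unfolding togliatti_def
proof (intro conjI exI[of _ "(\<lambda>m. single m 1) ` E"])
  have fin: "finite E"
    using E finite_expos[of "{..2::nat}" d] finite_subset by auto
  show "(\<lambda>m. single m 1) ` E \<subseteq> (forms {..2} d :: (nat, 'k) mpol set)"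
    using E by (auto intro!: forms_single)
  show "finite ((\<lambda>m. single m (1::'k)) ` E)"
    using fin by simp
  have "card ((\<lambda>m. single m (1::'k)) ` E) \<le> card E"
    by (rule card_image_le[OF fin])
  then show "card ((\<lambda>m. single m (1::'k)) ` E) \<le> (2 + d - 1) choose (2 - 1)"
    using card by simp
  show "mono_ideal {..2} E = Idl\<^bsub>PR 2\<^esub> ((\<lambda>m. single m (1::'k)) ` E)"
    using E by (intro genideal_monomials[symmetric]) (auto simp: expos_def)
  show "artinian_ring (PR 2 Quot (mono_ideal {..2} E :: (nat, 'k) mpol set))"
    by (rule artinian_mono_ideal[OF corners])
  show "fails_WLP 2 (mono_ideal {..2} E :: (nat, 'k) mpol set) (d - 1)"
    by (rule fails_WLPI[OF E \<open>d \<ge> 1\<close> card syz])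
qed

lemma togliattiD:
  assumes E: "E \<subseteq> expos {..2} d" and "d \<ge> 1"
    and "togliatti 2 d (mono_ideal {..2} E :: (nat, 'k::field_char_0) mpol set)"
  shows "i \<le> 2 \<Longrightarrow> single i d \<in> E" "line_dependent TYPE('k) E"
  using assms(3) artinian_mono_ideal_corners[OF E, of i, where 'k='k] 
    fails_WLP_imp_line_dependent[OF E \<open>d \<ge> 1\<close>, where 'k='k]
  unfolding togliatti_def by blast+

lemma monomials_image:
  assumes "S \<subseteq> (monomials n d :: (nat, 'k::field) mpol set)"
  obtains E where "E \<subseteq> expos {..n} d" "S = (\<lambda>m. single m 1) ` E"
  using assms unfolding monomials_def by (rule subset_imageE)

lemma Idl_single_image:
  assumes "E \<subseteq> expos {..n} d"
  shows "Idl\<^bsub>PR n\<^esub> ((\<lambda>m. single m 1) ` E) = (mono_ideal {..n} E :: (nat, 'k::field) mpol set)"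
  using assms by (intro genideal_monomials) (auto simp: expos_def)

text \<open>A subset without all corners does not give an artinian quotient, and for the others
  dependence on the line is necessary. Minimality thus becomes a statement of linear algebra about
  subsets containing the corners.\<close>

lemma TogI:
  assumes E: "E \<subseteq> expos {..2} d" and "d \<ge> 1"
    and tog: "togliatti 2 d (mono_ideal {..2} E :: (nat, 'k::field_char_0) mpol set)"
    and min: "\<And>E'. E' \<subset> E \<Longrightarrow> (\<And>i. i \<le> 2 \<Longrightarrow> single i d \<in> E') \<Longrightarrow> \<not> line_dependent TYPE('k) E'"
  shows "(mono_ideal {..2} E :: (nat, 'k) mpol set) \<in> Tog 2 d"
  unfolding Tog_def
proof (intro CollectI conjI tog exI[of _ "(\<lambda>m. single m 1) ` E"] allI impI notI)
  show "(\<lambda>m. single m 1) ` E \<subseteq> (monomials 2 d :: (nat, 'k) mpol set)"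
    using E by (auto simp: monomials_def)
  show "mono_ideal {..2} E = Idl\<^bsub>PR 2\<^esub> ((\<lambda>m. single m (1::'k)) ` E)"
    by (rule Idl_single_image[OF E, symmetric])
  fix S' assume S': "S' \<subset> (\<lambda>m. single m (1::'k)) ` E" "togliatti 2 d (Idl\<^bsub>PR 2\<^esub> S')"
  have "S' \<subseteq> (\<lambda>m. single m (1::'k)) ` E"
    using S'(1) by blast
  then obtain E' where E': "E' \<subseteq> E" "S' = (\<lambda>m. single m 1) ` E'"
    by (rule subset_imageE)
  have "E' \<noteq> E"
    using S'(1) E'(2) by blast
  have E'': "E' \<subseteq> expos {..2} d"
    using E E'(1) by blast
  have "togliatti 2 d (mono_ideal {..2} E' :: (nat, 'k) mpol set)"
    using S'(2) unfolding E'(2) Idl_single_image[OF E''] .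
  then show False
    using min[of E'] togliattiD[OF E'' \<open>d \<ge> 1\<close>] E'(1) \<open>E' \<noteq> E\<close> by blast
qed

lemma TogE:
  assumes "(I :: (nat, 'k::field_char_0) mpol set) \<in> Tog 2 d" "d \<ge> 1"
  obtains E where "E \<subseteq> expos {..2} d" "I = mono_ideal {..2} E" "\<And>i. i \<le> 2 \<Longrightarrow> single i d \<in> E"
    "line_dependent TYPE('k) E"
proof -
  obtain S where S: "S \<subseteq> monomials 2 d" "I = Idl\<^bsub>PR 2\<^esub> S" and tog: "togliatti 2 d I"
    using assms(1) unfolding Tog_def by blast
  obtain E where E: "E \<subseteq> expos {..2} d" "S = (\<lambda>m. single m 1) ` E"
    using monomials_image[OF S(1)] by blast
  have "I = mono_ideal {..2} E"
    using S(2) E by (simp add: Idl_single_image)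
  then show ?thesis
    using that[OF E(1)] togliattiD[OF E(1) assms(2)] tog by blast
qed

lemma num_gens_le:
  assumes "(I :: (nat, 'k::field_char_0) mpol set) \<in> Tog 2 d"
  shows "num_gens 2 I \<le> d + 1"
proof -
  obtain S where S: "S \<subseteq> forms {..2} d" "finite S" "card S \<le> (2 + d - 1) choose (2 - 1)" "I = Idl\<^bsub>PR 2\<^esub> S"
    using assms unfolding Tog_def togliatti_def by blast
  have "S \<subseteq> carrier (PR 2)"
    using S(1) forms_subset_carrier by blast
  then have "num_gens 2 I \<le> card S"
    unfolding num_gens_def using S by (intro Least_le) blast
  then show ?thesis
    using S(3) by simp
qed

section \<open>The lower bound for the number of generators\<close>

lemma coeff_binomial: "coeff ([:1, 1:] ^ n) k = (of_nat (n choose k) :: 'k::field_char_0)"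
proof (cases "k \<le> n")
  case True
  then show ?thesis
    by (simp add: coeff_linear_poly_power)
next
  case False
  have "degree ([:1, 1 :: 'k:] ^ n) \<le> n"
    using degree_power_le[of "[:1, 1 :: 'k:]" n] by simp
  then show ?thesis
    using False by (simp add: coeff_eq_0 binomial_eq_0)
qed

text \<open>The coefficients of \<open>t ^ k\<close> with \<open>0 < k < d\<close> involve only
  \<gamma> and \<delta>, and two or three of them suffice in each case. The bound on
  \<open>d\<close> excludes x^3 + y^3 + z^3 = 3xyz on the line x + y + z = 0.\<close>

lemma four_monomials_independent:
  fixes \<alpha> \<beta> \<gamma> \<delta> :: "'k::field_char_0"
  assumes d: "d \<ge> 4" and bc: "b + c \<le> d" "(b, c) \<noteq> (0, 0)" "(b, c) \<noteq> (d, 0)" "(b, c) \<noteq> (0, d)"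
    and eq: "\<And>t. \<alpha> + \<beta> * t ^ d + \<gamma> * (1 + t) ^ d + \<delta> * (t ^ b * (1 + t) ^ c) = 0"
  shows "\<alpha> = 0" "\<beta> = 0" "\<gamma> = 0" "\<delta> = 0"
proof -
  define P where "P = [:\<alpha>:] + monom \<beta> d + smult \<gamma> ([:1, 1:] ^ d) + smult \<delta> (monom 1 b * [:1, 1:] ^ c)"
  have "P = 0"
    by (rule poly_eq_0_if_cofinite[of "{}"]) (use eq in \<open>simp_all add: P_def poly_monom\<close>)
  then have "coeff P k = 0" for k
    by simp
  have co: "(if k = 0 then \<alpha> else 0) + (if d = k then \<beta> else 0) + \<gamma> * of_nat (d choose k) +
      (if k < b then 0 else \<delta> * of_nat (c choose (k - b))) = 0" for k
    using \<open>coeff P k = 0\<close>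
    by (simp add: P_def coeff_binomial coeff_monom_mult coeff_pCons' if_distrib[of "(*) _"] cong: if_cong)
  have mid: "\<gamma> * of_nat (d choose k) + (if k < b then 0 else \<delta> * of_nat (c choose (k - b))) = 0"
    if "0 < k" "k < d" for k
    using co[of k] that by simp
  show \<gamma>: "\<gamma> = 0"
  proof (rule ccontr)
    assume nz: "\<gamma> \<noteq> 0"
    consider "b \<ge> 2" | "b = 1" | "b = 0" "c < d - 1" | "b = 0" "c = d - 1"
      using bc by force
    then show False
    proof cases
      case 1
      then show ?thesis
        using mid[of 1] d nz by simp
    next
      case 2
      have "\<delta> = - \<gamma> * of_nat d"
        using mid[of 1] 2 d by (simp add: eq_neg_iff_add_eq_0 add.commute)
      then have "\<gamma> * of_nat (d choose k) = \<gamma> * of_nat (d * (c choose (k - 1)))" if "1 < k" "k < d" for k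
        using mid[of k] 2 that by (simp add: mult.assoc)
      then have rel: "d choose k = d * (c choose (k - 1))" if "1 < k" "k < d" for k
        using nz that by (metis mult_left_cancel of_nat_eq_iff)
      \<comment> \<open>The coefficients for \<open>k = 2\<close> and \<open>k = 3\<close>, the
        latter available as \<open>d \<ge> 4\<close>, give \<open>2 * c = d - 1\<close> and
        \<open>3 * (c choose 2) = (2 * c) choose 2\<close>; together they force
        \<open>c = 0\<close>.\<close>
      have "2 * (d choose 2) = d * (d - 1)" "3 * (d choose 3) = d * ((d - 1) choose 2)"
        using times_binomial_minus1_eq[of 2 d] times_binomial_minus1_eq[of 3 d] by simp_all
      then have "d * (2 * c) = d * (d - 1)" "d * (3 * (c choose 2)) = d * ((d - 1) choose 2)"
        using rel[of 2] rel[of 3] d by (simp_all add: mult.left_commute)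
      then have "2 * c = d - 1" "3 * (c choose 2) = (d - 1) choose 2"
        using d by simp_all
      then have "3 * (c choose 2) = (2 * c) choose 2"
        by simp
      moreover have "2 * (c choose 2) = c * (c - 1)" "2 * ((2 * c) choose 2) = c * (2 * (2 * c - 1))"
        using times_binomial_minus1_eq[of 2 c] times_binomial_minus1_eq[of 2 "2 * c"] by simp_all
      moreover have "c * (3 * (c - 1)) = 3 * (c * (c - 1))"
        by simp
      ultimately have "c * (3 * (c - 1)) = c * (2 * (2 * c - 1))"
        by linarith
      then have "c = 0"
        by auto
      then show ?thesis
        using \<open>2 * c = d - 1\<close> d by simp
    next
      case 3
      then show ?thesis
        using mid[of "d - 1"] d nz by (simp add: binomial_eq_0)
    next
      case 4
      have "d choose (d - 1) = d"
        using binomial_symmetric[of "d - 1" d] d by simp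
      then have "\<delta> = - \<gamma> * of_nat d"
        using mid[of "d - 1"] 4 d by (simp add: eq_neg_iff_add_eq_0 add.commute)
      then have "\<gamma> * of_nat (d choose (d - 2)) = \<gamma> * of_nat (d * ((d - 1) choose (d - 2)))"
        using mid[of "d - 2"] 4 d by (simp add: mult.assoc)
      then have "d choose (d - 2) = d * ((d - 1) choose (d - 2))"
        using nz by (metis mult_left_cancel of_nat_eq_iff)
      moreover have "d choose (d - 2) = d choose 2" "(d - 1) choose (d - 2) = d - 1"
        using d binomial_symmetric[of "d - 2" d] binomial_symmetric[of "d - 2" "d - 1"] by simp_all
      moreover have "2 * (d choose 2) = d * (d - 1)"
        using times_binomial_minus1_eq[of 2 d] by simp
      ultimately show ?thesis
        using d by simp
    qed
  qed
  \<comment> \<open>With \<gamma> gone, the lowest term of the fourth monomial has degree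
    \<open>b\<close> and coefficient \<delta>. If \<open>b = 0\<close>, this degree is not strictly
    between 0 and \<open>d\<close>, and the leading term of degree \<open>c\<close> is used.\<close>
  show \<delta>: "\<delta> = 0"
  proof -
    have "b < d" "b = 0 \<Longrightarrow> 0 < c \<and> c < d"
      using bc by auto
    then show ?thesis
      using mid[of b] mid[of c] \<gamma> by (cases "b = 0") auto
  qed
  show "\<alpha> = 0" "\<beta> = 0"
    using co[of 0] co[of d] \<gamma> \<delta> d by (auto split: if_splits)
qed

definition corner_expos :: "nat \<Rightarrow> nat expo set" where
  "corner_expos d = {single 0 d, single 1 d, single 2 d}"

lemma single_eq_expo3:
  "single 0 d = expo3 0 d 1 0 2 0" "single (Suc 0) d = expo3 0 0 1 d 2 0" "single 2 d = expo3 0 0 1 0 2 d"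
  by (simp_all add: expo3_def)

lemma corner_expos_subset: "corner_expos d \<subseteq> expos {..2} d"
  by (auto simp: corner_expos_def expos_def)

lemma corner_subset_iff: "(\<forall>i\<le>2. single i d \<in> E) \<longleftrightarrow> corner_expos d \<subseteq> E"
  using xyz.ball_le_2 by (auto simp: corner_expos_def)

lemma sum_corner_expos:
  assumes "d > 0"
  shows "sum f (corner_expos d) = f (single 0 d) + f (single 1 d) + f (single 2 d)"
proof -
  have "single i d \<noteq> single j d" if "i \<noteq> j" for i j :: nat
    using that assms by (metis keys_single less_numeral_extra(3) singleton_inject)
  then show ?thesis
    by (simp add: corner_expos_def add.assoc)
qed

lemma card_corner_expos: "d > 0 \<Longrightarrow> card (corner_expos d) = 3"
  using sum_corner_expos[of d "\<lambda>_. 1::nat"] by simp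

lemma line_dependent_card:
  assumes E: "E \<subseteq> expos {..2} d" and d: "d \<ge> 4" and corners: "corner_expos d \<subseteq> E"
    and dep: "line_dependent TYPE('k::field_char_0) E"
  shows "card E \<ge> 5"
proof (rule ccontr)
  assume "\<not> card E \<ge> 5"
  have fin: "finite E"
    using E finite_expos[of "{..2::nat}" d] finite_subset by auto
  have "finite (corner_expos d)"
    by (simp add: corner_expos_def)
  then have "card (E - corner_expos d) \<le> 1"
    using \<open>\<not> card E \<ge> 5\<close> card_Diff_subset[OF _ corners] card_corner_expos[of d] d by simp
  then obtain m0 where sub: "E - corner_expos d \<subseteq> {m0}"
    using card_le_Suc0_iff_eq[of "E - corner_expos d"] fin by (cases "E - corner_expos d = {}") auto
  obtain c :: "nat expo \<Rightarrow> 'k" where c: "\<exists>m\<in>E. c m \<noteq> 0"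
      "\<And>t. (\<Sum>m\<in>E. c m * (t ^ lookup m 1 * (1 + t) ^ lookup m 2)) = 0"
    using dep unfolding line_dependent_def by blast
  \<comment> \<open>If \<open>E\<close> consists of the corners only, an arbitrary further monomial
    with coefficient 0 is added, so that three and four monomials are treated alike.\<close>
  define m1 where "m1 = (if E = corner_expos d then expo3 0 (d - 1) 1 1 2 0 else m0)"
  define \<delta> where "\<delta> = (if E = corner_expos d then 0 else c m0)"
  have m1: "m1 \<in> expos {..2} d" "m1 \<notin> corner_expos d"
  proof -
    have "expo3 0 (d - 1) 1 1 2 0 \<in> expos {..2} d"
      using d by (intro xyz.expo3_in_expos) simp
    then show "m1 \<in> expos {..2} d"
      using E sub corners by (auto simp only: m1_def split: if_splits)
    have "expo3 0 (d - 1) 1 1 2 0 \<notin> corner_expos d"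
      using d by (simp add: corner_expos_def single_eq_expo3)
    then show "m1 \<notin> corner_expos d"
      using sub corners by (auto simp: m1_def)
  qed
  obtain a b b' where abc: "m1 = expo3 0 a 1 b 2 b'" "a + b + b' = d"
    by (rule expos_three_cases[OF m1(1)])
  have ne: "(b, b') \<noteq> (0, 0)" "(b, b') \<noteq> (d, 0)" "(b, b') \<noteq> (0, d)"
    using m1(2) abc by (auto simp: corner_expos_def single_eq_expo3)
  have "c (single 0 d) + c (single 1 d) * t ^ d + c (single 2 d) * (1 + t) ^ d + \<delta> * (t ^ b * (1 + t) ^ b') = 0" for t
  proof -
    let ?f = "\<lambda>m. c m * (t ^ lookup m 1 * (1 + t) ^ lookup m 2)"
    have "sum ?f E = sum ?f (corner_expos d) + sum ?f (E - corner_expos d)"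
      using sum.subset_diff[OF corners fin, of ?f] by (simp add: add.commute)
    also have "sum ?f (E - corner_expos d) = \<delta> * (t ^ b * (1 + t) ^ b')"
    proof (cases "E = corner_expos d")
      case True
      then show ?thesis
        by (simp add: \<delta>_def)
    next
      case False
      then have "E - corner_expos d = {m1}"
        using sub corners by (auto simp: m1_def)
      moreover have "m1 = m0"
        using False by (simp add: m1_def)
      ultimately show ?thesis
        using False abc xyz.lookup_expo3[of a b b'] by (simp add: \<delta>_def)
    qed
    finally show ?thesis
      using c(2)[of t] d by (simp add: sum_corner_expos lookup_single)
  qed
  note zero = four_monomials_independent[OF d _ ne this]
  have "c (single 0 d) = 0" "c (single 1 d) = 0" "c (single 2 d) = 0" "\<delta> = 0"
    by (rule zero; use abc in simp)+
  then have "c m = 0" if "m \<in> E" for m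
    using that sub by (auto simp: corner_expos_def \<delta>_def split: if_splits)
  then show False
    using c(1) by blast
qed

section \<open>Minimal smooth systems\<close>

text \<open>The monomials in the syzygy \<open>(z\<^sup>e - (- x - y)\<^sup>e) x\<^sup>a y\<^sup>b z\<^sup>c\<close> on the line \<open>x + y + z = 0\<close>, together with the corners.\<close>

definition binomial_expos :: "nat \<Rightarrow> nat \<Rightarrow> nat \<Rightarrow> nat \<Rightarrow> nat expo set" where
  "binomial_expos e a b c =
    (\<lambda>i. expo3 0 (a + (e - i)) 1 (b + i) 2 c) ` {..e} \<union> {expo3 0 a 1 b 2 (c + e)}"

definition syzygy_expos :: "nat \<Rightarrow> nat \<Rightarrow> nat \<Rightarrow> nat \<Rightarrow> nat expo set" where
  "syzygy_expos e a b c = corner_expos (a + b + c + e) \<union> binomial_expos e a b c"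

lemma syzygy_expos_subset: "syzygy_expos e a b c \<subseteq> expos {..2} (a + b + c + e)"
proof -
  have "expo3 0 (a + (e - i)) 1 (b + i) 2 c \<in> expos {..2} (a + b + c + e)" if "i \<le> e" for i
    using that by (intro xyz.expo3_in_expos) simp
  moreover have "expo3 0 a 1 b 2 (c + e) \<in> expos {..2} (a + b + c + e)"
    by (intro xyz.expo3_in_expos) simp
  ultimately show ?thesis
    using corner_expos_subset unfolding syzygy_expos_def binomial_expos_def by blast
qed

lemma corner_in_syzygy_expos:
  assumes "i \<le> 2"
  shows "single i (a + b + c + e) \<in> syzygy_expos e a b c"
proof -
  have "corner_expos (a + b + c + e) \<subseteq> syzygy_expos e a b c"
    by (simp add: syzygy_expos_def)
  then show ?thesis
    using corner_subset_iff assms by blast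
qed

lemma expo3_add: "expo3 0 a 1 b 2 c + expo3 0 a' 1 b' 2 c' = expo3 0 (a + a') 1 (b + b') 2 (c + c')"
  by (simp add: expo3_def single_add add_ac)

text \<open>The linear form is \<open>x - y\<close>, where \<open>x\<close> is the scaled third
  variable and \<open>y\<close> is minus the rest. It divides \<open>x ^ e - y ^ e\<close>, and
  \<open>F\<close> is the monomial \<open>m\<close> times the quotient. The support is controlled
  because \<open>x ^ e\<close> involves only variable 2 and \<open>y ^ e\<close> only variables 0
  and 1.\<close>

lemma syzygy_exists:
  fixes \<alpha> :: "nat \<Rightarrow> 'k::field_char_0"
  assumes \<alpha>: "\<alpha> 0 \<noteq> 0" "\<alpha> 1 \<noteq> 0" "\<alpha> 2 \<noteq> 0" and e: "e \<ge> 1" and d: "a + b + c + e = d"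
  shows "\<exists>F\<in>forms {..2} (d - 1). F \<noteq> 0 \<and> lin_form 2 \<alpha> * F \<in> mono_ideal {..2} (syzygy_expos e a b c)"
proof
  let ?v = "\<lambda>i. single (single i (1::nat)) (\<alpha> i)"
  define m where "m = expo3 0 a 1 b 2 c"
  define x :: "(nat, 'k) mpol" where "x = ?v 2"
  define y :: "(nat, 'k) mpol" where "y = - (?v 0 + ?v 1)"
  define F where "F = single m 1 * (\<Sum>i<e. y ^ (e - Suc i) * x ^ i)"
  have v: "?v i \<in> forms V 1" if "i \<in> V" for V i
    using that by (intro forms_single) (simp add: expos_def)
  have x: "x \<in> forms V 1" if "2 \<in> V" for V
    unfolding x_def using that by (rule v)
  have y: "y \<in> forms V 1" if "0 \<in> V" "1 \<in> V" for V
    unfolding y_def using that by (intro forms_uminus forms_add v)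
  have m: "single m (1::'k) \<in> forms {..2} (a + b + c)"
    unfolding m_def by (intro forms_single xyz.expo3_in_expos) simp
  have "(\<Sum>i<e. y ^ (e - Suc i) * x ^ i) \<in> forms {..2} (e - 1)"
  proof (rule forms_sum)
    fix i assume i: "i \<in> {..<e}"
    have "y ^ (e - Suc i) * x ^ i \<in> forms {..2} ((e - Suc i) * 1 + i * 1)"
      by (intro forms_mult forms_power x y) simp_all
    then show "y ^ (e - Suc i) * x ^ i \<in> forms {..2} (e - 1)"
      using i by simp
  qed
  then have "F \<in> forms {..2} (a + b + c + (e - 1))"
    unfolding F_def by (rule forms_mult[OF m])
  then show F: "F \<in> forms {..2} (d - 1)"
    using e d by simp
  have L: "lin_form 2 \<alpha> = x - y"
    by (simp add: lin_form_def x_def y_def numeral_2_eq_2)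
  have LF: "lin_form 2 \<alpha> * F = single m 1 * x ^ e - single m 1 * y ^ e"
    unfolding L F_def right_diff_distrib[symmetric] power_diff_sumr2[of x e y] by (simp add: mult_ac)
  show "F \<noteq> 0 \<and> lin_form 2 \<alpha> * F \<in> mono_ideal {..2} (syzygy_expos e a b c)"
  proof
    \<comment> \<open>A point with \<open>x = 1\<close>, \<open>y = 0\<close> and all coordinates
      nonzero; the product is nonzero there, hence so is \<open>F\<close>.\<close>
    define p where "p i = (if i = 0 then 1 / \<alpha> 0 else if i = 1 then - 1 / \<alpha> 1 else 1 / \<alpha> 2)" for i :: nat
    have "eval_mpol x p = 1" "eval_mpol y p = 0"
      using \<alpha> by (simp_all add: x_def y_def p_def)
    then have "eval_mpol (lin_form 2 \<alpha> * F) p = mono_val m p"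
      using e unfolding LF by (simp add: zero_power)
    also have "mono_val m p \<noteq> 0"
      using \<alpha> by (simp add: m_def p_def)
    finally show "F \<noteq> 0"
      by auto
    have mem: "m + t \<in> binomial_expos e a b c" if t: "t \<in> expos {2} e \<union> expos {0, 1} e" for t
    proof -
      have "t \<in> expos {..2} e"
        using t by (auto simp: expos_def)
      then obtain a' b' c' where abc: "t = expo3 0 a' 1 b' 2 c'" "a' + b' + c' = e"
        by (rule expos_three_cases)
      have l: "lookup t 0 = a'" "lookup t 1 = b'" "lookup t 2 = c'"
        unfolding abc(1) xyz.lookup_expo3 by simp_all
      have "(a' = 0 \<and> b' = 0) \<or> c' = 0"
      proof (cases "t \<in> expos {2} e")
        case True
        then have "0 \<notin> keys t" "1 \<notin> keys t"
          by (auto simp: expos_def)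
        then show ?thesis
          using l by (simp add: in_keys_iff)
      next
        case False
        then have "2 \<notin> keys t"
          using t by (auto simp: expos_def)
        then show ?thesis
          using l by (simp add: in_keys_iff)
      qed
      then show ?thesis
      proof
        assume "a' = 0 \<and> b' = 0"
        then have "m + t = expo3 0 a 1 b 2 (c + e)"
          using abc by (simp only: m_def expo3_add) simp
        then show ?thesis
          by (simp add: binomial_expos_def)
      next
        assume "c' = 0"
        then have "a' = e - b'" "b' \<le> e"
          using abc(2) by auto
        then have "m + t = expo3 0 (a + (e - b')) 1 (b + b') 2 c"
          using abc(1) \<open>c' = 0\<close> by (simp only: m_def expo3_add) simp
        then show ?thesis
          using \<open>b' \<le> e\<close> unfolding binomial_expos_def by blast
      qed
    qed
    have "keys (single m 1 * x ^ e) \<subseteq> binomial_expos e a b c"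
      using Poly_Mapping.keys_mult[of "single m 1" "x ^ e"] forms_power[OF x[of "{2}"], of e] mem
      by (fastforce simp: forms_def)
    moreover have "keys (single m 1 * y ^ e) \<subseteq> binomial_expos e a b c"
      using Poly_Mapping.keys_mult[of "single m 1" "y ^ e"] forms_power[OF y[of "{0, 1}"], of e] mem
      by (fastforce simp: forms_def)
    ultimately have "keys (lin_form 2 \<alpha> * F) \<subseteq> syzygy_expos e a b c"
      unfolding LF syzygy_expos_def using keys_diff[of "single m 1 * x ^ e" "single m 1 * y ^ e"] by blast
    moreover have "lin_form 2 \<alpha> * F \<in> forms {..2} d"
      using mult_lin_form_in_forms[OF F] e d by simp
    ultimately show "lin_form 2 \<alpha> * F \<in> mono_ideal {..2} (syzygy_expos e a b c)"
      using forms_in_mono_ideal[OF syzygy_expos_subset] d by blast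
  qed
qed

lemma togliatti_syzygy_expos:
  assumes e: "e \<ge> 1" and d: "a + b + c + e = d" and "card (syzygy_expos e a b c) \<le> d + 1"
  shows "togliatti 2 d (mono_ideal {..2} (syzygy_expos e a b c) :: (nat, 'k::field_char_0) mpol set)"
proof (rule togliattiI)
  show "syzygy_expos e a b c \<subseteq> expos {..2} d"
    using syzygy_expos_subset d by blast
  show "single i d \<in> syzygy_expos e a b c" if "i \<le> 2" for i
    using corner_in_syzygy_expos[OF that] d by blast
  show "\<exists>F\<in>forms {..2} (d - 1). F \<noteq> 0 \<and> lin_form 2 \<alpha> * F \<in> mono_ideal {..2} (syzygy_expos e a b c)"
    if "\<alpha> 0 \<noteq> 0" "\<alpha> 1 \<noteq> 0" "\<alpha> 2 \<noteq> 0" for \<alpha> :: "nat \<Rightarrow> 'k"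
    by (rule syzygy_exists[OF that e d])
qed (use assms in auto)

section \<open>Smooth systems with a prescribed number of generators\<close>

lemma assoc_expos_mono_ideal:
  assumes "E \<subseteq> expos {..n} d"
  shows "assoc_expos n d (mono_ideal {..n} E :: (nat, 'k::field) mpol set) = expos {..n} d - E"
  unfolding assoc_expos_def using single_in_mono_ideal[OF assms, where 'k='k] by blast

lemma Tog_smoothI:
  assumes "E \<subseteq> expos {..2} d" "(mono_ideal {..2} E :: (nat, 'k::field_char_0) mpol set) \<in> Tog 2 d"
    and "truncated_triangle (expos {..2} d - E) d k"
  shows "(mono_ideal {..2} E :: (nat, 'k) mpol set) \<in> Tog_smooth 2 d"
  using assms(2) truncated_triangle.smooth[OF assms(3), where 'k='k]
  by (simp add: Tog_smooth_def assoc_variety_def assoc_expos_mono_ideal[OF assms(1)])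

lemma lookup_eq_degree:
  assumes "m \<in> expos {..2} d" "i \<le> 2" "lookup m i \<ge> d"
  shows "m \<in> corner_expos d"
proof -
  obtain a b c where m: "m = expo3 0 a 1 b 2 c" "a + b + c = d"
    by (rule expos_three_cases[OF assms(1)])
  have "lookup m 0 = a" "lookup m 1 = b" "lookup m 2 = c"
    unfolding m(1) xyz.lookup_expo3 by simp_all
  moreover have "i = 0 \<or> i = 1 \<or> i = 2"
    using assms(2) by auto
  ultimately show ?thesis
    using assms(3) m by (auto simp: corner_expos_def single_eq_expo3)
qed

lemma corner_expos_lookup: "m \<in> corner_expos d \<Longrightarrow> \<exists>i\<le>2. lookup m i = d"
  unfolding corner_expos_def by (elim insertE) (auto intro: exI[of _ 0] exI[of _ 1] exI[of _ 2])

text \<open>Here the lower bound does double duty: applied to \<open>E\<close> it shows that the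
  five monomials are distinct, and applied to proper subsets it gives minimality.\<close>

lemma five_generators:
  assumes d: "d \<ge> 4"
  shows "\<exists>I :: (nat, 'k::field_char_0) mpol set. I \<in> Tog_smooth 2 d \<and> num_gens 2 I = 5"
proof -
  define E where "E = syzygy_expos 1 0 0 (d - 1)"
  have sub: "E \<subseteq> expos {..2} d"
    using syzygy_expos_subset[of 1 0 0 "d - 1"] d by (simp add: E_def)
  have E_eq: "E = corner_expos d \<union> {expo3 0 1 1 0 2 (d - 1), expo3 0 0 1 1 2 (d - 1)}"
    using d by (auto simp: E_def syzygy_expos_def binomial_expos_def corner_expos_def single_eq_expo3 atMost_Suc)
  have "card E \<le> card (corner_expos d) + card {expo3 0 1 1 0 2 (d - 1), expo3 0 0 1 1 2 (d - 1)}"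
    unfolding E_eq by (rule card_Un_le)
  also have "\<dots> \<le> 3 + 2"
    using d by (intro add_mono) (simp_all add: card_corner_expos card_insert_if)
  finally have le: "card E \<le> 5"
    by simp
  have tog: "togliatti 2 d (mono_ideal {..2} E :: (nat, 'k) mpol set)"
    unfolding E_def by (rule togliatti_syzygy_expos) (use d le in \<open>simp_all add: E_def\<close>)
  have "d \<ge> 1"
    using d by simp
  have corners: "corner_expos d \<subseteq> E"
    unfolding E_eq by (rule Un_upper1)
  have fin: "finite E"
    using sub finite_expos[of "{..2::nat}" d] finite_subset by auto
  have card: "card E = 5"
    using le line_dependent_card[OF sub d corners togliattiD(2)[OF sub \<open>d \<ge> 1\<close> tog]] by simp
  have Tog: "(mono_ideal {..2} E :: (nat, 'k) mpol set) \<in> Tog 2 d"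
  proof (rule TogI[OF sub \<open>d \<ge> 1\<close> tog])
    fix E' assume E': "E' \<subset> E" "\<And>i. i \<le> 2 \<Longrightarrow> single i d \<in> E'"
    have "card E' < 5"
      using psubset_card_mono[OF fin E'(1)] card by simp
    moreover have "corner_expos d \<subseteq> E'" "E' \<subseteq> expos {..2} d"
      using E' corner_subset_iff sub by blast+
    ultimately show "\<not> line_dependent TYPE('k) E'"
      using line_dependent_card[of E' d] d by force
  qed
  \<comment> \<open>All exponents with last entry \<open>d\<close> or \<open>d - 1\<close> are
    removed, which cuts that corner at height 2.\<close>
  have "truncated_triangle (expos {..2} d - E) d 2"
  proof
    fix m i assume m: "m \<in> expos {..2} d - E" and i: "i \<le> (2::nat)"
    obtain a b c where abc: "m = expo3 0 a 1 b 2 c" "a + b + c = d"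
      using expos_three_cases m by blast
    have l: "lookup m 0 = a" "lookup m 1 = b" "lookup m 2 = c"
      unfolding abc(1) xyz.lookup_expo3 by simp_all
    have "lookup m i < d"
      using lookup_eq_degree[of m d i] m i corners by (meson DiffD1 DiffD2 not_le subsetD)
    moreover have "c \<noteq> d - 1"
    proof
      assume "c = d - 1"
      then have "(a = 1 \<and> b = 0) \<or> (a = 0 \<and> b = 1)"
        using abc(2) d by auto
      then have "m \<in> E"
        using \<open>c = d - 1\<close> by (auto simp: abc(1) E_eq)
      then show False
        using m by simp
    qed
    ultimately show "lookup m i + cut_height 2 i \<le> d"
      using l by (cases "i = 2") (auto simp: cut_height_def)
  next
    fix m assume m: "m \<in> expos {..2} d" "\<forall>i\<le>2. lookup m i + cut_height 2 i \<le> d"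
    have "lookup m 2 + 2 \<le> d" "lookup m i < d" if "i \<le> 2" for i
      using m(2) that by (auto simp: cut_height_def split: if_splits)
    then have "m \<notin> corner_expos d" "lookup m 2 \<noteq> d - 1"
      using corner_expos_lookup[of m d] d by fastforce+
    then show "m \<in> expos {..2} d - E"
      using m(1) by (auto simp: E_eq)
  qed (use d in auto)
  then have "(mono_ideal {..2} E :: (nat, 'k) mpol set) \<in> Tog_smooth 2 d"
    by (rule Tog_smoothI[OF sub Tog])
  moreover have "num_gens 2 (mono_ideal {..2} E :: (nat, 'k) mpol set) = 5"
    using num_gens_mono_ideal[OF sub] card by simp
  ultimately show ?thesis
    by blast
qed

text \<open>The inner part has degree at most \<open>e + 2 \<le> d - 2\<close>, so the coefficient
  of \<open>t ^ (d - 1)\<close> shows \<gamma> alone; \<beta> and \<alpha> follow from degrees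
  \<open>d\<close> and 0. After division by \<open>t * (1 + t)\<close> the remaining relation is the
  binomial expansion up to the factor \<open>q'\<close>.\<close>

lemma interior_syzygy_unique:
  fixes q :: "nat \<Rightarrow> 'k::field_char_0"
  assumes d: "e + 4 \<le> d"
    and eq: "\<And>t. \<alpha> + \<beta> * t ^ d + \<gamma> * (1 + t) ^ d +
      t * (1 + t) * ((\<Sum>i\<le>e. q i * t ^ i) + q' * (1 + t) ^ e) = 0"
  shows "\<alpha> = 0" "\<beta> = 0" "\<gamma> = 0" "i \<le> e \<Longrightarrow> q i = - q' * of_nat (e choose i)"
proof -
  define R where "R = (\<Sum>i\<le>e. monom (q i) i) + smult q' ([:1, 1:] ^ e)"
  define Q where "Q = [:0, 1, 1:] * R"
  define P where "P = [:\<alpha>:] + monom \<beta> d + smult \<gamma> ([:1, 1:] ^ d) + Q"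
  have "P = 0"
    by (rule poly_eq_0_if_cofinite[of "{}"])
      (use eq in \<open>simp_all add: P_def Q_def R_def poly_monom poly_sum algebra_simps\<close>)
  have "degree R \<le> e"
    unfolding R_def
  proof (intro degree_add_le degree_sum_le)
    show "degree (smult q' ([:1, 1:] ^ e)) \<le> e"
      using degree_power_le[of "[:1, 1 :: 'k:]" e] degree_smult_le[of q' "[:1, 1:] ^ e"] by simp
  qed (auto intro: order.trans[OF degree_monom_le])
  then have "degree Q < d - 1"
    using degree_mult_le[of "[:0, 1, 1 :: 'k:]" R] d by (simp only: Q_def) simp
  then have deg: "coeff Q k = 0" if "k \<ge> d - 1" for k
    using that by (intro coeff_eq_0) simp
  have co: "coeff P k = 0" for k
    by (simp add: \<open>P = 0\<close>)
  have "d choose (d - 1) = d"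
    using binomial_symmetric[of "d - 1" d] d by simp
  moreover have "d \<noteq> d - 1"
    using d by simp
  ultimately show \<gamma>: "\<gamma> = 0"
    using co[of "d - 1"] deg[of "d - 1"] d by (simp add: P_def coeff_binomial coeff_pCons')
  show \<beta>: "\<beta> = 0"
    using co[of d] deg[of d] d \<gamma> by (simp add: P_def coeff_pCons')
  show \<alpha>: "\<alpha> = 0"
    using co[of 0] d \<gamma> by (simp add: P_def Q_def)
  have "Q = 0"
    using \<open>P = 0\<close> \<alpha> \<beta> \<gamma> by (simp add: P_def)
  then have "[:0, 1, 1:] * R = 0"
    by (simp only: Q_def)
  then have "coeff R i = 0"
    by (simp only: mult_eq_0_iff) simp
  then show "q i = - q' * of_nat (e choose i)" if "i \<le> e"
    using that by (simp add: R_def coeff_sum coeff_binomial eq_neg_iff_add_eq_0)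
qed

text \<open>The relations among the monomials form a line spanned by the binomial syzygy, in which
  every inner monomial has a nonzero coefficient. Removing any one of them leaves no relation, which
  is minimality.\<close>

lemma six_or_more_generators:
  assumes r: "6 \<le> r" "r \<le> d + 1"
  shows "\<exists>I :: (nat, 'k::field_char_0) mpol set. I \<in> Tog_smooth 2 d \<and> num_gens 2 I = r"
proof -
  define e where "e = r - 5"
  \<comment> \<open>This is \<open>d - e - 2\<close>; the bound \<open>r \<le> d + 1\<close> makes
    it at least 2.\<close>
  define a where "a = d + 3 - r"
  have e: "1 \<le> e" "e + 4 \<le> d" "a + e = d - 2" "a \<ge> 2" "a + 1 + 1 + e = d" "e + 5 = r"
    using r by (auto simp: e_def a_def)
  define E where "E = syzygy_expos e a 1 1"
  define f where "f i = expo3 0 (a + (e - i)) 1 (1 + i) 2 1" for i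
  define g where "g = expo3 0 a 1 1 2 (1 + e)"
  have sub: "E \<subseteq> expos {..2} d"
    using syzygy_expos_subset[of e a 1 1] e by (simp add: E_def)
  have E_eq: "E = corner_expos d \<union> (f ` {..e} \<union> {g})"
    using e by (simp add: E_def syzygy_expos_def binomial_expos_def f_def[abs_def] g_def)
  have lf: "lookup (f i) 0 = a + (e - i)" "lookup (f i) 1 = 1 + i" "lookup (f i) 2 = 1" for i
    unfolding f_def xyz.lookup_expo3 by simp_all
  have lg: "lookup g 0 = a" "lookup g 1 = 1" "lookup g 2 = 1 + e"
    unfolding g_def xyz.lookup_expo3 by simp_all
  have fin: "finite E"
    using sub finite_expos[of "{..2::nat}" d] finite_subset by auto
  have inj: "inj_on f {..e}"
    by (rule inj_onI) (use lf(2) in \<open>metis add_left_cancel\<close>)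
  have g_notin: "g \<notin> f ` {..e}"
    using lf(3) lg(3) e(1) by (metis add_cancel_right_right imageE not_one_le_zero)
  have inner: "1 \<le> lookup m i" if "m \<in> f ` {..e} \<union> {g}" "i \<le> 2" for m i
  proof -
    have "i = 0 \<or> i = 1 \<or> i = 2"
      using that(2) by auto
    then show ?thesis
      using that(1) lf lg e by auto
  qed
  have disj: "corner_expos d \<inter> (f ` {..e} \<union> {g}) = {}"
  proof -
    have "m \<notin> f ` {..e} \<union> {g}" if "m \<in> corner_expos d" for m
    proof
      assume "m \<in> f ` {..e} \<union> {g}"
      then have "1 \<le> lookup m 0" "1 \<le> lookup m 1"
        using inner[of m] by simp_all
      then show False
        using that by (auto simp: corner_expos_def lookup_single)
    qed
    then show ?thesis
      by blast
  qed
  have finc: "finite (corner_expos d)"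
    by (simp add: corner_expos_def)
  have "card E = card (corner_expos d) + card (f ` {..e} \<union> {g})"
    unfolding E_eq using finc disj by (intro card_Un_disjoint) auto
  also have "\<dots> = r"
    using e g_notin inj by (simp add: card_corner_expos card_image)
  finally have card: "card E = r" .
  have tog: "togliatti 2 d (mono_ideal {..2} E :: (nat, 'k) mpol set)"
    unfolding E_def by (rule togliatti_syzygy_expos) (use e card r in \<open>simp_all add: E_def\<close>)
  have "d \<ge> 1"
    using e by simp
  have Tog: "(mono_ideal {..2} E :: (nat, 'k) mpol set) \<in> Tog 2 d"
  proof (rule TogI[OF sub \<open>d \<ge> 1\<close> tog], rule notI)
    fix E' assume E': "E' \<subset> E" "\<And>i. i \<le> 2 \<Longrightarrow> single i d \<in> E'" and dep: "line_dependent TYPE('k) E'"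
    obtain c' :: "nat expo \<Rightarrow> 'k" where c': "\<exists>m\<in>E'. c' m \<noteq> 0"
        "\<And>t. (\<Sum>m\<in>E'. c' m * (t ^ lookup m 1 * (1 + t) ^ lookup m 2)) = 0"
      using dep unfolding line_dependent_def by blast
    \<comment> \<open>The relation is extended by zero from \<open>E'\<close> to \<open>E\<close>,
      so that the uniqueness of the syzygy applies to it.\<close>
    define c where "c m = (if m \<in> E' then c' m else 0)" for m
    have "c (single 0 d) + c (single 1 d) * t ^ d + c (single 2 d) * (1 + t) ^ d +
      t * (1 + t) * ((\<Sum>i\<le>e. c (f i) * t ^ i) + c g * (1 + t) ^ e) = 0" for t
    proof -
      let ?h = "\<lambda>m. c m * (t ^ lookup m 1 * (1 + t) ^ lookup m 2)"
      have "0 = (\<Sum>m\<in>E'. c' m * (t ^ lookup m 1 * (1 + t) ^ lookup m 2))"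
        by (rule c'(2)[symmetric])
      also have "\<dots> = sum ?h E"
        using E'(1) fin by (intro sum.mono_neutral_cong_left) (auto simp: c_def)
      also have "\<dots> = sum ?h (corner_expos d) + sum ?h (f ` {..e} \<union> {g})"
        unfolding E_eq using finc disj by (intro sum.union_disjoint) auto
      also have "sum ?h (f ` {..e} \<union> {g}) = (\<Sum>i\<le>e. ?h (f i)) + ?h g"
        using g_notin inj by (simp add: sum.reindex add.commute)
      also have "(\<Sum>i\<le>e. ?h (f i)) = t * (1 + t) * (\<Sum>i\<le>e. c (f i) * t ^ i)"
        unfolding lf by (simp add: sum_distrib_left mult_ac)
      also have "?h g = t * (1 + t) * (c g * (1 + t) ^ e)"
        unfolding lg by simp
      also have "sum ?h (corner_expos d) = c (single 0 d) + c (single 1 d) * t ^ d + c (single 2 d) * (1 + t) ^ d"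
        using \<open>d \<ge> 1\<close> by (simp add: sum_corner_expos lookup_single)
      finally show ?thesis
        by (simp add: distrib_left add.assoc)
    qed
    note zero = interior_syzygy_unique[OF e(2) this]
    have "corner_expos d \<subseteq> E'"
      using E'(2) corner_subset_iff by blast
    then obtain m where "m \<in> f ` {..e} \<union> {g}" "m \<notin> E'"
      using E'(1) E_eq by blast
    then have "c g = 0"
    proof (elim UnE imageE)
      fix i assume "m = f i" "i \<in> {..e}" "m \<notin> E'"
      then show "c g = 0"
        \<comment> \<open>The missing coefficient equals \<open>- c g * of_nat (e choose i)\<close>,
          and the binomial coefficient is nonzero in characteristic zero.\<close>
        using zero(4)[of i] by (simp add: c_def)
    qed (simp add: c_def)
    then have "c m = 0" if "m \<in> E" for m
      using that zero unfolding E_eq corner_expos_def by auto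
    then show False
      using c'(1) E'(1) unfolding c_def by (metis psubsetD)
  qed
  \<comment> \<open>Apart from the corners only multiples of xyz are removed, so the boundary is
    intact and every corner is cut at height 1.\<close>
  have "truncated_triangle (expos {..2} d - E) d 1"
  proof
    fix m i assume m: "m \<in> expos {..2} d - E" and i: "i \<le> (2::nat)"
    have "lookup m i < d"
      using lookup_eq_degree[of m d i] m i unfolding E_eq by (meson DiffD1 DiffD2 UnI1 not_le)
    then show "lookup m i + cut_height 1 i \<le> d"
      by (auto simp: cut_height_def)
  next
    fix m assume m: "m \<in> expos {..2} d" "\<forall>i\<le>2. lookup m i + cut_height 1 i \<le> d"
      "\<exists>i\<le>2. lookup m i = 0 \<or> cut_height 1 i = 2 \<and> lookup m i + 2 = d"
    have "\<exists>i\<le>2. lookup m i = 0"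
      using m(3) by (auto simp: cut_height_def split: if_splits)
    then have "m \<notin> f ` {..e} \<union> {g}"
      using inner[of m] by fastforce
    moreover have "lookup m i < d" if "i \<le> 2" for i
    proof -
      have "lookup m i + cut_height 1 i \<le> d"
        using m(2) that by blast
      then show ?thesis
        by (simp add: cut_height_def split: if_splits)
    qed
    then have "m \<notin> corner_expos d"
      using corner_expos_lookup[of m d] by fastforce
    ultimately show "m \<in> expos {..2} d - E"
      using m(1) by (simp add: E_eq)
  qed (use e in auto)
  then have "(mono_ideal {..2} E :: (nat, 'k) mpol set) \<in> Tog_smooth 2 d"
    by (rule Tog_smoothI[OF sub Tog])
  moreover have "num_gens 2 (mono_ideal {..2} E :: (nat, 'k) mpol set) = r"
    using num_gens_mono_ideal[OF sub] card by simp
  ultimately show ?thesis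
    by blast
qed

lemma num_gens_ge:
  assumes "(I :: (nat, 'k::field_char_0) mpol set) \<in> Tog 2 d" "d \<ge> 4"
  shows "num_gens 2 I \<ge> 5"
proof -
  obtain E where E: "E \<subseteq> expos {..2} d" "I = mono_ideal {..2} E" "\<And>i. i \<le> 2 \<Longrightarrow> single i d \<in> E"
      "line_dependent TYPE('k) E"
    using TogE[OF assms(1)] assms(2) by (metis le_trans one_le_numeral)
  have "corner_expos d \<subseteq> E"
    using E(3) corner_subset_iff by blast
  then show ?thesis
    using line_dependent_card[OF E(1) assms(2) _ E(4)] num_gens_mono_ideal[OF E(1), where 'k='k] E(2)
    by simp
qed

theorem proposition4p1:
  shows "(\<forall>d \<ge> 4. mu_min_smooth TYPE('k::{alg_closed_field, field_char_0}) 2 d = 5 \<and> mu_min TYPE('k) 2 d = 5)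
    \<and> (\<forall>d \<ge> 4. rho_max_smooth TYPE('k) 2 d = d + 1 \<and> rho_max TYPE('k) 2 d = d + 1)
    \<and> (\<forall>d \<ge> 4. \<forall>r. 5 \<le> r \<and> r \<le> d + 1 \<longrightarrow>
           (\<exists>I :: (nat, 'k) mpol set. I \<in> Tog_smooth 2 d \<and> num_gens 2 I = r))"
proof -
  have ex: "\<exists>I :: (nat, 'k) mpol set. I \<in> Tog_smooth 2 d \<and> num_gens 2 I = r"
    if "d \<ge> 4" "5 \<le> r" "r \<le> d + 1" for d r
    using that five_generators[of d, where 'k='k] six_or_more_generators[of r d, where 'k='k] by (cases "r = 5") auto
  have sm: "Tog_smooth 2 d \<subseteq> (Tog 2 d :: (nat, 'k) mpol set set)" for d
    by (auto simp: Tog_smooth_def)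
  \<comment> \<open>Both sets of systems have exactly this set of generator numbers, as the smooth
    ones attain every value. In particular it is finite, so \<open>Min\<close> and
    \<open>Max\<close> are meaningful.\<close>
  have image: "num_gens 2 ` T = {5..d + 1}"
    if "d \<ge> 4" "Tog_smooth 2 d \<subseteq> T" "T \<subseteq> Tog 2 d" for d and T :: "(nat, 'k) mpol set set"
  proof
    show "num_gens 2 ` T \<subseteq> {5..d + 1}"
      using num_gens_ge num_gens_le that by fastforce
    show "{5..d + 1} \<subseteq> num_gens 2 ` T"
      using ex[OF that(1)] that(2) by (force simp: image_iff)
  qed
  have "Min {5..d + 1} = 5" "Max {5..d + 1} = d + 1" if "d \<ge> 4" for d :: nat
    using that by (auto intro: Min_eqI Max_eqI)
  then show ?thesis
    using ex image sm unfolding mu_min_smooth_def mu_min_def rho_max_smooth_def rho_max_def by simp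
qed

end
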